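(* Let $K\subseteq\mathbb{R}^3$ be a rectangular box with side-lengths $a,b,c>0$, and let $X=\operatorname{length}(\ell\cap K)$ for a random directed line $\ell$ intersecting $K$ (as defined in the context). Then the probability density function of $X$ is given, for $0<t<\sqrt{a^2+b^2+c^2}$, by $$\operatorname{pdf}_X(t)=\frac{F(a,b,c,t)+F(b,c,a,t)+F(c,a,b,t)}{3\pi t^3(ab+ac+bc)},$$ where $F$ is the piecewise-defined function given by $$F(a,b,c,t)=t^3(8a-3t)$$ for $0<t<a$; by $$F(a,b,c,t)=\left(6t^4-a^4+6\pi a^2bc\right)-4(b+c)\sqrt{|t^2-a^2|}\,(a^2+2t^2)$$ for $a<t<\sqrt{a^2+b^2}$; and by $$\begin{aligned}F(a,b,c,t)={}&6\pi a^2bc+b^4-3t^4-6a^2b^2+4c\sqrt{|t^2-a^2-b^2|}\,\left(a^2+b^2+2t^2\right)\\&+4a\sqrt{|t^2-b^2|}\,(b^2+2t^2)-12a^2bc\cdot\arctan\left(\frac{\sqrt{|t^2-a^2-b^2|}}{b}\right)\\&-4c\sqrt{|t^2-a^2|}\,(a^2+2t^2)-12ab^2c\cdot\arctan\left(\frac{\sqrt{|t^2-a^2-b^2|}}{a}\right)\end{aligned}$$ for $\sqrt{a^2+b^2}<t<\sqrt{a^2+b^2+c^2}$.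
   Context: $K=[0,a]\times[0,b]\times[0,c]$. Directed lines $\ell$ in $\mathbb{R}^3$ are parametrized by pairs $(v,q)$, where $v\in\mathbb{S}^{2}$ is the unit direction of $\ell$ and $q$ is the unique point of $\ell$ in the plane $v^\perp$ through the origin orthogonal to $v$. Let $d\ell=dA(q)\,dS(v)$, where $dA$ is area measure on $v^\perp$ and $dS$ is surface area measure on $\mathbb{S}^2$; this is the translation- and rotation-invariant measure on directed lines, unique up to a constant. Restrict $d\ell$ to the set of directed lines intersecting $K$ and normalize it to a probability measure; $X=\operatorname{length}(\ell\cap K)$ where $\ell$ is random with this law. $\operatorname{pdf}_X$ denotes the probability density function of $X$. In the formula for $\operatorname{pdf}_X$, the terms $F(b,c,a,t)$ and $F(c,a,b,t)$ are obtained from the piecewise definition of $F$ (including its ranges of $t$) by permuting the variables $a,b,c$ accordingly. *)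

theory Defs
  imports "HOL-Probability.Probability"
begin

section \<open>The invariant measure on directed lines in three-space\<close>

text \<open>
  Surface area on the unit sphere, in polar-coordinate normalisation: the area of \<open>A\<close> is
  three times the volume of the cone \<open>{r v | 0 < r < 1, v \<in> A}\<close>.
\<close>

definition sphere_area :: "(real^3) measure" where
  "sphere_area =
     distr (scale_measure 3 (restrict_space lborel (ball 0 1 - {0})))
       (restrict_space borel (sphere 0 1)) (\<lambda>x. x /\<^sub>R norm x)"

definition perp :: "real^3 \<Rightarrow> (real^3) set" where
  "perp v = {q. v \<bullet> q = 0}"

text \<open>
  Area on the plane \<open>perp v\<close> for a unit vector \<open>v\<close>: the area of \<open>A\<close> is the volume of the
  cylinder \<open>{q + s v | q \<in> A, 0 \<le> s \<le> 1}\<close> of height one over \<open>A\<close>. By \<open>plane_area_coordinates\<close> below,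
  this is the image of Lebesgue measure on the coordinate plane under any choice of orthonormal
  coordinates in \<open>perp v\<close>.
\<close>

definition plane_area :: "real^3 \<Rightarrow> (real^3) measure" where
  "plane_area v =
     distr (restrict_space lborel {x. 0 \<le> v \<bullet> x \<and> v \<bullet> x \<le> 1})
       (restrict_space borel (perp v)) (\<lambda>x. x - (v \<bullet> x) *\<^sub>R v)"

text \<open>
  The pair \<open>(v, q)\<close> stands for the line through \<open>q\<close> with unit direction \<open>v\<close>, where \<open>q\<close> is its point in
  the plane through the origin orthogonal to \<open>v\<close>.
\<close>

definition directed_lines :: "((real^3) \<times> (real^3)) set" where
  "directed_lines = {(v, q). norm v = 1 \<and> q \<in> perp v}"

definition points_of :: "(real^3) \<times> (real^3) \<Rightarrow> (real^3) set" where
  "points_of l = (case l of (v, q) \<Rightarrow> range (\<lambda>s. q + s *\<^sub>R v))"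

text \<open>
  The measure \<open>dA(q) dS(v)\<close>. The set function below is countably additive, see
  \<open>emeasure_line_measure\<close>.
\<close>

definition line_measure :: "((real^3) \<times> (real^3)) measure" where
  "line_measure =
     measure_of directed_lines (sets (restrict_space borel directed_lines))
       (\<lambda>A. \<integral>\<^sup>+ v. emeasure (plane_area v) {q. (v, q) \<in> A} \<partial>sphere_area)"


section \<open>Random chords of a box\<close>

definition box3 :: "real \<Rightarrow> real \<Rightarrow> real \<Rightarrow> (real^3) set" where
  "box3 a b c = {x. x $ 1 \<in> {0..a} \<and> x $ 2 \<in> {0..b} \<and> x $ 3 \<in> {0..c}}"

definition random_line :: "(real^3) set \<Rightarrow> ((real^3) \<times> (real^3)) measure" where
  "random_line K = uniform_measure line_measure {l \<in> directed_lines. points_of l \<inter> K \<noteq> {}}"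

text \<open>
  One-dimensional Lebesgue measure of the chord, in the unit-speed parametrisation of the line.
\<close>

definition chord_length :: "(real^3) set \<Rightarrow> (real^3) \<times> (real^3) \<Rightarrow> real" where
  "chord_length K l = (case l of (v, q) \<Rightarrow> measure lborel {s. q + s *\<^sub>R v \<in> K})"

text \<open>
  Nonnegativity is required separately because \<open>ennreal\<close> truncates negative values. It is required
  almost everywhere only, as a density is determined only up to a null set.
\<close>

definition is_pdf :: "'a measure \<Rightarrow> ('a \<Rightarrow> real) \<Rightarrow> (real \<Rightarrow> real) \<Rightarrow> bool" where
  "is_pdf M X f \<longleftrightarrow>
     (AE t in lborel. 0 \<le> f t) \<and> distributed M lborel X (\<lambda>t. ennreal (f t))"

text \<open>
  The value \<open>0\<close> at the two break points (and outside the three ranges) is a dummy: it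
  affects the density on a null set only.
\<close>

definition F :: "real \<Rightarrow> real \<Rightarrow> real \<Rightarrow> real \<Rightarrow> real" where
  "F a b c t =
    (if 0 < t \<and> t < a then
       t^3 * (8 * a - 3 * t)
     else if a < t \<and> t < sqrt (a^2 + b^2) then
       (6 * t^4 - a^4 + 6 * pi * a^2 * b * c)
         - 4 * (b + c) * sqrt \<bar>t^2 - a^2\<bar> * (a^2 + 2 * t^2)
     else if sqrt (a^2 + b^2) < t \<and> t < sqrt (a^2 + b^2 + c^2) then
       6 * pi * a^2 * b * c + b^4 - 3 * t^4 - 6 * a^2 * b^2
         + 4 * c * sqrt \<bar>t^2 - a^2 - b^2\<bar> * (a^2 + b^2 + 2 * t^2)
         + 4 * a * sqrt \<bar>t^2 - b^2\<bar> * (b^2 + 2 * t^2)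
         - 12 * a^2 * b * c * arctan (sqrt \<bar>t^2 - a^2 - b^2\<bar> / b)
         - 4 * c * sqrt \<bar>t^2 - a^2\<bar> * (a^2 + 2 * t^2)
         - 12 * a * b^2 * c * arctan (sqrt \<bar>t^2 - a^2 - b^2\<bar> / a)
     else 0)"


section \<open>Consistency of the definitions\<close>

lemma space_sphere_area [simp]: "space sphere_area = sphere 0 1"
  by (simp add: sphere_area_def space_restrict_space)

lemma sets_sphere_area [simp, measurable_cong]:
  "sets sphere_area = sets (restrict_space borel (sphere 0 1))"
  by (simp add: sphere_area_def)

lemma emeasure_sphere_area_sphere: "emeasure sphere_area (sphere 0 1) = ennreal (4 * pi)"
proof -
  let ?B = "ball 0 1 - {0} :: (real^3) set"
  have "(\<lambda>x. x /\<^sub>R norm x) \<in> measurable (restrict_space lborel ?B)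
          (borel :: (real^3) measure)"
    by (rule measurable_restrict_space1) measurable
  hence "(\<lambda>x. x /\<^sub>R norm x) \<in> measurable (scale_measure 3 (restrict_space lborel ?B))
          (borel :: (real^3) measure)"
    by (simp cong: measurable_cong_sets)
  hence m: "(\<lambda>x. x /\<^sub>R norm x) \<in> measurable (scale_measure 3 (restrict_space lborel ?B))
             (restrict_space borel (sphere (0::real^3) 1))"
    by (rule measurable_restrict_space2[rotated])
       (auto simp: space_restrict_space space_scale_measure)
  have "emeasure sphere_area (sphere 0 1)
      = emeasure (scale_measure 3 (restrict_space lborel ?B)) (?B)"
  proof -
    have "(\<lambda>x. x /\<^sub>R norm x) -` sphere 0 1 \<inter> ?B = ?B"
      by auto
    thus ?thesis
      unfolding sphere_area_def
      by (subst emeasure_distr[OF m])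
         (auto simp: sets_restrict_space space_restrict_space space_scale_measure)
  qed
  also have "\<dots> = 3 * emeasure lborel ?B"
    by (simp add: emeasure_restrict_space)
  also have "emeasure lborel ?B = emeasure lborel (ball (0::real^3) 1)"
    by (rule emeasure_Diff_null_set) auto
  also have "\<dots> = ennreal (4 / 3 * pi)"
    using emeasure_ball[of 1 "0::real^3"] by (simp add: unit_ball_vol_3)
  also have "3 * ennreal (4 / 3 * pi) = ennreal (4 * pi)"
    by (simp add: ennreal_mult'[symmetric] flip: ennreal_numeral)
  finally show ?thesis .
qed

lemma sets_perp [measurable]: "perp v \<in> sets borel"
  unfolding perp_def by measurable

lemma space_plane_area [simp]: "space (plane_area v) = perp v"
  by (simp add: plane_area_def space_restrict_space)

lemma sets_plane_area [simp]: "sets (plane_area v) = sets (restrict_space borel (perp v))"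
  by (simp add: plane_area_def)

lemma perp_project: "norm v = 1 \<Longrightarrow> x - (v \<bullet> x) *\<^sub>R v \<in> perp v"
  by (simp add: perp_def inner_diff_right dot_square_norm)

lemma emeasure_plane_area:
  assumes v: "norm v = 1" and A: "A \<in> sets borel" "A \<subseteq> perp v"
  shows "emeasure (plane_area v) A
       = emeasure lborel {x. 0 \<le> v \<bullet> x \<and> v \<bullet> x \<le> 1 \<and> x - (v \<bullet> x) *\<^sub>R v \<in> A}"
proof -
  let ?S = "{x. 0 \<le> v \<bullet> x \<and> v \<bullet> x \<le> 1}"
  have m: "(\<lambda>x. x - (v \<bullet> x) *\<^sub>R v)
             \<in> measurable (restrict_space lborel ?S) (restrict_space borel (perp v))"
    by (rule measurable_restrict_space2)
       (auto intro!: measurable_restrict_space1 perp_project v)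
  have S: "?S \<in> sets lborel"
    by simp
  show ?thesis
    unfolding plane_area_def using A S
    by (subst emeasure_distr[OF m])
       (auto simp: sets_restrict_space space_restrict_space emeasure_restrict_space
             intro!: arg_cong2[where f = emeasure])
qed

lemma emeasure_lborel_Times:
  fixes A :: "'a::euclidean_space set" and B :: "'b::euclidean_space set"
  assumes "A \<in> sets borel" "B \<in> sets borel"
  shows "emeasure lborel (A \<times> B) = emeasure lborel A * emeasure lborel B"
  unfolding lborel_prod[symmetric] using assms by (simp add: lborel.emeasure_pair_measure_Times)

lemma measurable_triple:
  "(\<lambda>((x, y), s). vector [x, y, s] :: real^3)
     \<in> measurable (lborel :: ((real \<times> real) \<times> real) measure) borel"
proof -
  have "(\<lambda>((x, y), s). vector [x, y, s] :: real^3)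
      = (\<lambda>p. fst (fst p) *\<^sub>R axis 1 1 + snd (fst p) *\<^sub>R axis 2 1 + snd p *\<^sub>R axis 3 1)"
    by (auto simp: fun_eq_iff vec_eq_iff forall_3 axis_def)
  moreover have "continuous_on UNIV \<dots>"
    by (intro continuous_intros)
  ultimately show ?thesis
    by (simp add: borel_measurable_continuous_onI)
qed

lemma lborel_triple:
  "distr (lborel :: ((real \<times> real) \<times> real) measure) borel
     (\<lambda>((x, y), s). vector [x, y, s] :: real^3) = lborel"
proof (rule lborel_eqI[symmetric])
  let ?E = "\<lambda>((x, y), s). vector [x, y, s] :: real^3"
  show "sets (distr (lborel :: ((real \<times> real) \<times> real) measure) borel ?E) = sets borel"
    by simp
  fix l u :: "real^3"
  assume le: "\<And>b. b \<in> Basis \<Longrightarrow> l \<bullet> b \<le> u \<bullet> b"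
  have le': "l $ i \<le> u $ i" for i
    using le[of "axis i 1"] by (simp add: axis_in_Basis_iff inner_axis)
  have meas: "?E \<in> measurable lborel borel"
    by (rule measurable_triple)
  have pre: "?E -` box l u = ({l$1<..<u$1} \<times> {l$2<..<u$2}) \<times> {l$3<..<u$3}"
    by (auto simp: mem_box_cart forall_3)
  have "emeasure (distr lborel borel ?E) (box l u)
      = emeasure (lborel :: ((real \<times> real) \<times> real) measure)
          (({l$1<..<u$1} \<times> {l$2<..<u$2}) \<times> {l$3<..<u$3})"
    using meas by (simp add: emeasure_distr pre)
  also have "\<dots> = ennreal (u$1 - l$1) * ennreal (u$2 - l$2) * ennreal (u$3 - l$3)"
    using le' by (simp add: emeasure_lborel_Times borel_Times)
  also have "\<dots> = ennreal (\<Prod>b\<in>Basis. (u - l) \<bullet> b)"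
  proof -
    have B: "Basis = {axis 1 1, axis 2 1, axis 3 1 :: real^3}"
      by (auto simp: Basis_vec_def UNIV_3)
    have "(\<Prod>b\<in>Basis. (u - l) \<bullet> b) = (u$1 - l$1) * (u$2 - l$2) * (u$3 - l$3)"
      unfolding B by (simp add: axis_eq_axis inner_axis mult_ac)
    thus ?thesis
      using le' by (simp add: ennreal_mult)
  qed
  finally show "emeasure (distr lborel borel ?E) (box l u) = ennreal (\<Prod>b\<in>Basis. (u - l) \<bullet> b)" .
qed

lemma lborel_orthogonal:
  fixes f :: "real^3 \<Rightarrow> real^3"
  assumes f: "orthogonal_transformation f"
  shows "distr lborel borel f = lborel"
proof (rule lborel_eqI[symmetric])
  show "sets (distr lborel borel f) = sets borel"
    by simp
  have "linear f"
    using f by (simp add: orthogonal_transformation_linear)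
  hence meas: "f \<in> measurable lborel borel"
    by (simp add: borel_measurable_continuous_onI linear_continuous_on linear_conv_bounded_linear)
  have bij: "bij f"
    using f by (rule orthogonal_transformation_bij)
  have inv: "orthogonal_transformation (inv f)"
    using f by (rule orthogonal_transformation_inv)
  fix l u :: "real^3"
  assume le: "\<And>b. b \<in> Basis \<Longrightarrow> l \<bullet> b \<le> u \<bullet> b"
  have pre: "f -` box l u = inv f ` box l u"
    using bij by (simp add: bij_vimage_eq_inv_image)
  have m: "inv f ` box l u \<in> lmeasurable" "measure lebesgue (inv f ` box l u) = measure lebesgue (box l u)"
    using measurable_orthogonal_image[OF inv, of "box l u"] measure_orthogonal_image[OF inv, of "box l u"]
    by auto
  have "f -` box l u \<in> sets borel"
    using measurable_sets[OF meas, of "box l u"] by simp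
  hence "emeasure (distr lborel borel f) (box l u) = emeasure lebesgue (inv f ` box l u)"
    using meas by (simp add: emeasure_distr pre)
  also have "\<dots> = ennreal (measure lebesgue (box l u))"
    using m by (simp add: emeasure_eq_ennreal_measure fmeasurable_def less_top)
  also have "\<dots> = ennreal (\<Prod>b\<in>Basis. (u - l) \<bullet> b)"
    using le by (simp add: measure_lborel_box inner_diff_left)
  finally show "emeasure (distr lborel borel f) (box l u) = ennreal (\<Prod>b\<in>Basis. (u - l) \<bullet> b)" .
qed

lemma plane_area_coordinates:
  assumes v: "norm v = 1" and e: "norm e1 = 1" "norm e2 = 1" "e1 \<bullet> e2 = 0"
    and perp: "e1 \<in> perp v" "e2 \<in> perp v"
  shows "plane_area v = distr lborel (restrict_space borel (perp v))
           (\<lambda>(x, y). x *\<^sub>R e1 + y *\<^sub>R e2)"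
proof (rule measure_eqI)
  fix A
  assume "A \<in> sets (plane_area v)"
  hence A [measurable]: "A \<in> sets borel" and Ap: "A \<subseteq> perp v"
    by (auto simp: sets_restrict_space_iff)
  have ips [simp]: "v \<bullet> v = 1" "e1 \<bullet> e1 = 1" "e2 \<bullet> e2 = 1" "v \<bullet> e1 = 0" "v \<bullet> e2 = 0"
      "e1 \<bullet> v = 0" "e2 \<bullet> v = 0" "e1 \<bullet> e2 = 0" "e2 \<bullet> e1 = 0"
    using v e perp by (simp_all add: dot_square_norm perp_def inner_commute)
  let ?T = "\<lambda>x::real^3. (x$1) *\<^sub>R e1 + (x$2) *\<^sub>R e2 + (x$3) *\<^sub>R v"
  have T: "orthogonal_transformation ?T"
    unfolding orthogonal_transformation_def
  proof (intro conjI allI)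
    show "linear ?T"
      by (rule linearI) (simp_all add: algebra_simps)
    show "?T x \<bullet> ?T y = x \<bullet> y" for x y
      by (simp add: inner_add_left inner_add_right inner_vec_def[of x y] sum_3)
  qed
  let ?E = "\<lambda>((x, y), s). vector [x, y, s] :: real^3"
  have E: "?E \<in> measurable lborel borel"
    by (rule measurable_triple)
  have Tm: "?T \<in> measurable borel borel"
    by measurable
  have S: "{x. 0 \<le> v \<bullet> x \<and> v \<bullet> x \<le> 1 \<and> x - (v \<bullet> x) *\<^sub>R v \<in> A} \<in> sets borel" (is "?S \<in> _")
    by measurable
  have B: "{p. (case p of (x, y) \<Rightarrow> x *\<^sub>R e1 + y *\<^sub>R e2) \<in> A} \<in> sets borel" (is "?B \<in> _")
    using measurable_sets[of "\<lambda>p::real \<times> real. fst p *\<^sub>R e1 + snd p *\<^sub>R e2" borel borel A] A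
    by (simp add: case_prod_unfold vimage_def borel_measurable_continuous_onI continuous_intros)
  have "emeasure (plane_area v) A = emeasure lborel ?S"
    using v A Ap by (rule emeasure_plane_area)
  also have "\<dots> = emeasure (distr (distr lborel borel ?E) borel ?T) ?S"
    by (simp only: lborel_triple lborel_orthogonal[OF T])
  also have "\<dots> = emeasure lborel (?E -` ?T -` ?S)"
    using S E Tm measurable_sets[OF Tm, of ?S] by (simp add: emeasure_distr)
  also have "?E -` ?T -` ?S = ?B \<times> {0..1}"
    by (auto simp: inner_add_right)
  also have "emeasure lborel (?B \<times> {0..1::real}) = emeasure lborel ?B * emeasure lborel {0..1::real}"
    by (rule emeasure_lborel_Times[OF B]) simp
  also have "\<dots> = emeasure (distr lborel (restrict_space borel (perp v))
                    (\<lambda>(x, y). x *\<^sub>R e1 + y *\<^sub>R e2)) A"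
  proof -
    have m: "(\<lambda>(x, y). x *\<^sub>R e1 + y *\<^sub>R e2) \<in> measurable lborel (restrict_space borel (perp v))"
      unfolding case_prod_unfold
      by (rule measurable_restrict_space2) (auto simp: perp_def inner_add_right
           intro!: borel_measurable_continuous_onI continuous_intros)
    show ?thesis
      using A Ap by (subst emeasure_distr[OF m])
        (auto simp: sets_restrict_space_iff vimage_def)
  qed
  finally show "emeasure (plane_area v) A = \<dots>" .
qed simp

lemma closed_directed_lines: "closed directed_lines"
proof -
  have eq: "directed_lines
      = {l :: (real^3) \<times> (real^3). norm (fst l) = 1} \<inter> {l. fst l \<bullet> snd l = 0}"
    by (auto simp: directed_lines_def perp_def)
  show ?thesis
    unfolding eq by (intro closed_Int closed_Collect_eq continuous_intros)
qed

lemma sets_directed_lines [measurable]: "directed_lines \<in> sets borel"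
  using closed_directed_lines by simp

lemma space_line_measure [simp]: "space line_measure = directed_lines"
  unfolding line_measure_def by (rule space_measure_of) (auto simp: sets_restrict_space)

lemma sets_line_measure [simp, measurable_cong]:
  "sets line_measure = sets (restrict_space borel directed_lines)"
proof -
  have "sets line_measure = sigma_sets directed_lines (sets (restrict_space borel directed_lines))"
    unfolding line_measure_def by (rule sets_measure_of) (auto simp: sets_restrict_space)
  also have "\<dots> = sets (restrict_space borel directed_lines)"
    using sets.sigma_sets_eq[of "restrict_space borel directed_lines"]
    by (simp add: space_restrict_space)
  finally show ?thesis .
qed

lemma measurable_plane_area_section:
  assumes A: "A \<in> sets (restrict_space borel directed_lines)"
  shows "(\<lambda>v. emeasure (plane_area v) {q. (v, q) \<in> A}) \<in> borel_measurable sphere_area"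
proof -
  have A': "A \<in> sets (borel :: ((real^3) \<times> (real^3)) measure)" "A \<subseteq> directed_lines"
    using A by (auto simp: sets_restrict_space_iff)
  let ?g = "\<lambda>v. \<integral>\<^sup>+x. indicator {0..1} (v \<bullet> x) * indicator A (v, x - (v \<bullet> x) *\<^sub>R v) \<partial>lborel"
  have [measurable]: "A \<in> sets (borel \<Otimes>\<^sub>M borel)"
    unfolding borel_prod using A' by simp
  have "?g \<in> borel_measurable borel"
    by measurable
  hence "?g \<in> borel_measurable sphere_area"
    by (simp add: sphere_area_def measurable_restrict_space1)
  moreover have "emeasure (plane_area v) {q. (v, q) \<in> A} = ?g v" if "v \<in> space sphere_area" for v
  proof -
    have v: "norm v = 1"
      using that by simp
    have S: "{q. (v, q) \<in> A} \<in> sets borel"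
      by measurable
    have "emeasure (plane_area v) {q. (v, q) \<in> A}
        = emeasure lborel {x. 0 \<le> v \<bullet> x \<and> v \<bullet> x \<le> 1 \<and> (v, x - (v \<bullet> x) *\<^sub>R v) \<in> A}"
      using A' S by (subst emeasure_plane_area[OF v]) (auto simp: directed_lines_def)
    also have "\<dots> = (\<integral>\<^sup>+x. indicator {x. 0 \<le> v \<bullet> x \<and> v \<bullet> x \<le> 1 \<and>
                                (v, x - (v \<bullet> x) *\<^sub>R v) \<in> A} x \<partial>lborel)"
      by (rule nn_integral_indicator[symmetric]) measurable
    also have "\<dots> = ?g v"
      by (intro nn_integral_cong) (auto simp: indicator_def)
    finally show ?thesis .
  qed
  ultimately show ?thesis
    by (subst measurable_cong) auto
qed

lemma emeasure_line_measure:
  assumes A: "A \<in> sets line_measure"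
  shows "emeasure line_measure A
       = (\<integral>\<^sup>+ v. emeasure (plane_area v) {q. (v, q) \<in> A} \<partial>sphere_area)"
proof (rule emeasure_measure_of[OF line_measure_def])
  let ?\<mu> = "\<lambda>A. \<integral>\<^sup>+ v. emeasure (plane_area v) {q. (v, q) \<in> A} \<partial>sphere_area"
  show "sets (restrict_space borel directed_lines) \<subseteq> Pow directed_lines"
    by (auto simp: sets_restrict_space)
  show "positive (sets line_measure) ?\<mu>"
    by (simp add: positive_def)
  show "countably_additive (sets line_measure) ?\<mu>"
  proof (rule countably_additiveI)
    fix A :: "nat \<Rightarrow> ((real^3) \<times> (real^3)) set"
    assume A: "range A \<subseteq> sets line_measure" "disjoint_family A"
    have slice: "{q. (v, q) \<in> A i} \<in> sets (plane_area v)" for v i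
    proof -
      have "A i \<in> sets (restrict_space borel directed_lines)"
        using A by auto
      hence "A i \<in> sets borel" "A i \<subseteq> directed_lines"
        by (simp_all add: sets_restrict_space_iff)
      hence [measurable]: "A i \<in> sets (borel \<Otimes>\<^sub>M borel)"
        unfolding borel_prod by simp
      have "{q. (v, q) \<in> A i} \<in> sets borel"
        by measurable
      thus ?thesis
        using \<open>A i \<subseteq> directed_lines\<close>
        by (auto simp: sets_restrict_space_iff directed_lines_def)
    qed
    have "(\<Sum>i. ?\<mu> (A i))
        = (\<integral>\<^sup>+ v. (\<Sum>i. emeasure (plane_area v) {q. (v, q) \<in> A i}) \<partial>sphere_area)"
      using A by (intro nn_integral_suminf[symmetric] measurable_plane_area_section) auto
    also have "\<dots> = (\<integral>\<^sup>+ v. emeasure (plane_area v) (\<Union>i. {q. (v, q) \<in> A i}) \<partial>sphere_area)"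
      using A slice
      by (intro nn_integral_cong suminf_emeasure) (auto simp: disjoint_family_on_def)
    also have "\<dots> = ?\<mu> (\<Union>i. A i)"
      by (intro nn_integral_cong arg_cong2[where f = emeasure]) auto
    finally show "(\<Sum>i. ?\<mu> (A i)) = ?\<mu> (\<Union>i. A i)" .
  qed
qed (use A in auto)

end

theory Submission
  imports Defs
begin

text \<open>
  Fix a direction \<open>v\<close>. Slicing the overlap of the box \<open>K\<close> with its translate by \<open>- t v\<close> into lines
  parallel to \<open>v\<close> shows that the volume of the overlap is the integral of \<open>(L - t)\<^sup>+\<close> over
  \<open>perp v\<close>, where \<open>L\<close> is the chord length (\<open>emeasure_translated_overlap\<close>). For a box this volume
  is the product of the three factors \<open>(a\<^sub>i - t |v\<^sub>i|)\<^sup>+\<close>, so minus its right derivative in \<open>t\<close> is the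
  area of the set of lines in direction \<open>v\<close> whose chord is longer than \<open>t\<close>
  (\<open>emeasure_chord_tail_direction\<close>).

  It remains to integrate this tail over the sphere. As a function of \<open>t\<close> it is
  piecewise polynomial. Up to the length at which \<open>t v\<close> leaves the box \<open>[0,a] \<times> [0,b] \<times> [0,c]\<close> (after
  reflecting \<open>v\<close> into the positive octant) it decreases smoothly, and there it drops to zero by a
  jump; the smooth part comes from chords joining adjacent faces, the jump from chords joining
  opposite faces (\<open>tail_area_decomposition\<close>). Integrated over the sphere, the smooth part becomes
  an integral over the displacement vector of the chord, ranging over the box (polar coordinates), and
  the jump becomes an integral over a face of the box (central projection). In both integrals the
  distance from the origin can be made an integration variable, because in Cartesian coordinates
  \<open>z dz = s ds\<close> along lines parallel to an axis. What is left are elementary one-dimensional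
  integrals, \<open>tent_moment\<close> and \<open>face_moment\<close>, whose sum is the density
  (\<open>sphere_integral_tail_area\<close>).

  For \<open>t\<close> below the diagonal of the box, both integrals are piecewise elementary functions of \<open>T = t\<^sup>2\<close>
  whose formula changes only where \<open>T\<close> passes \<open>a\<^sup>2\<close>, \<open>a\<^sup>2 + b\<^sup>2\<close> or one of their permutations. So does the sum of the three terms \<open>F\<close>, and the
  two sides agree because they start with the same expression and change by the same expression at each
  of these thresholds
  (\<open>chord_density_eq_F\<close>). The normalising constant is the integral of the area of the shadow of \<open>K\<close>, and
  equals \<open>2 \<pi> (ab + ac + bc)\<close> because \<open>|v\<^sub>1|\<close> has integral \<open>2 \<pi>\<close> over the sphere.
\<close>

section \<open>Slicing space into parallel lines\<close>

lemma nn_integral_plane_area: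
  assumes v: "norm v = 1" and f [measurable]: "f \<in> borel_measurable borel"
  shows "(\<integral>\<^sup>+q. f q \<partial>plane_area v)
       = (\<integral>\<^sup>+x. indicator {0..1} (v \<bullet> x) * f (x - (v \<bullet> x) *\<^sub>R v) \<partial>lborel)"
proof -
  let ?S = "{x. 0 \<le> v \<bullet> x \<and> v \<bullet> x \<le> 1}"
  have m: "(\<lambda>x. x - (v \<bullet> x) *\<^sub>R v)
             \<in> measurable (restrict_space lborel ?S) (restrict_space borel (perp v))"
    by (rule measurable_restrict_space2)
       (auto intro!: measurable_restrict_space1 perp_project v)
  have "(\<integral>\<^sup>+q. f q \<partial>plane_area v)
      = (\<integral>\<^sup>+x. f (x - (v \<bullet> x) *\<^sub>R v) \<partial>restrict_space lborel ?S)"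
    unfolding plane_area_def by (subst nn_integral_distr[OF m]) (auto intro: measurable_restrict_space1)
  also have "\<dots> = (\<integral>\<^sup>+x. f (x - (v \<bullet> x) *\<^sub>R v) * indicator ?S x \<partial>lborel)"
    by (rule nn_integral_restrict_space) simp
  also have "\<dots> = (\<integral>\<^sup>+x. indicator {0..1} (v \<bullet> x) * f (x - (v \<bullet> x) *\<^sub>R v) \<partial>lborel)"
    by (intro nn_integral_cong) (auto simp: indicator_def)
  finally show ?thesis .
qed

lemma nn_integral_lborel_shift:
  fixes f :: "'a::euclidean_space \<Rightarrow> ennreal"
  assumes [measurable]: "f \<in> borel_measurable borel"
  shows "(\<integral>\<^sup>+x. f (c + x) \<partial>lborel) = (\<integral>\<^sup>+x. f x \<partial>lborel)"
  by (subst (2) lborel_distr_plus[of c, symmetric]) (simp add: nn_integral_distr)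

text \<open>
  Fubini along lines of direction \<open>v\<close>, without choosing coordinates in \<open>perp v\<close>: area on \<open>perp v\<close> is
  volume in a slab of height one, and averaging over the translates of the slab along \<open>v\<close> gives the
  whole space with weight one.
\<close>

lemma emeasure_lborel_slice_lines:
  fixes B :: "(real^3) set"
  assumes v: "norm v = 1" and B: "B \<in> sets borel"
  shows "emeasure lborel B = (\<integral>\<^sup>+q. emeasure lborel {s. q + s *\<^sub>R v \<in> B} \<partial>plane_area v)"
proof -
  have [measurable]: "B \<in> sets borel" by fact
  have vv: "v \<bullet> v = 1" using v by (simp add: dot_square_norm)
  have slice: "emeasure lborel {s. q + s *\<^sub>R v \<in> B} = (\<integral>\<^sup>+s. indicator B (q + s *\<^sub>R v) \<partial>lborel)" for q
  proof -
    have "emeasure lborel {s. q + s *\<^sub>R v \<in> B} = (\<integral>\<^sup>+s. indicator {s. q + s *\<^sub>R v \<in> B} s \<partial>lborel)"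
      by (rule nn_integral_indicator[symmetric]) measurable
    thus ?thesis by (simp add: indicator_def)
  qed
  have "(\<integral>\<^sup>+q. emeasure lborel {s. q + s *\<^sub>R v \<in> B} \<partial>plane_area v)
      = (\<integral>\<^sup>+x. indicator {0..1} (v \<bullet> x) *
           (\<integral>\<^sup>+s. indicator B (x - (v \<bullet> x) *\<^sub>R v + s *\<^sub>R v) \<partial>lborel) \<partial>lborel)"
    unfolding slice by (rule nn_integral_plane_area[OF v]) measurable
  also have "\<dots> = (\<integral>\<^sup>+x. (\<integral>\<^sup>+s. indicator {0..1} (v \<bullet> x) * indicator B (x + s *\<^sub>R v) \<partial>lborel) \<partial>lborel)"
  proof (rule nn_integral_cong)
    fix x :: "real^3"
    have "(\<integral>\<^sup>+s. indicator B (x - (v \<bullet> x) *\<^sub>R v + s *\<^sub>R v) \<partial>lborel)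
        = (\<integral>\<^sup>+s. (\<lambda>s. indicator B (x + s *\<^sub>R v)) (- (v \<bullet> x) + s) \<partial>lborel)"
      by (simp add: algebra_simps)
    also have "\<dots> = (\<integral>\<^sup>+s. indicator B (x + s *\<^sub>R v) \<partial>lborel)"
      by (rule nn_integral_lborel_shift) measurable
    finally show "indicator {0..1} (v \<bullet> x) * (\<integral>\<^sup>+s. indicator B (x - (v \<bullet> x) *\<^sub>R v + s *\<^sub>R v) \<partial>lborel)
        = (\<integral>\<^sup>+s. indicator {0..1} (v \<bullet> x) * indicator B (x + s *\<^sub>R v) \<partial>lborel)"
      by (simp add: nn_integral_cmult)
  qed
  also have "\<dots> = (\<integral>\<^sup>+s. (\<integral>\<^sup>+x. indicator {0..1} (v \<bullet> x) * indicator B (x + s *\<^sub>R v) \<partial>lborel) \<partial>lborel)"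
    by (rule lborel_pair.Fubini'[symmetric]) measurable
  also have "\<dots> = (\<integral>\<^sup>+s. (\<integral>\<^sup>+x. indicator {0..1} (v \<bullet> x - s) * indicator B x \<partial>lborel) \<partial>lborel)"
  proof (rule nn_integral_cong)
    fix s :: real
    have "(\<integral>\<^sup>+x. indicator {0..1} (v \<bullet> x) * indicator B (x + s *\<^sub>R v) \<partial>lborel)
        = (\<integral>\<^sup>+x. (\<lambda>x. indicator {0..1} (v \<bullet> x - s) * indicator B x) (s *\<^sub>R v + x) \<partial>lborel)"
      by (simp add: algebra_simps vv)
    also have "\<dots> = (\<integral>\<^sup>+x. indicator {0..1} (v \<bullet> x - s) * indicator B x \<partial>lborel)"
      by (rule nn_integral_lborel_shift) measurable
    finally show "(\<integral>\<^sup>+x. indicator {0..1} (v \<bullet> x) * indicator B (x + s *\<^sub>R v) \<partial>lborel) = \<dots>" .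
  qed
  also have "\<dots> = (\<integral>\<^sup>+x. (\<integral>\<^sup>+s. indicator {0..1} (v \<bullet> x - s) * indicator B x \<partial>lborel) \<partial>lborel)"
    by (rule lborel_pair.Fubini') measurable
  also have "\<dots> = (\<integral>\<^sup>+x. indicator B x \<partial>lborel)"
  proof (rule nn_integral_cong)
    fix x :: "real^3"
    have "(\<integral>\<^sup>+s. indicator {0..1} (v \<bullet> x - s) \<partial>lborel)
        = (\<integral>\<^sup>+s. indicator {v \<bullet> x - 1..v \<bullet> x} s \<partial>(lborel :: real measure))"
      by (intro nn_integral_cong) (auto simp: indicator_def)
    also have "\<dots> = 1"
      by simp
    finally show "(\<integral>\<^sup>+s. indicator {0..1} (v \<bullet> x - s) * indicator B x \<partial>lborel) = indicator B x"
      by (simp add: nn_integral_multc)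
  qed
  also have "\<dots> = emeasure lborel B"
    by simp
  finally show ?thesis ..
qed

lemma line_slice_interval:
  fixes K :: "'a::euclidean_space set"
  assumes K: "compact K" "convex K" and v: "v \<noteq> 0"
  shows "\<exists>\<alpha> \<beta>. {s::real. q + s *\<^sub>R v \<in> K} = {\<alpha>..\<beta>}"
proof -
  let ?I = "{s. q + s *\<^sub>R v \<in> K}"
  have "closed ?I"
  proof -
    have "closed ((\<lambda>s. q + s *\<^sub>R v) -` K)"
      using K by (intro closed_vimage compact_imp_closed) (auto intro!: continuous_intros)
    thus ?thesis by (simp add: vimage_def)
  qed
  moreover have "bounded ?I"
  proof -
    obtain B where B: "\<And>x. x \<in> K \<Longrightarrow> norm x \<le> B"
      using compact_imp_bounded[OF K(1)] by (auto simp: bounded_iff)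
    have "norm s \<le> (B + norm q) / norm v" if "s \<in> ?I" for s
    proof -
      have "norm (s *\<^sub>R v) \<le> norm (q + s *\<^sub>R v) + norm q"
        by (metis add_diff_cancel_left' norm_triangle_ineq4)
      thus ?thesis using B[of "q + s *\<^sub>R v"] that v by (simp add: field_simps)
    qed
    thus ?thesis by (auto simp: bounded_iff)
  qed
  moreover have "convex ?I"
  proof (rule convexI)
    fix s s' u w :: real
    assume s: "s \<in> ?I" "s' \<in> ?I" and u: "0 \<le> u" "0 \<le> w" "u + w = 1"
    have "u *\<^sub>R (q + s *\<^sub>R v) + w *\<^sub>R (q + s' *\<^sub>R v) \<in> K"
      using s u K(2) by (auto simp: convex_def)
    also have "u *\<^sub>R (q + s *\<^sub>R v) + w *\<^sub>R (q + s' *\<^sub>R v) = (u + w) *\<^sub>R q + (u * s + w * s') *\<^sub>R v"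
      by (simp add: algebra_simps)
    finally show "u *\<^sub>R s + w *\<^sub>R s' \<in> ?I" using u by simp
  qed
  ultimately have "compact ?I" "connected ?I"
    by (auto simp: compact_eq_bounded_closed convex_connected)
  thus ?thesis
    using connected_compact_interval_1[of ?I] by auto
qed

section \<open>Chords of a convex body and overlaps with its translates\<close>

text \<open>
  A point lies in \<open>K\<close> together with its translate by \<open>t v\<close> iff it is among the points of its chord
  at distance at least \<open>t\<close> from the far end. So a chord of length \<open>L\<close> contributes \<open>(L - t)\<^sup>+\<close>;
  the conversion to \<open>ennreal\<close> performs this truncation.
\<close>

lemma emeasure_translated_overlap:
  fixes K :: "(real^3) set"
  assumes K: "compact K" "convex K" and v: "norm v = 1" and t: "0 \<le> t"
  shows "emeasure lborel {x. x \<in> K \<and> x + t *\<^sub>R v \<in> K}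
       = (\<integral>\<^sup>+q. ennreal (chord_length K (v, q) - t) \<partial>plane_area v)"
proof -
  have Kb [measurable]: "K \<in> sets borel"
    using K by (simp add: compact_imp_closed)
  have "emeasure lborel {x. x \<in> K \<and> x + t *\<^sub>R v \<in> K}
      = (\<integral>\<^sup>+q. emeasure lborel {s. q + s *\<^sub>R v \<in> {x. x \<in> K \<and> x + t *\<^sub>R v \<in> K}} \<partial>plane_area v)"
    by (rule emeasure_lborel_slice_lines[OF v]) measurable
  also have "\<dots> = (\<integral>\<^sup>+q. ennreal (chord_length K (v, q) - t) \<partial>plane_area v)"
  proof (rule nn_integral_cong)
    fix q
    obtain \<alpha> \<beta> where I: "{s. q + s *\<^sub>R v \<in> K} = {\<alpha>..\<beta>}"
      using line_slice_interval[OF K, of v q] v by fastforce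
    hence mem: "q + s *\<^sub>R v \<in> K \<longleftrightarrow> s \<in> {\<alpha>..\<beta>}" for s
      by blast
    have "{s. q + s *\<^sub>R v \<in> {x. x \<in> K \<and> x + t *\<^sub>R v \<in> K}} = {s. s \<in> {\<alpha>..\<beta>} \<and> s + t \<in> {\<alpha>..\<beta>}}"
      using mem[of "_ + t"] mem by (auto simp: algebra_simps)
    also have "\<dots> = {\<alpha>..\<beta> - t}"
      using t by auto
    finally have 1: "{s. q + s *\<^sub>R v \<in> {x. x \<in> K \<and> x + t *\<^sub>R v \<in> K}} = {\<alpha>..\<beta> - t}" .
    have 2: "chord_length K (v, q) = max 0 (\<beta> - \<alpha>)"
      by (simp add: chord_length_def I max_def)
    show "emeasure lborel {s. q + s *\<^sub>R v \<in> {x. x \<in> K \<and> x + t *\<^sub>R v \<in> K}}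
        = ennreal (chord_length K (v, q) - t)"
      unfolding 1 2 using t by (cases "\<alpha> \<le> \<beta> - t") (auto simp: max_def ennreal_neg)
  qed
  finally show ?thesis .
qed

lemma emeasure_box_overlap:
  fixes l u y :: "real^3"
  shows "emeasure lborel {x. x \<in> cbox l u \<and> x + y \<in> cbox l u}
       = ennreal (\<Prod>i\<in>UNIV. max 0 (u $ i - l $ i - \<bar>y $ i\<bar>))"
proof -
  define l' where "l' = (\<chi> i. max (l $ i) (l $ i - y $ i))"
  define u' where "u' = (\<chi> i. min (u $ i) (u $ i - y $ i))"
  have eq: "{x. x \<in> cbox l u \<and> x + y \<in> cbox l u} = cbox l' u'"
    by (auto simp: mem_box_cart l'_def u'_def algebra_simps)
  have d: "u $ i - l $ i - \<bar>y $ i\<bar> = u' $ i - l' $ i" for i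
    by (auto simp: max_def min_def l'_def u'_def)
  show ?thesis
  proof (cases "\<forall>i. l' $ i \<le> u' $ i")
    case True
    hence ne: "cbox l' u' \<noteq> {}"
      by (simp add: interval_ne_empty_cart(1))
    have "emeasure lborel (cbox l' u') = ennreal (measure lborel (cbox l' u'))"
      using emeasure_lborel_cbox_finite[of l' u'] by (intro emeasure_eq_ennreal_measure) auto
    also have "measure lborel (cbox l' u') = (\<Prod>i\<in>UNIV. max 0 (u' $ i - l' $ i))"
      using ne True by (simp add: content_cbox_cart max_absorb2)
    finally show ?thesis
      unfolding eq d .
  next
    case False
    then obtain i where i: "u' $ i < l' $ i"
      by (auto simp: not_le)
    hence "cbox l' u' = {}"
      by (auto simp: mem_box_cart) (meson le_less_trans less_irrefl order_trans)
    moreover have "(\<Prod>i\<in>UNIV. max 0 (u' $ i - l' $ i)) = 0"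
      using i by (intro prod_zero) (auto intro!: exI[of _ i])
    ultimately show ?thesis
      unfolding eq d by (simp only: emeasure_empty ennreal_0)
  qed
qed

text \<open>
  If \<open>\<phi> s\<close> is the mean excess of \<open>X\<close> over \<open>s\<close>, then \<open>\<phi> t - \<phi> (t + h)\<close> lies between \<open>h\<close> times the
  measure of \<open>X > t + h\<close> and \<open>h\<close> times the measure of \<open>X > t\<close>. Dividing by \<open>h\<close> and letting \<open>h\<close> tend to
  zero recovers the tail, since the tail is continuous from the right.
\<close>

lemma emeasure_tail_from_excess:
  fixes X :: "'a \<Rightarrow> real" and \<phi> :: "real \<Rightarrow> real"
  assumes X [measurable]: "X \<in> borel_measurable M"
    and \<phi>: "\<And>s. t \<le> s \<Longrightarrow> (\<integral>\<^sup>+x. ennreal (X x - s) \<partial>M) = ennreal (\<phi> s)"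
    and \<phi>0: "\<And>s. t \<le> s \<Longrightarrow> 0 \<le> \<phi> s"
    and d: "(\<phi> has_real_derivative - d) (at_right t)"
  shows "emeasure M {x \<in> space M. t < X x} = ennreal d"
proof -
  define A where "A = (\<lambda>s. emeasure M {x \<in> space M. s < X x})"
  have upper: "ennreal h * A (t + h) \<le> ennreal (\<phi> t - \<phi> (t + h))"
    and lower: "ennreal (\<phi> t - \<phi> (t + h)) \<le> ennreal h * A t" if h: "0 < h" for h
  proof -
    let ?e = "\<lambda>x. ennreal (X x - (t + h))"
    have fin: "ennreal (\<phi> (t + h)) \<noteq> \<infinity>" by simp
    have "ennreal (\<phi> (t + h)) + ennreal h * A (t + h)
        = (\<integral>\<^sup>+x. ?e x + ennreal h * indicator {x \<in> space M. t + h < X x} x \<partial>M)"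
      using \<phi>[of "t + h"] h by (subst nn_integral_add) (auto simp: nn_integral_cmult_indicator A_def)
    also have "\<dots> \<le> (\<integral>\<^sup>+x. ennreal (X x - t) \<partial>M)"
      using h by (intro nn_integral_mono)
        (auto simp: indicator_def ennreal_plus[symmetric] simp del: ennreal_plus intro!: ennreal_leI)
    also have "\<dots> = ennreal (\<phi> t)"
      by (rule \<phi>) simp
    finally have "ennreal (\<phi> (t + h)) + ennreal h * A (t + h) \<le> ennreal (\<phi> t)" .
    hence "(ennreal (\<phi> (t + h)) + ennreal h * A (t + h)) - ennreal (\<phi> (t + h)) \<le> ennreal (\<phi> t) - ennreal (\<phi> (t + h))"
      by (intro ennreal_minus_mono) auto
    thus "ennreal h * A (t + h) \<le> ennreal (\<phi> t - \<phi> (t + h))"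
      using \<phi>0[of "t + h"] h by (simp add: ennreal_minus ennreal_add_diff_cancel_left)
    have "ennreal (\<phi> t) = (\<integral>\<^sup>+x. ennreal (X x - t) \<partial>M)"
      by (rule \<phi>[symmetric]) simp
    also have "\<dots> \<le> (\<integral>\<^sup>+x. ?e x + ennreal h * indicator {x \<in> space M. t < X x} x \<partial>M)"
    proof (rule nn_integral_mono)
      fix x assume x: "x \<in> space M"
      consider "X x \<le> t" | "t < X x" "X x \<le> t + h" | "t + h < X x" by linarith
      thus "ennreal (X x - t) \<le> ?e x + ennreal h * indicator {x \<in> space M. t < X x} x"
      proof cases
        case 3
        thus ?thesis using h x
          by (auto simp: ennreal_plus[symmetric] simp del: ennreal_plus)
      qed (use h x in \<open>auto simp: ennreal_neg intro!: ennreal_leI\<close>)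
    qed
    also have "\<dots> = ennreal (\<phi> (t + h)) + ennreal h * A t"
      using \<phi>[of "t + h"] h by (subst nn_integral_add) (auto simp: nn_integral_cmult_indicator A_def)
    finally have "ennreal (\<phi> t) - ennreal (\<phi> (t + h)) \<le> (ennreal (\<phi> (t + h)) + ennreal h * A t) - ennreal (\<phi> (t + h))"
      by (intro ennreal_minus_mono) auto
    thus "ennreal (\<phi> t - \<phi> (t + h)) \<le> ennreal h * A t"
      using \<phi>0[of "t + h"] h by (simp add: ennreal_minus ennreal_add_diff_cancel_left)
  qed
  have quot: "((\<lambda>h. (\<phi> t - \<phi> (t + h)) / h) \<longlongrightarrow> d) (at_right 0)"
  proof -
    have "((\<lambda>s. (\<phi> s - \<phi> t) / (s - t)) \<longlongrightarrow> - d) (at_right t)"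
      using d by (simp add: has_field_derivative_iff)
    hence "((\<lambda>h. (\<phi> (h + t) - \<phi> t) / (h + t - t)) \<longlongrightarrow> - d) (at_right 0)"
      by (subst (asm) filterlim_at_right_to_0) 
    hence "((\<lambda>h. - ((\<phi> (h + t) - \<phi> t) / (h + t - t))) \<longlongrightarrow> - (- d)) (at_right 0)"
      by (rule tendsto_minus)
    thus ?thesis by (simp add: add.commute minus_divide_left)
  qed
  \<comment> \<open>Along a decreasing sequence \<open>\<epsilon>\<close> the sets \<open>X > t + \<epsilon> n\<close> increase to \<open>X > t\<close>.\<close>
  define \<epsilon> where "\<epsilon> = (\<lambda>n. 1 / real (Suc n))"
  have \<epsilon>: "\<epsilon> n > 0" for n by (simp add: \<epsilon>_def)
  have \<epsilon>0: "\<epsilon> \<longlonglongrightarrow> 0"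
    unfolding \<epsilon>_def using LIMSEQ_inverse_real_of_nat by (simp add: inverse_eq_divide)
  hence \<epsilon>f: "filterlim \<epsilon> (at_right 0) sequentially"
    using \<epsilon> by (auto intro!: tendsto_imp_filterlim_at_right always_eventually)
  have lim: "(\<lambda>n. ennreal ((\<phi> t - \<phi> (t + \<epsilon> n)) / \<epsilon> n)) \<longlonglongrightarrow> ennreal d"
    using filterlim_compose[OF quot \<epsilon>f] by (intro tendsto_ennrealI)
  have cancel: "ennreal h * y / ennreal h = y" if "h > 0" for h y
    using that ennreal_mult_divide_eq[of "ennreal h" y] by (simp add: mult.commute)
  have div: "ennreal ((\<phi> t - \<phi> (t + h)) / h) = ennreal (\<phi> t - \<phi> (t + h)) / ennreal h" if "h > 0" for h
  proof (cases "\<phi> t - \<phi> (t + h) \<ge> 0")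
    case True thus ?thesis using that by (simp add: divide_ennreal)
  next
    case False thus ?thesis using that by (simp add: ennreal_neg divide_nonpos_pos)
  qed
  have "ennreal d \<le> A t"
  proof (rule LIMSEQ_le_const2[OF lim], intro exI allI impI)
    fix n
    have "ennreal (\<phi> t - \<phi> (t + \<epsilon> n)) / ennreal (\<epsilon> n) \<le> (ennreal (\<epsilon> n) * A t) / ennreal (\<epsilon> n)"
      by (intro divide_right_mono_ennreal lower \<epsilon>)
    thus "ennreal ((\<phi> t - \<phi> (t + \<epsilon> n)) / \<epsilon> n) \<le> A t"
      by (simp add: div[OF \<epsilon>] cancel[OF \<epsilon>])
  qed
  moreover have "A t \<le> ennreal d"
  proof (rule LIMSEQ_le[OF _ lim])
    have inc: "incseq (\<lambda>n. {x \<in> space M. t + \<epsilon> n < X x})"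
    proof (rule incseq_SucI)
      fix n
      have "\<epsilon> (Suc n) \<le> \<epsilon> n"
        by (simp add: \<epsilon>_def frac_le)
      thus "{x \<in> space M. t + \<epsilon> n < X x} \<subseteq> {x \<in> space M. t + \<epsilon> (Suc n) < X x}"
        by auto
    qed
    have "(\<lambda>n. A (t + \<epsilon> n)) \<longlonglongrightarrow> emeasure M (\<Union>n. {x \<in> space M. t + \<epsilon> n < X x})"
      unfolding A_def by (rule Lim_emeasure_incseq[OF _ inc]) auto
    also have "(\<Union>n. {x \<in> space M. t + \<epsilon> n < X x}) = {x \<in> space M. t < X x}"
    proof -
      have "\<exists>n. t + \<epsilon> n < X x" if "t < X x" for x
      proof -
        have "eventually (\<lambda>n. \<epsilon> n < X x - t) sequentially"
          by (rule order_tendstoD(2)[OF \<epsilon>0]) (use that in simp)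
        thus ?thesis by (auto simp: eventually_sequentially algebra_simps)
      qed
      moreover have "t < X x" if "t + \<epsilon> n < X x" for x n
        using that \<epsilon>[of n] by linarith
      ultimately show ?thesis by auto
    qed
    finally show "(\<lambda>n. A (t + \<epsilon> n)) \<longlonglongrightarrow> A t"
      by (simp add: A_def)
    show "\<exists>N. \<forall>n\<ge>N. A (t + \<epsilon> n) \<le> ennreal ((\<phi> t - \<phi> (t + \<epsilon> n)) / \<epsilon> n)"
    proof (intro exI allI impI)
      fix n
      have "(ennreal (\<epsilon> n) * A (t + \<epsilon> n)) / ennreal (\<epsilon> n) \<le> ennreal (\<phi> t - \<phi> (t + \<epsilon> n)) / ennreal (\<epsilon> n)"
        by (intro divide_right_mono_ennreal upper \<epsilon>)
      thus "A (t + \<epsilon> n) \<le> ennreal ((\<phi> t - \<phi> (t + \<epsilon> n)) / \<epsilon> n)"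
        by (simp add: div[OF \<epsilon>] cancel[OF \<epsilon>])
    qed
  qed
  ultimately show ?thesis
    by (simp add: A_def)
qed

section \<open>Chords of a box in a fixed direction\<close>

lemma borel_measurable_chord_length [measurable]:
  assumes K: "K \<in> sets borel"
  shows "chord_length K \<in> borel_measurable borel"
proof -
  have [measurable]: "K \<in> sets borel" by fact
  have "chord_length K = (\<lambda>l. enn2real (\<integral>\<^sup>+s. indicator K (snd l + s *\<^sub>R fst l) \<partial>lborel))"
  proof
    fix l :: "(real^3) \<times> (real^3)"
    have "emeasure lborel {s. snd l + s *\<^sub>R fst l \<in> K}
        = (\<integral>\<^sup>+s. indicator {s. snd l + s *\<^sub>R fst l \<in> K} s \<partial>lborel)"
      by (rule nn_integral_indicator[symmetric]) measurable
    thus "chord_length K l = enn2real (\<integral>\<^sup>+s. indicator K (snd l + s *\<^sub>R fst l) \<partial>lborel)"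
      by (simp add: chord_length_def case_prod_unfold measure_def indicator_def)
  qed
  also have "\<dots> \<in> borel_measurable (borel \<Otimes>\<^sub>M borel)"
    by measurable
  finally show ?thesis
    by (simp add: borel_prod)
qed

lemma prod_3: "prod f (UNIV::3 set) = f 1 * f 2 * f 3"
  unfolding UNIV_3 by (simp add: mult.assoc)

text \<open>
  With \<open>x, y, z\<close> the absolute values of the components of the direction, this is minus the right
  derivative at \<open>t\<close> of the volume \<open>(a - t x)\<^sup>+ (b - t y)\<^sup>+ (c - t z)\<^sup>+\<close>.
\<close>

definition tail_area :: "real \<Rightarrow> real \<Rightarrow> real \<Rightarrow> real \<Rightarrow> real \<Rightarrow> real \<Rightarrow> real \<Rightarrow> real" where
  "tail_area a b c t x y z =
    (if t * x < a \<and> t * y < b \<and> t * z < c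
     then x * (b - t * y) * (c - t * z) + y * (c - t * z) * (a - t * x) + z * (a - t * x) * (b - t * y)
     else 0)"

lemma emeasure_chord_tail_direction:
  fixes l u v :: "real^3"
  assumes v: "norm v = 1" and t: "0 \<le> t"
  shows "emeasure (plane_area v) {q \<in> perp v. t < chord_length (cbox l u) (v, q)}
       = ennreal (tail_area (u$1 - l$1) (u$2 - l$2) (u$3 - l$3) t \<bar>v$1\<bar> \<bar>v$2\<bar> \<bar>v$3\<bar>)"
proof -
  define a b c where "a = u$1 - l$1" and "b = u$2 - l$2" and "c = u$3 - l$3"
  define x y z where "x = \<bar>v$1\<bar>" and "y = \<bar>v$2\<bar>" and "z = \<bar>v$3\<bar>"
  have xyz: "0 \<le> x" "0 \<le> y" "0 \<le> z" by (auto simp: x_def y_def z_def)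
  define \<phi> where "\<phi> = (\<lambda>s. max 0 (a - s * x) * max 0 (b - s * y) * max 0 (c - s * z))"
  have m: "(\<lambda>q. chord_length (cbox l u) (v, q)) \<in> borel_measurable (plane_area v)"
  proof -
    have "(\<lambda>q. chord_length (cbox l u) (v, q)) \<in> borel_measurable borel"
      by (rule measurable_compose[OF _ borel_measurable_chord_length])
         (auto simp: borel_prod[symmetric])
    thus ?thesis
      by (simp add: measurable_restrict_space1 cong: measurable_cong_sets)
  qed
  have "emeasure (plane_area v) {q \<in> space (plane_area v). t < chord_length (cbox l u) (v, q)}
      = ennreal (tail_area a b c t x y z)"
  proof (rule emeasure_tail_from_excess[OF m])
    fix s assume s: "t \<le> s"
    hence s0: "0 \<le> s" using t by simp
    have "(\<integral>\<^sup>+q. ennreal (chord_length (cbox l u) (v, q) - s) \<partial>plane_area v)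
        = emeasure lborel {p. p \<in> cbox l u \<and> p + s *\<^sub>R v \<in> cbox l u}"
      by (rule emeasure_translated_overlap[symmetric, OF _ _ v s0]) auto
    also have "\<dots> = ennreal (\<phi> s)"
      using s0 unfolding emeasure_box_overlap prod_3
      by (simp add: \<phi>_def a_def b_def c_def x_def y_def z_def abs_mult)
    finally show "(\<integral>\<^sup>+q. ennreal (chord_length (cbox l u) (v, q) - s) \<partial>plane_area v) = ennreal (\<phi> s)" .
    show "0 \<le> \<phi> s" by (simp add: \<phi>_def)
  next
    show "(\<phi> has_real_derivative - tail_area a b c t x y z) (at_right t)"
    proof (cases "t * x < a \<and> t * y < b \<and> t * z < c")
      case True
      have ev: "eventually (\<lambda>s. 0 < k - s * w) (at_right t)" if "t * w < k" for k w :: real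
      proof -
        have "((\<lambda>s. k - s * w) \<longlongrightarrow> k - t * w) (at_right t)"
          by (intro tendsto_diff tendsto_mult tendsto_const tendsto_ident_at)
        from order_tendstoD(1)[OF this, of 0] show ?thesis using that by simp
      qed
      have "eventually (\<lambda>s. \<phi> s = (a - s * x) * (b - s * y) * (c - s * z)) (at_right t)"
        using ev[OF True[THEN conjunct1]] ev[OF True[THEN conjunct2, THEN conjunct1]]
          ev[OF True[THEN conjunct2, THEN conjunct2]]
        by eventually_elim (simp add: \<phi>_def)
      moreover have "\<phi> t = (a - t * x) * (b - t * y) * (c - t * z)"
        using True by (simp add: \<phi>_def)
      moreover have "((\<lambda>s. (a - s * x) * (b - s * y) * (c - s * z))
          has_real_derivative - tail_area a b c t x y z) (at_right t)"
        using True unfolding tail_area_def by (auto intro!: derivative_eq_intros simp: algebra_simps)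
      ultimately show ?thesis
        using has_field_derivative_cong_eventually[of \<phi> "\<lambda>s. (a - s * x) * (b - s * y) * (c - s * z)"] by blast
    next
      case False
      have "\<phi> s = 0" if "t \<le> s" for s
      proof -
        have "t * x \<le> s * x" "t * y \<le> s * y" "t * z \<le> s * z"
          using that xyz by (auto intro: mult_right_mono)
        thus ?thesis using False by (auto simp: \<phi>_def max_def)
      qed
      hence "eventually (\<lambda>s. \<phi> s = 0) (at_right t)" "\<phi> t = 0"
        by (auto simp: eventually_at_filter intro!: always_eventually)
      moreover have "((\<lambda>_. 0) has_real_derivative - tail_area a b c t x y z) (at_right t)"
        using False by (auto simp: tail_area_def)
      ultimately show ?thesis
        using has_field_derivative_cong_eventually[of \<phi> "\<lambda>_. 0"] by blast
    qed
  qed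
  thus ?thesis
    by (simp add: a_def b_def c_def x_def y_def z_def)
qed

lemma box3_eq_cbox: "box3 a b c = cbox 0 (vector [a, b, c])"
  by (auto simp: box3_def mem_box_cart forall_3)

definition hitting_lines :: "(real^3) set \<Rightarrow> ((real^3) \<times> (real^3)) set" where
  "hitting_lines K = {l \<in> directed_lines. points_of l \<inter> K \<noteq> {}}"

lemma positive_chord_hits:
  assumes "l \<in> directed_lines" "0 < chord_length K l"
  shows "l \<in> hitting_lines K"
proof -
  obtain v q where l: "l = (v, q)" by (cases l)
  have "{s. q + s *\<^sub>R v \<in> K} \<noteq> {}"
    using assms(2) unfolding l by (metis chord_length_def case_prod_conv less_irrefl measure_empty)
  thus ?thesis
    using assms(1) by (auto simp: hitting_lines_def points_of_def l)
qed

text \<open>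
  The set of lines hitting \<open>K\<close> is the continuous image of the compact set of pairs of a unit vector
  and a point of \<open>K\<close>; this is how it is seen to be measurable.
\<close>

lemma compact_hitting_lines:
  assumes "compact K"
  shows "compact (hitting_lines K)"
proof -
  let ?\<pi> = "\<lambda>(v, x). (v, x - (v \<bullet> x) *\<^sub>R v) :: (real^3) \<times> (real^3)"
  have "hitting_lines K = ?\<pi> ` (sphere 0 1 \<times> K)"
  proof (intro set_eqI iffI)
    fix l assume "l \<in> hitting_lines K"
    then obtain v q s where l: "l = (v, q)" "norm v = 1" "v \<bullet> q = 0" "q + s *\<^sub>R v \<in> K"
      by (auto simp: hitting_lines_def directed_lines_def perp_def points_of_def)
    hence "l = ?\<pi> (v, q + s *\<^sub>R v)"
      by (simp add: inner_add_right dot_square_norm)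
    thus "l \<in> ?\<pi> ` (sphere 0 1 \<times> K)"
      using l by (intro image_eqI[of _ _ "(v, q + s *\<^sub>R v)"]) auto
  next
    fix l assume "l \<in> ?\<pi> ` (sphere 0 1 \<times> K)"
    then obtain v x where l: "l = (v, x - (v \<bullet> x) *\<^sub>R v)" "norm v = 1" "x \<in> K"
      by auto
    have "x \<in> points_of l"
      by (auto simp: points_of_def l(1) intro!: image_eqI[of _ _ "v \<bullet> x"])
    thus "l \<in> hitting_lines K"
      using l perp_project[of v x] by (auto simp: hitting_lines_def directed_lines_def)
  qed
  moreover have "compact (?\<pi> ` (sphere 0 1 \<times> K))"
    using assms by (intro compact_continuous_image compact_Times)
      (auto simp: case_prod_unfold intro!: continuous_intros)
  ultimately show ?thesis by simp
qed

text \<open>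
  Lines that touch the box without entering it have chord length zero, so the tail at \<open>0\<close> does not
  count them. They enter every larger box, so the shadow is squeezed between the tails at \<open>0\<close> of
  the box and of its enlargement by \<open>\<epsilon>\<close> on each side.
\<close>

lemma emeasure_shadow_direction:
  fixes v :: "real^3"
  assumes v: "norm v = 1" and abc: "0 < a" "0 < b" "0 < c"
  shows "emeasure (plane_area v) {q. (v, q) \<in> hitting_lines (box3 a b c)}
       = ennreal (tail_area a b c 0 \<bar>v$1\<bar> \<bar>v$2\<bar> \<bar>v$3\<bar>)"
proof (rule antisym)
  let ?P = "plane_area v" and ?H = "{q. (v, q) \<in> hitting_lines (box3 a b c)}"
  define T where "T = (\<lambda>\<epsilon>. tail_area (a + 2 * \<epsilon>) (b + 2 * \<epsilon>) (c + 2 * \<epsilon>) 0 \<bar>v$1\<bar> \<bar>v$2\<bar> \<bar>v$3\<bar>)"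
  have Hm: "?H \<in> sets ?P"
  proof -
    have "closed (hitting_lines (box3 a b c))"
      by (simp add: compact_imp_closed compact_hitting_lines box3_eq_cbox)
    hence "closed (Pair v -` hitting_lines (box3 a b c))"
      by (intro closed_vimage) (auto intro!: continuous_intros)
    moreover have "?H \<subseteq> perp v"
      by (auto simp: hitting_lines_def directed_lines_def)
    ultimately show ?thesis
      by (auto simp: sets_restrict_space_iff vimage_def)
  qed
  have tail: "emeasure ?P {q \<in> perp v. 0 < chord_length (cbox (vector [-\<epsilon>, -\<epsilon>, -\<epsilon>]) (vector [a + \<epsilon>, b + \<epsilon>, c + \<epsilon>])) (v, q)}
      = ennreal (T \<epsilon>)" for \<epsilon>
    using emeasure_chord_tail_direction[OF v, of 0] by (simp add: T_def algebra_simps)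
  have chord_sets: "{q \<in> perp v. 0 < chord_length (cbox l u) (v, q)} \<in> sets ?P" for l u
  proof -
    have "(\<lambda>q. chord_length (cbox l u) (v, q)) \<in> borel_measurable borel"
      by (rule measurable_compose[OF _ borel_measurable_chord_length])
         (auto simp: borel_prod[symmetric])
    hence "{q. 0 < chord_length (cbox l u) (v, q)} \<in> sets borel"
      by measurable
    thus ?thesis by (auto simp: sets_restrict_space)
  qed
  have "{q \<in> perp v. 0 < chord_length (box3 a b c) (v, q)} \<subseteq> ?H"
    using v by (auto intro: positive_chord_hits simp: directed_lines_def)
  hence "emeasure ?P {q \<in> perp v. 0 < chord_length (box3 a b c) (v, q)} \<le> emeasure ?P ?H"
    by (rule emeasure_mono) (rule Hm)
  also have "emeasure ?P {q \<in> perp v. 0 < chord_length (box3 a b c) (v, q)}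
      = ennreal (tail_area a b c 0 \<bar>v$1\<bar> \<bar>v$2\<bar> \<bar>v$3\<bar>)"
    using emeasure_chord_tail_direction[OF v, of 0 0 "vector [a, b, c]"] by (simp add: box3_eq_cbox)
  finally show "ennreal (tail_area a b c 0 \<bar>v$1\<bar> \<bar>v$2\<bar> \<bar>v$3\<bar>) \<le> emeasure ?P ?H" .
  have vi: "\<bar>v $ i\<bar> \<le> 1" for i
    using component_le_norm_cart[of v i] v by simp
  have "emeasure ?P ?H \<le> ennreal (T \<epsilon>)" if \<epsilon>: "\<epsilon> > 0" for \<epsilon>
  proof -
    let ?K = "cbox (vector [-\<epsilon>, -\<epsilon>, -\<epsilon>]) (vector [a + \<epsilon>, b + \<epsilon>, c + \<epsilon>]) :: (real^3) set"
    have "?H \<subseteq> {q \<in> perp v. 0 < chord_length ?K (v, q)}"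
    proof
      fix q assume "q \<in> ?H"
      then obtain s where q: "q \<in> perp v" and s: "q + s *\<^sub>R v \<in> box3 a b c"
        by (auto simp: hitting_lines_def directed_lines_def points_of_def)
      obtain \<alpha> \<beta> where I: "{s. q + s *\<^sub>R v \<in> ?K} = {\<alpha>..\<beta>}"
        using line_slice_interval[of ?K v q] v by fastforce
      have "q + (s + r) *\<^sub>R v \<in> ?K" if r: "\<bar>r\<bar> \<le> \<epsilon>" for r
      proof -
        have "\<bar>r * v $ i\<bar> \<le> \<epsilon> * 1" for i
          unfolding abs_mult using r vi[of i] by (intro mult_mono) auto
        hence "- \<epsilon> \<le> r * v $ i \<and> r * v $ i \<le> \<epsilon>" for i
          by (metis abs_le_iff minus_le_iff mult.right_neutral)
        moreover have "q $ i + (s + r) * v $ i = (q $ i + s * v $ i) + r * v $ i" for i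
          by (simp add: algebra_simps)
        ultimately have
            lower: "0 \<le> q $ i + s * v $ i \<Longrightarrow> - \<epsilon> \<le> q $ i + (s + r) * v $ i" and
            upper: "q $ i + s * v $ i \<le> m \<Longrightarrow> q $ i + (s + r) * v $ i \<le> m + \<epsilon>" for i m
          by (smt (verit))+
        show ?thesis
          using s by (simp add: box3_def mem_box_cart forall_3 lower upper)
      qed
      from this[of 0] this[of \<epsilon>] have "s \<in> {\<alpha>..\<beta>}" "s + \<epsilon> \<in> {\<alpha>..\<beta>}"
        using \<epsilon> unfolding I[symmetric] by auto
      hence "0 < chord_length ?K (v, q)"
        using \<epsilon> by (auto simp: chord_length_def I)
      thus "q \<in> {q \<in> perp v. 0 < chord_length ?K (v, q)}"
        using q by simp
    qed
    hence "emeasure ?P ?H \<le> emeasure ?P {q \<in> perp v. 0 < chord_length ?K (v, q)}"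
      by (rule emeasure_mono) (rule chord_sets)
    thus ?thesis by (simp only: tail)
  qed
  hence "eventually (\<lambda>\<epsilon>. emeasure ?P ?H \<le> ennreal (T \<epsilon>)) (at_right 0)"
    by (auto simp: eventually_at_filter)
  moreover have "((\<lambda>\<epsilon>. ennreal (T \<epsilon>)) \<longlongrightarrow> ennreal (tail_area a b c 0 \<bar>v$1\<bar> \<bar>v$2\<bar> \<bar>v$3\<bar>)) (at_right 0)"
  proof (rule tendsto_ennrealI)
    define p where "p = (\<lambda>\<epsilon>. \<bar>v$1\<bar> * (b + 2*\<epsilon>) * (c + 2*\<epsilon>) + \<bar>v$2\<bar> * (c + 2*\<epsilon>) * (a + 2*\<epsilon>) + \<bar>v$3\<bar> * (a + 2*\<epsilon>) * (b + 2*\<epsilon>))"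
    have "(p \<longlongrightarrow> \<bar>v$1\<bar> * (b + 2*0) * (c + 2*0) + \<bar>v$2\<bar> * (c + 2*0) * (a + 2*0) + \<bar>v$3\<bar> * (a + 2*0) * (b + 2*0)) (at_right 0)"
      unfolding p_def by (rule tendsto_intros)+
    moreover have "eventually (\<lambda>\<epsilon>. p \<epsilon> = T \<epsilon>) (at_right 0)"
      using abc by (auto simp: eventually_at_filter p_def T_def tail_area_def)
    ultimately show "(T \<longlongrightarrow> tail_area a b c 0 \<bar>v$1\<bar> \<bar>v$2\<bar> \<bar>v$3\<bar>) (at_right 0)"
      using abc by (simp add: tail_area_def tendsto_cong)
  qed
  ultimately show "emeasure ?P ?H \<le> ennreal (tail_area a b c 0 \<bar>v$1\<bar> \<bar>v$2\<bar> \<bar>v$3\<bar>)"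
    by (intro tendsto_le[OF _ _ tendsto_const]) auto
qed

section \<open>Polar coordinates in three-space\<close>

lemma measurable_radial_projection:
  "(\<lambda>x. x /\<^sub>R norm x) \<in> measurable (scale_measure 3 (restrict_space lborel (ball 0 1 - {0})))
     (restrict_space borel (sphere (0::real^3) 1))"
proof (rule measurable_restrict_space2)
  have "(\<lambda>x. x /\<^sub>R norm x) \<in> measurable (restrict_space lborel (ball 0 1 - {0})) (borel :: (real^3) measure)"
    by (rule measurable_restrict_space1) measurable
  thus "(\<lambda>x. x /\<^sub>R norm x) \<in> measurable (scale_measure 3 (restrict_space lborel (ball 0 1 - {0})))
     (borel :: (real^3) measure)"
    by (simp cong: measurable_cong_sets)
qed (auto simp: space_restrict_space space_scale_measure)

lemma nn_integral_sphere_area: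
  assumes [measurable]: "f \<in> borel_measurable borel"
  shows "(\<integral>\<^sup>+v. f v \<partial>sphere_area) = 3 * (\<integral>\<^sup>+x. indicator (ball 0 1 - {0}) x * f (x /\<^sub>R norm x) \<partial>lborel)"
proof -
  have "(\<integral>\<^sup>+v. f v \<partial>sphere_area)
      = (\<integral>\<^sup>+x. f (x /\<^sub>R norm x) \<partial>scale_measure 3 (restrict_space lborel (ball 0 1 - {0})))"
    unfolding sphere_area_def
    by (subst nn_integral_distr[OF measurable_radial_projection]) (auto intro: measurable_restrict_space1)
  also have "\<dots> = 3 * (\<integral>\<^sup>+x. f (x /\<^sub>R norm x) \<partial>restrict_space lborel (ball 0 1 - {0}))"
    by (rule nn_integral_scale_measure) (auto intro: measurable_restrict_space1)
  also have "\<dots> = 3 * (\<integral>\<^sup>+x. indicator (ball 0 1 - {0}) x * f (x /\<^sub>R norm x) \<partial>lborel)"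
    by (subst nn_integral_restrict_space) (auto simp: mult.commute)
  finally show ?thesis .
qed

lemma nn_integral_lborel_scale3:
  fixes f :: "real^3 \<Rightarrow> ennreal"
  assumes [measurable]: "f \<in> borel_measurable borel" and "0 < u"
  shows "(\<integral>\<^sup>+x. f x \<partial>lborel) = ennreal (u ^ 3) * (\<integral>\<^sup>+x. f (u *\<^sub>R x) \<partial>lborel)"
  using \<open>0 < u\<close>
  by (subst lborel_affine[of u 0]) (auto simp: nn_integral_density nn_integral_distr nn_integral_cmult)

lemma nn_integral_inverse_power4:
  assumes "0 < r"
  shows "(\<integral>\<^sup>+u. ennreal (3 / u ^ 4) * indicator {r<..} u \<partial>lborel) = ennreal (1 / r ^ 3)"
proof -
  have "(\<integral>\<^sup>+u. ennreal (3 / u ^ 4) * indicator {r<..} u \<partial>lborel)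
      = (\<integral>\<^sup>+u. ennreal (3 / u ^ 4) * indicator {r..} u \<partial>lborel)"
    by (rule nn_integral_cong_AE, rule AE_mp[OF AE_lborel_singleton[of r]]) (auto simp: indicator_def)
  also have "\<dots> = ennreal (0 - (- 1 / r ^ 3))"
  proof (rule nn_integral_FTC_atLeast[where F = "\<lambda>u. - 1 / u ^ 3"])
    show "((\<lambda>u::real. - 1 / u ^ 3) \<longlongrightarrow> 0) at_top"
      by (rule tendsto_divide_0[OF tendsto_const filterlim_at_top_imp_at_infinity])
         (intro filterlim_pow_at_top filterlim_ident, simp)
    show "((\<lambda>u. - 1 / u ^ 3) has_real_derivative 3 / x ^ 4) (at x)" if "r \<le> x" for x
      using that assms
      by (auto intro!: derivative_eq_intros simp: divide_simps eval_nat_numeral)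
  qed auto
  finally show ?thesis by simp
qed

text \<open>
  The sphere is measured here by the unit ball, so the left-hand side is a fourfold integral over a point
  \<open>x\<close> of the ball and a radius. Scaling the radius to \<open>s = u |x|\<close> and then \<open>x\<close> to \<open>y = u x\<close> turns the
  integrand into \<open>h y\<close> with the weight \<open>3 |y|\<^sup>3 / u\<^sup>4\<close> on \<open>u > |y|\<close>, which has total mass one.
\<close>

theorem polar_coordinates:
  fixes h :: "real^3 \<Rightarrow> ennreal"
  assumes [measurable]: "h \<in> borel_measurable borel"
  shows "(\<integral>\<^sup>+v. (\<integral>\<^sup>+s. ennreal (s\<^sup>2) * indicator {0<..} s * h (s *\<^sub>R v) \<partial>lborel) \<partial>sphere_area)
       = (\<integral>\<^sup>+x. h x \<partial>lborel)"
proof -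
  let ?B = "ball 0 1 - {0} :: (real^3) set"
  let ?I = "indicator {0<..} :: real \<Rightarrow> ennreal"
  define g where "g = (\<lambda>u x. if x \<noteq> 0 \<and> norm x < 1 \<and> 0 < u then ennreal (u\<^sup>2 * norm x ^ 3) * h (u *\<^sub>R x) else 0)"
  define k where "k = (\<lambda>u y. if y \<noteq> 0 \<and> norm y < u then ennreal (norm y ^ 3 / u ^ 4) * h y else 0)"
  have [measurable]: "case_prod g \<in> borel_measurable (lborel \<Otimes>\<^sub>M lborel)"
      "case_prod (\<lambda>x u. g u x) \<in> borel_measurable (lborel \<Otimes>\<^sub>M lborel)"
    unfolding g_def by measurable
  have km [measurable]: "case_prod k \<in> borel_measurable (lborel \<Otimes>\<^sub>M lborel)"
      "case_prod (\<lambda>x u. k u x) \<in> borel_measurable (lborel \<Otimes>\<^sub>M lborel)"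
    unfolding k_def by measurable
  have ku [measurable]: "k u \<in> borel_measurable borel" for u
    unfolding k_def by measurable
  have "(\<integral>\<^sup>+v. (\<integral>\<^sup>+s. ennreal (s\<^sup>2) * ?I s * h (s *\<^sub>R v) \<partial>lborel) \<partial>sphere_area)
      = 3 * (\<integral>\<^sup>+x. indicator ?B x *
          (\<integral>\<^sup>+s. ennreal (s\<^sup>2) * ?I s * h (s *\<^sub>R (x /\<^sub>R norm x)) \<partial>lborel) \<partial>lborel)"
    by (rule nn_integral_sphere_area) measurable
  also have "\<dots> = 3 * (\<integral>\<^sup>+x. (\<integral>\<^sup>+u. g u x \<partial>lborel) \<partial>lborel)"
  proof (rule arg_cong[where f = "\<lambda>r. 3 * r"], rule nn_integral_cong)
    fix x :: "real^3"
    show "indicator ?B x * (\<integral>\<^sup>+s. ennreal (s\<^sup>2) * ?I s * h (s *\<^sub>R (x /\<^sub>R norm x)) \<partial>lborel)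
        = (\<integral>\<^sup>+u. g u x \<partial>lborel)"
    proof (cases "x \<noteq> 0 \<and> norm x < 1")
      case True
      define r where "r = norm x"
      have r: "r > 0" using True by (simp add: r_def)
      have "(\<integral>\<^sup>+s. ennreal (s\<^sup>2) * ?I s * h (s *\<^sub>R (x /\<^sub>R r)) \<partial>lborel)
          = ennreal \<bar>r\<bar> * (\<integral>\<^sup>+u. ennreal ((0 + r * u)\<^sup>2) * ?I (0 + r * u) * h ((0 + r * u) *\<^sub>R (x /\<^sub>R r)) \<partial>lborel)"
        using r by (intro nn_integral_real_affine) auto
      also have "\<dots> = (\<integral>\<^sup>+u. ennreal r * (ennreal ((r * u)\<^sup>2) * ?I (r * u) * h ((r * u) *\<^sub>R (x /\<^sub>R r))) \<partial>lborel)"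
        using r by (simp add: nn_integral_cmult)
      also have "\<dots> = (\<integral>\<^sup>+u. g u x \<partial>lborel)"
      proof (rule nn_integral_cong)
        fix u :: real
        have "(r * u) *\<^sub>R (x /\<^sub>R r) = u *\<^sub>R x" using r by simp
        moreover have "?I (r * u) = ?I u" using r by (simp add: indicator_def zero_less_mult_iff)
        moreover have "ennreal r * ennreal ((r * u)\<^sup>2) = ennreal (u\<^sup>2 * r ^ 3)"
          using r by (subst ennreal_mult[symmetric]) (auto simp: power_mult_distrib eval_nat_numeral mult_ac)
        ultimately have "ennreal r * (ennreal ((r * u)\<^sup>2) * ?I (r * u) * h ((r * u) *\<^sub>R (x /\<^sub>R r)))
            = ennreal (u\<^sup>2 * r ^ 3) * ?I u * h (u *\<^sub>R x)"
          by (simp only: mult.assoc[symmetric])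
        thus "ennreal r * (ennreal ((r * u)\<^sup>2) * ?I (r * u) * h ((r * u) *\<^sub>R (x /\<^sub>R r))) = g u x"
          using True by (simp add: g_def r_def)
      qed
      finally show ?thesis
        using True by (simp add: r_def[symmetric])
    next
      case False
      thus ?thesis by (auto simp: g_def)
    qed
  qed
  also have "\<dots> = 3 * (\<integral>\<^sup>+u. (\<integral>\<^sup>+x. g u x \<partial>lborel) \<partial>lborel)"
    by (intro arg_cong[where f = "\<lambda>r. 3 * r"] lborel_pair.Fubini') measurable
  also have "\<dots> = 3 * (\<integral>\<^sup>+u. (\<integral>\<^sup>+y. k u y \<partial>lborel) \<partial>lborel)"
  proof (rule arg_cong[where f = "\<lambda>r. 3 * r"], rule nn_integral_cong)
    fix u :: real
    show "(\<integral>\<^sup>+x. g u x \<partial>lborel) = (\<integral>\<^sup>+y. k u y \<partial>lborel)"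
    proof (cases "u > 0")
      case u: True
      have "(\<integral>\<^sup>+y. k u y \<partial>lborel) = ennreal (u ^ 3) * (\<integral>\<^sup>+x. k u (u *\<^sub>R x) \<partial>lborel)"
        by (rule nn_integral_lborel_scale3[OF ku u])
      also have "\<dots> = (\<integral>\<^sup>+x. ennreal (u ^ 3) * k u (u *\<^sub>R x) \<partial>lborel)"
        by (rule nn_integral_cmult[symmetric]) measurable
      also have "\<dots> = (\<integral>\<^sup>+x. g u x \<partial>lborel)"
      proof (rule nn_integral_cong)
        fix x :: "real^3"
        have "ennreal (u ^ 3) * ennreal (norm (u *\<^sub>R x) ^ 3 / u ^ 4) = ennreal (u\<^sup>2 * norm x ^ 3)"
          using u by (subst ennreal_mult[symmetric]) (auto simp: power_mult_distrib eval_nat_numeral)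
        thus "ennreal (u ^ 3) * k u (u *\<^sub>R x) = g u x"
          using u by (simp add: k_def g_def mult.assoc[symmetric])
      qed
      finally show ?thesis ..
    next
      case False
      have "\<not> norm y < u" for y :: "real^3"
        using False norm_ge_zero[of y] by linarith
      thus ?thesis using False by (simp add: g_def k_def)
    qed
  qed
  also have "\<dots> = 3 * (\<integral>\<^sup>+y. (\<integral>\<^sup>+u. k u y \<partial>lborel) \<partial>lborel)"
    by (intro arg_cong[where f = "\<lambda>r. 3 * r"] lborel_pair.Fubini') measurable
  also have "\<dots> = (\<integral>\<^sup>+y. 3 * (\<integral>\<^sup>+u. k u y \<partial>lborel) \<partial>lborel)"
    by (rule nn_integral_cmult[symmetric]) measurable
  also have "\<dots> = (\<integral>\<^sup>+y. h y \<partial>lborel)"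
  proof (rule nn_integral_cong_AE, rule AE_mp[OF AE_lborel_singleton[of 0]], rule AE_I2, rule impI)
    fix y :: "real^3" assume y: "y \<noteq> 0"
    have "3 * (\<integral>\<^sup>+u. k u y \<partial>lborel) = (\<integral>\<^sup>+u. 3 * k u y \<partial>lborel)"
      by (rule nn_integral_cmult[symmetric]) (simp add: k_def)
    also have "\<dots> = (\<integral>\<^sup>+u. ennreal (3 / u ^ 4) * indicator {norm y<..} u * (ennreal (norm y ^ 3) * h y) \<partial>lborel)"
    proof (rule nn_integral_cong)
      fix u :: real
      have "3 * ennreal (norm y ^ 3 / u ^ 4) = ennreal (3 / u ^ 4) * ennreal (norm y ^ 3)"
        by (simp add: ennreal_mult[symmetric] flip: ennreal_numeral)
      thus "3 * k u y = ennreal (3 / u ^ 4) * indicator {norm y<..} u * (ennreal (norm y ^ 3) * h y)"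
        using y by (simp add: k_def indicator_def mult.assoc[symmetric])
    qed
    also have "\<dots> = ennreal (1 / norm y ^ 3) * (ennreal (norm y ^ 3) * h y)"
      using y nn_integral_inverse_power4[of "norm y"] by (subst nn_integral_multc) auto
    also have "\<dots> = h y"
      using y by (simp add: mult.assoc[symmetric] ennreal_mult[symmetric])
    finally show "3 * (\<integral>\<^sup>+u. k u y \<partial>lborel) = h y" .
  qed
  finally show ?thesis .
qed

lemma AE_sphere_area_nonzero: "AE v in sphere_area. v $ i \<noteq> 0"
proof -
  have "(\<integral>\<^sup>+v. indicator {v::real^3. v $ i = 0} v \<partial>sphere_area)
      = 3 * (\<integral>\<^sup>+x. indicator (ball 0 1 - {0}) x * indicator {v::real^3. v $ i = 0} (x /\<^sub>R norm x) \<partial>lborel)"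
    by (rule nn_integral_sphere_area) measurable
  also have "\<dots> \<le> 3 * (\<integral>\<^sup>+x. indicator {x::real^3. x $ i = 0} x \<partial>lborel)"
    by (intro mult_left_mono nn_integral_mono) (auto simp: indicator_def)
  also have "\<dots> = 3 * emeasure lborel {x::real^3. x $ i = 0}"
    by (rule arg_cong[where f = "\<lambda>r. 3 * r"], rule nn_integral_indicator) measurable
  also have "emeasure lborel {x::real^3. x $ i = 0} = 0"
  proof -
    have "negligible {x::real^3. axis i 1 \<bullet> x = 0}"
      by (rule negligible_hyperplane) (simp add: axis_eq_0_iff)
    hence "negligible {x::real^3. x $ i = 0}"
      by (simp add: inner_axis inner_commute)
    moreover have "{x::real^3. x $ i = 0} \<in> sets borel"
      by measurable
    ultimately show ?thesis
      by (auto simp: negligible_iff_null_sets null_sets_def)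
  qed
  finally have 0: "(\<integral>\<^sup>+v. indicator {v::real^3. v $ i = 0} v \<partial>sphere_area) = 0"
    by simp
  have "(indicator {v. v $ i = 0} :: real^3 \<Rightarrow> ennreal) \<in> borel_measurable sphere_area"
    by (simp add: sphere_area_def measurable_restrict_space1)
  hence "AE v in sphere_area. indicator {v::real^3. v $ i = 0} v = (0::ennreal)"
    using 0 by (simp add: nn_integral_0_iff_AE)
  thus ?thesis
    by (rule AE_mp) (auto simp: indicator_def)
qed

section \<open>Integrals over the positive octant\<close>

lemma nn_integral_lborel_vec3:
  fixes h :: "real^3 \<Rightarrow> ennreal"
  assumes [measurable]: "h \<in> borel_measurable borel"
  shows "(\<integral>\<^sup>+x. h x \<partial>lborel) = (\<integral>\<^sup>+x. (\<integral>\<^sup>+y. (\<integral>\<^sup>+z. h (vector [x, y, z]) \<partial>lborel) \<partial>lborel) \<partial>lborel)"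
proof -
  let ?E = "\<lambda>((x, y), s). vector [x, y, s] :: real^3"
  have [measurable]: "(\<lambda>p. vector [fst (fst p), snd (fst p), snd p] :: real^3)
      \<in> borel_measurable ((borel \<Otimes>\<^sub>M borel) \<Otimes>\<^sub>M borel)"
    using measurable_triple by (simp add: case_prod_unfold borel_prod)
  have m: "(\<lambda>p. h (?E p)) \<in> borel_measurable ((borel \<Otimes>\<^sub>M borel) \<Otimes>\<^sub>M borel)"
    unfolding case_prod_unfold by measurable
  have "(\<integral>\<^sup>+x. h x \<partial>lborel) = (\<integral>\<^sup>+x. h x \<partial>distr (lborel :: ((real \<times> real) \<times> real) measure) borel ?E)"
    by (simp only: lborel_triple)
  also have "\<dots> = (\<integral>\<^sup>+p. h (?E p) \<partial>lborel)"
    by (rule nn_integral_distr[OF measurable_triple]) simp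
  also have "\<dots> = (\<integral>\<^sup>+p. (\<integral>\<^sup>+z. h (?E (p, z)) \<partial>lborel) \<partial>lborel)"
  proof -
    have "(\<lambda>p. h (?E p)) \<in> borel_measurable ((lborel :: (real \<times> real) measure) \<Otimes>\<^sub>M lborel)"
      using m by (simp only: borel_prod lborel_prod measurable_lborel1 measurable_lborel2)
    from lborel.nn_integral_fst[OF this] show ?thesis
      by (simp only: lborel_prod)
  qed
  also have "\<dots> = (\<integral>\<^sup>+x. (\<integral>\<^sup>+y. (\<integral>\<^sup>+z. h (?E ((x, y), z)) \<partial>lborel) \<partial>lborel) \<partial>lborel)"
  proof -
    have "(\<lambda>p. \<integral>\<^sup>+z. h (?E (p, z)) \<partial>lborel) \<in> borel_measurable (borel \<Otimes>\<^sub>M borel)"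
      using m by (intro lborel.borel_measurable_nn_integral) (simp add: case_prod_unfold cong: measurable_cong_sets)
    hence "(\<lambda>p. \<integral>\<^sup>+z. h (?E (p, z)) \<partial>lborel) \<in> borel_measurable (lborel \<Otimes>\<^sub>M lborel)"
      by (simp cong: measurable_cong_sets)
    from lborel.nn_integral_fst[OF this] show ?thesis
      by (simp only: lborel_prod)
  qed
  finally show ?thesis by simp
qed

text \<open>
  Measurability of a function of three real variables, in a form in which measurability
  of compositions can be derived automatically.
\<close>

lemma borel_measurable_curried3:
  fixes f :: "real \<Rightarrow> real \<Rightarrow> real \<Rightarrow> ennreal"
  assumes f: "(\<lambda>(x, y, z). f x y z) \<in> borel_measurable borel"
    and [measurable]: "X \<in> borel_measurable M" "Y \<in> borel_measurable M" "Z \<in> borel_measurable M"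
  shows "(\<lambda>w. f (X w) (Y w) (Z w)) \<in> borel_measurable M"
proof -
  have "(\<lambda>w. (X w, Y w, Z w)) \<in> measurable M (borel \<Otimes>\<^sub>M borel \<Otimes>\<^sub>M borel)"
    by measurable
  hence "(\<lambda>w. (X w, Y w, Z w)) \<in> borel_measurable M"
    by (simp add: borel_prod)
  from measurable_compose[OF this f] show ?thesis by simp
qed

text \<open>
  All integrands depend only on the absolute values of the coordinates. Iterated integrals
  over half-lines make permutations and rescalings of single coordinates easy.
\<close>

definition octant_integral :: "(real \<Rightarrow> real \<Rightarrow> real \<Rightarrow> ennreal) \<Rightarrow> ennreal" where
  "octant_integral f = (\<integral>\<^sup>+x\<in>{0<..}. (\<integral>\<^sup>+y\<in>{0<..}. (\<integral>\<^sup>+z\<in>{0<..}. f x y z \<partial>lborel) \<partial>lborel) \<partial>lborel)"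

lemma octant_integral_cong:
  assumes "\<And>x y z. 0 < x \<Longrightarrow> 0 < y \<Longrightarrow> 0 < z \<Longrightarrow> f x y z = g x y z"
  shows "octant_integral f = octant_integral g"
  unfolding octant_integral_def using assms by (intro set_nn_integral_cong refl) auto

lemma nn_integral_swap_set:
  fixes f :: "real \<Rightarrow> real \<Rightarrow> ennreal"
  assumes f: "(\<lambda>(x, y). f x y) \<in> borel_measurable (borel \<Otimes>\<^sub>M borel)"
    and [measurable]: "A \<in> sets borel" "B \<in> sets borel"
  shows "(\<integral>\<^sup>+x\<in>A. (\<integral>\<^sup>+y\<in>B. f x y \<partial>lborel) \<partial>lborel) = (\<integral>\<^sup>+y\<in>B. (\<integral>\<^sup>+x\<in>A. f x y \<partial>lborel) \<partial>lborel)"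
proof -
  have [measurable]: "(\<lambda>(x, y). f x y) \<in> borel_measurable (borel \<Otimes>\<^sub>M borel)" by fact
  have 1: "(\<lambda>y. f x y) \<in> borel_measurable borel" "(\<lambda>x. f x z) \<in> borel_measurable borel" for x z
    using measurable_compose[OF measurable_Pair1' f, of x] measurable_compose[OF measurable_Pair2' f, of z]
    by simp_all
  have [measurable]: "(\<lambda>p. f (fst p) (snd p)) \<in> borel_measurable (borel \<Otimes>\<^sub>M borel)"
    using f by (simp add: case_prod_unfold)
  have "(\<integral>\<^sup>+x\<in>A. (\<integral>\<^sup>+y\<in>B. f x y \<partial>lborel) \<partial>lborel)
      = (\<integral>\<^sup>+x. (\<integral>\<^sup>+y. f x y * indicator B y * indicator A x \<partial>lborel) \<partial>lborel)"
    using 1 by (intro nn_integral_cong) (simp add: nn_integral_multc)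
  also have "\<dots> = (\<integral>\<^sup>+y. (\<integral>\<^sup>+x. f x y * indicator B y * indicator A x \<partial>lborel) \<partial>lborel)"
    by (rule lborel_pair.Fubini') (simp add: case_prod_unfold)
  also have "\<dots> = (\<integral>\<^sup>+y. (\<integral>\<^sup>+x. f x y * indicator A x * indicator B y \<partial>lborel) \<partial>lborel)"
    by (simp add: mult_ac)
  also have "\<dots> = (\<integral>\<^sup>+y\<in>B. (\<integral>\<^sup>+x\<in>A. f x y \<partial>lborel) \<partial>lborel)"
    using 1 by (intro nn_integral_cong) (simp add: nn_integral_multc)
  finally show ?thesis .
qed

lemma octant_integral_cyclic:
  assumes f: "(\<lambda>(x, y, z). f x y z) \<in> borel_measurable borel"
  shows "octant_integral f = octant_integral (\<lambda>z x y. f x y z)"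
proof -
  note [measurable (raw)] = borel_measurable_curried3[OF f]
  have "octant_integral f
      = (\<integral>\<^sup>+x\<in>{0<..}. (\<integral>\<^sup>+z\<in>{0<..}. (\<integral>\<^sup>+y\<in>{0<..}. f x y z \<partial>lborel) \<partial>lborel) \<partial>lborel)"
    unfolding octant_integral_def
    by (intro nn_integral_cong arg_cong2[where f = "(*)"] refl nn_integral_swap_set) measurable
  also have "\<dots> = (\<integral>\<^sup>+z\<in>{0<..}. (\<integral>\<^sup>+x\<in>{0<..}. (\<integral>\<^sup>+y\<in>{0<..}. f x y z \<partial>lborel) \<partial>lborel) \<partial>lborel)"
    by (rule nn_integral_swap_set) measurable
  finally show ?thesis
    by (simp add: octant_integral_def)
qed

lemma nn_integral_even:
  fixes f :: "real \<Rightarrow> ennreal"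
  assumes [measurable]: "f \<in> borel_measurable borel"
  shows "(\<integral>\<^sup>+x. f \<bar>x\<bar> \<partial>lborel) = 2 * (\<integral>\<^sup>+x\<in>{0<..}. f x \<partial>lborel)"
proof -
  have "(\<integral>\<^sup>+x. f \<bar>x\<bar> \<partial>lborel) = (\<integral>\<^sup>+x. f x * indicator {0<..} x + f (- x) * indicator {0<..} (- x) \<partial>lborel)"
    by (rule nn_integral_cong_AE, rule AE_mp[OF AE_lborel_singleton[of 0]]) (auto simp: indicator_def)
  also have "\<dots> = (\<integral>\<^sup>+x\<in>{0<..}. f x \<partial>lborel) + (\<integral>\<^sup>+x. f (- x) * indicator {0<..} (- x) \<partial>lborel)"
    by (rule nn_integral_add) measurable
  also have "(\<integral>\<^sup>+x. f (- x) * indicator {0<..} (- x) \<partial>lborel) = (\<integral>\<^sup>+x\<in>{0<..}. f x \<partial>lborel)"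
    using nn_integral_real_affine[of "\<lambda>x. f x * indicator {0<..} x" "-1" 0] by simp
  finally show ?thesis by (simp add: mult_2)
qed

lemma nn_integral_lborel_octant:
  assumes f: "(\<lambda>(x, y, z). f x y z) \<in> borel_measurable borel"
  shows "(\<integral>\<^sup>+x. f \<bar>x $ 1\<bar> \<bar>x $ 2\<bar> \<bar>x $ 3\<bar> \<partial>(lborel :: (real^3) measure)) = 8 * octant_integral f"
proof -
  note [measurable (raw)] = borel_measurable_curried3[OF f]
  have "(\<integral>\<^sup>+x. f \<bar>x $ 1\<bar> \<bar>x $ 2\<bar> \<bar>x $ 3\<bar> \<partial>(lborel :: (real^3) measure))
      = (\<integral>\<^sup>+x. (\<integral>\<^sup>+y. (\<integral>\<^sup>+z. f \<bar>x\<bar> \<bar>y\<bar> \<bar>z\<bar> \<partial>lborel) \<partial>lborel) \<partial>lborel)"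
    by (subst nn_integral_lborel_vec3) auto
  also have "\<dots> = (\<integral>\<^sup>+x. (\<integral>\<^sup>+y. 2 * (\<integral>\<^sup>+z\<in>{0<..}. f \<bar>x\<bar> \<bar>y\<bar> z \<partial>lborel) \<partial>lborel) \<partial>lborel)"
  proof (rule nn_integral_cong, rule nn_integral_cong)
    fix x y :: real
    show "(\<integral>\<^sup>+z. f \<bar>x\<bar> \<bar>y\<bar> \<bar>z\<bar> \<partial>lborel) = 2 * (\<integral>\<^sup>+z\<in>{0<..}. f \<bar>x\<bar> \<bar>y\<bar> z \<partial>lborel)"
      by (rule nn_integral_even[of "\<lambda>z. f \<bar>x\<bar> \<bar>y\<bar> z"]) measurable
  qed
  also have "\<dots> = (\<integral>\<^sup>+x. 2 * (\<integral>\<^sup>+y\<in>{0<..}. 2 * (\<integral>\<^sup>+z\<in>{0<..}. f \<bar>x\<bar> y z \<partial>lborel) \<partial>lborel) \<partial>lborel)"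
  proof (rule nn_integral_cong)
    fix x :: real
    show "(\<integral>\<^sup>+y. 2 * (\<integral>\<^sup>+z\<in>{0<..}. f \<bar>x\<bar> \<bar>y\<bar> z \<partial>lborel) \<partial>lborel)
        = 2 * (\<integral>\<^sup>+y\<in>{0<..}. 2 * (\<integral>\<^sup>+z\<in>{0<..}. f \<bar>x\<bar> y z \<partial>lborel) \<partial>lborel)"
      by (rule nn_integral_even[of "\<lambda>y. 2 * (\<integral>\<^sup>+z\<in>{0<..}. f \<bar>x\<bar> y z \<partial>lborel)"]) measurable
  qed
  also have "\<dots> = 2 * (\<integral>\<^sup>+x\<in>{0<..}. 2 * (\<integral>\<^sup>+y\<in>{0<..}. 2 * (\<integral>\<^sup>+z\<in>{0<..}. f x y z \<partial>lborel) \<partial>lborel) \<partial>lborel)"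
    by (rule nn_integral_even[of "\<lambda>x. 2 * (\<integral>\<^sup>+y\<in>{0<..}. 2 * (\<integral>\<^sup>+z\<in>{0<..}. f x y z \<partial>lborel) \<partial>lborel)"]; measurable)
  also have "\<dots> = 8 * octant_integral f"
    unfolding octant_integral_def
    by (simp add: mult.assoc nn_integral_cmult)
  finally show ?thesis .
qed

lemma norm_vec3: "norm (x :: real^3) = sqrt ((x$1)\<^sup>2 + (x$2)\<^sup>2 + (x$3)\<^sup>2)"
  by (simp add: norm_vec_def L2_set_def sum_3)

section \<open>Sphere integrals of functions of the absolute components\<close>

lemma sphere_area_octant:
  assumes f: "(\<lambda>(x, y, z). f x y z) \<in> borel_measurable borel"
  shows "(\<integral>\<^sup>+v. f \<bar>v $ 1\<bar> \<bar>v $ 2\<bar> \<bar>v $ 3\<bar> \<partial>sphere_area)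
    = 24 * octant_integral (\<lambda>x y z. let r = sqrt (x\<^sup>2 + y\<^sup>2 + z\<^sup>2) in
        if r < 1 then f (x / r) (y / r) (z / r) else 0)"
proof -
  note [measurable (raw)] = borel_measurable_curried3[OF f]
  define g where "g = (\<lambda>x y z. let r = sqrt (x\<^sup>2 + y\<^sup>2 + z\<^sup>2) in
        if r < 1 then f (x / r) (y / r) (z / r) else 0)"
  have g: "(\<lambda>(x, y, z). g x y z) \<in> borel_measurable borel"
    unfolding g_def Let_def borel_prod[symmetric] by measurable
  have "(\<integral>\<^sup>+v. f \<bar>v $ 1\<bar> \<bar>v $ 2\<bar> \<bar>v $ 3\<bar> \<partial>sphere_area)
     = 3 * (\<integral>\<^sup>+x. indicator (ball 0 1 - {0}) x * f \<bar>(x /\<^sub>R norm x :: real^3) $ 1\<bar> \<bar>(x /\<^sub>R norm x :: real^3) $ 2\<bar> \<bar>(x /\<^sub>R norm x :: real^3) $ 3\<bar> \<partial>lborel)"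
    by (rule nn_integral_sphere_area[of "\<lambda>v. f \<bar>v $ 1\<bar> \<bar>v $ 2\<bar> \<bar>v $ 3\<bar>"]) measurable
  also have "\<dots> = 3 * (\<integral>\<^sup>+x. g \<bar>x $ 1\<bar> \<bar>x $ 2\<bar> \<bar>x $ 3\<bar> \<partial>(lborel :: (real^3) measure))"
  proof (rule arg_cong[where f = "\<lambda>r. 3 * r"], rule nn_integral_cong_AE,
      rule AE_mp[OF AE_lborel_singleton[of 0]], rule AE_I2, rule impI)
    fix x :: "real^3" assume "x \<noteq> 0"
    thus "indicator (ball 0 1 - {0}) x * f \<bar>(x /\<^sub>R norm x :: real^3) $ 1\<bar> \<bar>(x /\<^sub>R norm x :: real^3) $ 2\<bar> \<bar>(x /\<^sub>R norm x :: real^3) $ 3\<bar>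
        = g \<bar>x $ 1\<bar> \<bar>x $ 2\<bar> \<bar>x $ 3\<bar>"
      unfolding g_def Let_def power2_abs norm_vec3[symmetric]
      by (auto simp: abs_mult divide_inverse mult.commute indicator_def)
  qed
  also have "\<dots> = 24 * octant_integral g"
    by (subst nn_integral_lborel_octant[OF g]) (simp add: mult.assoc[symmetric])
  finally show ?thesis by (simp add: g_def)
qed

lemma sphere_area_cyclic:
  assumes f: "(\<lambda>(x, y, z). f x y z) \<in> borel_measurable borel"
  shows "(\<integral>\<^sup>+v. f \<bar>v $ 2\<bar> \<bar>v $ 3\<bar> \<bar>v $ 1\<bar> \<partial>sphere_area) = (\<integral>\<^sup>+v. f \<bar>v $ 1\<bar> \<bar>v $ 2\<bar> \<bar>v $ 3\<bar> \<partial>sphere_area)"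
proof -
  note [measurable (raw)] = borel_measurable_curried3[OF f]
  have f': "(\<lambda>(z, x, y). f x y z) \<in> borel_measurable borel"
    unfolding borel_prod[symmetric] by measurable
  define g where "g = (\<lambda>x y z. let r = sqrt (x\<^sup>2 + y\<^sup>2 + z\<^sup>2) in
        if r < 1 then f (x / r) (y / r) (z / r) else 0)"
  have g: "(\<lambda>(x, y, z). g x y z) \<in> borel_measurable borel"
    unfolding g_def Let_def borel_prod[symmetric] by measurable
  have "(\<integral>\<^sup>+v. f \<bar>v $ 2\<bar> \<bar>v $ 3\<bar> \<bar>v $ 1\<bar> \<partial>sphere_area) = 24 * octant_integral (\<lambda>z x y. g x y z)"
    unfolding sphere_area_octant[OF f'] g_def by (simp only: add_ac)
  also have "octant_integral (\<lambda>z x y. g x y z) = octant_integral g"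
    by (rule octant_integral_cyclic[OF g, symmetric])
  also have "24 * octant_integral g = (\<integral>\<^sup>+v. f \<bar>v $ 1\<bar> \<bar>v $ 2\<bar> \<bar>v $ 3\<bar> \<partial>sphere_area)"
    unfolding sphere_area_octant[OF f] g_def ..
  finally show ?thesis .
qed

lemma polar_coordinates_octant:
  assumes f: "(\<lambda>(x, y, z). f x y z) \<in> borel_measurable borel"
  shows "(\<integral>\<^sup>+v. (\<integral>\<^sup>+s\<in>{0<..}. ennreal (s\<^sup>2) * f (s * \<bar>v $ 1\<bar>) (s * \<bar>v $ 2\<bar>) (s * \<bar>v $ 3\<bar>) \<partial>lborel) \<partial>sphere_area)
       = 8 * octant_integral f"
proof -
  note [measurable (raw)] = borel_measurable_curried3[OF f]
  have "(\<integral>\<^sup>+v. (\<integral>\<^sup>+s\<in>{0<..}. ennreal (s\<^sup>2) * f (s * \<bar>v $ 1\<bar>) (s * \<bar>v $ 2\<bar>) (s * \<bar>v $ 3\<bar>) \<partial>lborel) \<partial>sphere_area)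
     = (\<integral>\<^sup>+v. (\<integral>\<^sup>+s. ennreal (s\<^sup>2) * indicator {0<..} s *
           f \<bar>(s *\<^sub>R v) $ 1\<bar> \<bar>(s *\<^sub>R v) $ 2\<bar> \<bar>(s *\<^sub>R v) $ 3\<bar> \<partial>lborel) \<partial>sphere_area)"
    by (intro nn_integral_cong) (auto simp: indicator_def abs_mult)
  also have "\<dots> = (\<integral>\<^sup>+x. f \<bar>x $ 1\<bar> \<bar>x $ 2\<bar> \<bar>x $ 3\<bar> \<partial>(lborel :: (real^3) measure))"
    by (rule polar_coordinates[of "\<lambda>x. f \<bar>x $ 1\<bar> \<bar>x $ 2\<bar> \<bar>x $ 3\<bar>"]) measurable
  finally show ?thesis
    by (simp add: nn_integral_lborel_octant[OF f])
qed

lemma nn_integral_half_line_scale: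
  assumes [measurable]: "g \<in> borel_measurable borel" and k: "0 < (k::real)"
  shows "(\<integral>\<^sup>+y\<in>{0<..}. g y \<partial>lborel) = (\<integral>\<^sup>+y\<in>{0<..}. ennreal k * g (k * y) \<partial>lborel)"
proof -
  have "(\<integral>\<^sup>+y\<in>{0<..}. g y \<partial>lborel) = ennreal k * (\<integral>\<^sup>+y\<in>{0<..}. g (k * y) \<partial>lborel)"
    using k by (subst nn_integral_real_affine[of _ k 0]) (auto simp: zero_less_mult_iff indicator_def)
  also have "\<dots> = (\<integral>\<^sup>+y\<in>{0<..}. ennreal k * g (k * y) \<partial>lborel)"
    by (subst nn_integral_cmult[symmetric]) (auto simp: mult.assoc)
  finally show ?thesis .
qed

text \<open>
  Projecting the sphere centrally to the plane at distance \<open>a\<close> from the origin. In the cone over the sphere, the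
  coordinates \<open>y\<close> and \<open>z\<close> are rescaled to those of the point where the ray meets the plane;
  what remains is three times the integral of \<open>x\<^sup>2 / a\<^sup>2\<close> over \<open>0 < x < a / r\<close>, and this is the
  Jacobian \<open>a / r\<^sup>3\<close>.
\<close>

lemma sphere_area_central_projection:
  assumes f: "(\<lambda>(x, y, z). f x y z) \<in> borel_measurable borel" and a: "0 < a"
  shows "(\<integral>\<^sup>+v. f \<bar>v $ 1\<bar> \<bar>v $ 2\<bar> \<bar>v $ 3\<bar> \<partial>sphere_area)
    = 8 * (\<integral>\<^sup>+y\<in>{0<..}. (\<integral>\<^sup>+z\<in>{0<..}. (let r = sqrt (a\<^sup>2 + y\<^sup>2 + z\<^sup>2) in
        ennreal (a / r ^ 3) * f (a / r) (y / r) (z / r)) \<partial>lborel) \<partial>lborel)"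
proof -
  note [measurable (raw)] = borel_measurable_curried3[OF f]
  define g where "g = (\<lambda>x y z. let r = sqrt (x\<^sup>2 + y\<^sup>2 + z\<^sup>2) in
        if r < 1 then f (x / r) (y / r) (z / r) else 0)"
  have g: "(\<lambda>(x, y, z). g x y z) \<in> borel_measurable borel"
    unfolding g_def Let_def borel_prod[symmetric] by measurable
  note [measurable (raw)] = borel_measurable_curried3[OF g]
  define R where "R = (\<lambda>y z. sqrt (a\<^sup>2 + y\<^sup>2 + z\<^sup>2))"
  have [measurable]: "(\<lambda>p. R (fst p) (snd p)) \<in> borel_measurable (borel \<Otimes>\<^sub>M borel)"
    unfolding R_def by measurable
  have R: "0 < R y z" for y z
    using a by (simp add: R_def add_pos_nonneg)
  define k where "k = (\<lambda>x y z. if x < a / R y z then ennreal (x\<^sup>2 / a\<^sup>2) * f (a / R y z) (y / R y z) (z / R y z) else 0)"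
  have k: "(\<lambda>(x, y, z). k x y z) \<in> borel_measurable borel"
    unfolding k_def R_def borel_prod[symmetric] by measurable
  note [measurable (raw)] = borel_measurable_curried3[OF k]
  have gk: "octant_integral g = octant_integral k"
    unfolding octant_integral_def
  proof (rule nn_integral_cong)
    fix x :: real
    show "(\<integral>\<^sup>+y\<in>{0<..}. (\<integral>\<^sup>+z\<in>{0<..}. g x y z \<partial>lborel) \<partial>lborel) * indicator {0<..} x
        = (\<integral>\<^sup>+y\<in>{0<..}. (\<integral>\<^sup>+z\<in>{0<..}. k x y z \<partial>lborel) \<partial>lborel) * indicator {0<..} x"
    proof (cases "0 < x")
      case x: True
      let ?c = "x / a"
      have c: "0 < ?c" using x a by simp
      have pt: "ennreal ?c * (ennreal ?c * g x (?c * y) (?c * z)) = k x y z" for y z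
      proof -
        have "sqrt (x\<^sup>2 + (?c * y)\<^sup>2 + (?c * z)\<^sup>2) = sqrt (?c\<^sup>2 * (a\<^sup>2 + y\<^sup>2 + z\<^sup>2))"
          using a by (intro arg_cong[where f = sqrt]) (simp add: field_simps)
        hence r: "sqrt (x\<^sup>2 + (?c * y)\<^sup>2 + (?c * z)\<^sup>2) = ?c * R y z"
          using c by (simp only: real_sqrt_mult R_def real_sqrt_abs abs_of_pos)
        have "x / (?c * R y z) = a / R y z" "?c * y / (?c * R y z) = y / R y z" "?c * z / (?c * R y z) = z / R y z"
          using x a by auto
        moreover have "?c * R y z < 1 \<longleftrightarrow> x < a / R y z"
          using a R[of y z] by (simp add: field_simps)
        moreover have "ennreal ?c * ennreal ?c = ennreal (x\<^sup>2 / a\<^sup>2)"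
          using c by (subst ennreal_mult[symmetric]) (auto simp: power2_eq_square)
        ultimately show ?thesis
          unfolding g_def k_def Let_def r by (simp add: mult.assoc[symmetric])
      qed
      have "(\<integral>\<^sup>+y\<in>{0<..}. (\<integral>\<^sup>+z\<in>{0<..}. g x y z \<partial>lborel) \<partial>lborel)
          = (\<integral>\<^sup>+y\<in>{0<..}. ennreal ?c * (\<integral>\<^sup>+z\<in>{0<..}. g x (?c * y) z \<partial>lborel) \<partial>lborel)"
        by (rule nn_integral_half_line_scale[OF _ c]) measurable
      also have "\<dots> = (\<integral>\<^sup>+y\<in>{0<..}. (\<integral>\<^sup>+z\<in>{0<..}. k x y z \<partial>lborel) \<partial>lborel)"
      proof (rule nn_integral_cong, rule arg_cong2[where f = "(*)", OF _ refl])
        fix y :: real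
        have "ennreal ?c * (\<integral>\<^sup>+z\<in>{0<..}. g x (?c * y) z \<partial>lborel)
            = ennreal ?c * (\<integral>\<^sup>+z\<in>{0<..}. ennreal ?c * g x (?c * y) (?c * z) \<partial>lborel)"
          by (subst nn_integral_half_line_scale[OF _ c]) auto
        also have "\<dots> = (\<integral>\<^sup>+z\<in>{0<..}. k x y z \<partial>lborel)"
          by (subst nn_integral_cmult[symmetric]) (auto simp: pt[symmetric] mult.assoc)
        finally show "ennreal ?c * (\<integral>\<^sup>+z\<in>{0<..}. g x (?c * y) z \<partial>lborel) = \<dots>" .
      qed
      finally show ?thesis by simp
    qed simp
  qed
  have k_swap: "octant_integral k = (\<integral>\<^sup>+y\<in>{0<..}. (\<integral>\<^sup>+z\<in>{0<..}. (\<integral>\<^sup>+x\<in>{0<..}. k x y z \<partial>lborel) \<partial>lborel) \<partial>lborel)"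
  proof -
    have k': "(\<lambda>(y, z, x). k x y z) \<in> borel_measurable borel"
      unfolding borel_prod[symmetric] by measurable
    show ?thesis
      using octant_integral_cyclic[OF k'] by (simp add: octant_integral_def)
  qed
  have "24 * octant_integral k = 8 * (\<integral>\<^sup>+y\<in>{0<..}. (\<integral>\<^sup>+z\<in>{0<..}.
        ennreal (a / R y z ^ 3) * f (a / R y z) (y / R y z) (z / R y z) \<partial>lborel) \<partial>lborel)"
  proof -
    have inner: "3 * (\<integral>\<^sup>+x\<in>{0<..}. k x y z \<partial>lborel)
        = ennreal (a / R y z ^ 3) * f (a / R y z) (y / R y z) (z / R y z)" for y z
    proof -
      let ?u = "a / R y z"
      have u: "0 \<le> ?u" using a R[of y z] by simp
      have "(\<integral>\<^sup>+x\<in>{0<..}. k x y z \<partial>lborel)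
          = (\<integral>\<^sup>+x. (ennreal (x\<^sup>2 / a\<^sup>2) * indicator {0..?u} x) * f ?u (y / R y z) (z / R y z) \<partial>lborel)"
        by (rule nn_integral_cong_AE, rule AE_mp[OF AE_lborel_singleton[of 0]],
            rule AE_mp[OF AE_lborel_singleton[of ?u]]) (auto simp: indicator_def k_def)
      also have "\<dots> = (\<integral>\<^sup>+x. ennreal (x\<^sup>2 / a\<^sup>2) * indicator {0..?u} x \<partial>lborel) * f ?u (y / R y z) (z / R y z)"
        by (rule nn_integral_multc) measurable
      also have "(\<integral>\<^sup>+x. ennreal (x\<^sup>2 / a\<^sup>2) * indicator {0..?u} x \<partial>lborel)
          = ennreal (?u ^ 3 / (3 * a\<^sup>2) - 0 ^ 3 / (3 * a\<^sup>2))"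
        by (rule nn_integral_FTC_Icc[OF _ _ _ u]) (use a in \<open>auto intro!: derivative_eq_intros simp: divide_simps\<close>)
      also have "?u ^ 3 / (3 * a\<^sup>2) - 0 ^ 3 / (3 * a\<^sup>2) = (a / R y z ^ 3) / 3"
        using a by (simp add: divide_simps power2_eq_square power3_eq_cube)
      also have "3 * (ennreal (a / R y z ^ 3 / 3) * f ?u (y / R y z) (z / R y z))
          = ennreal (a / R y z ^ 3) * f ?u (y / R y z) (z / R y z)"
        using a R[of y z] by (simp add: mult.assoc[symmetric] ennreal_mult'[symmetric] flip: ennreal_numeral)
      finally show ?thesis .
    qed
    have "24 * (\<integral>\<^sup>+y\<in>{0<..}. (\<integral>\<^sup>+z\<in>{0<..}. (\<integral>\<^sup>+x\<in>{0<..}. k x y z \<partial>lborel) \<partial>lborel) \<partial>lborel)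
        = 8 * (3 * (\<integral>\<^sup>+y\<in>{0<..}. (\<integral>\<^sup>+z\<in>{0<..}. (\<integral>\<^sup>+x\<in>{0<..}. k x y z \<partial>lborel) \<partial>lborel) \<partial>lborel))"
      by (simp add: mult.assoc[symmetric])
    also have "3 * (\<integral>\<^sup>+y\<in>{0<..}. (\<integral>\<^sup>+z\<in>{0<..}. (\<integral>\<^sup>+x\<in>{0<..}. k x y z \<partial>lborel) \<partial>lborel) \<partial>lborel)
        = (\<integral>\<^sup>+y\<in>{0<..}. (\<integral>\<^sup>+z\<in>{0<..}. 3 * (\<integral>\<^sup>+x\<in>{0<..}. k x y z \<partial>lborel) \<partial>lborel) \<partial>lborel)"
      by (simp add: nn_integral_cmult mult.assoc)
    finally show ?thesis by (simp only: inner k_swap)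
  qed
  moreover have "(\<integral>\<^sup>+v. f \<bar>v $ 1\<bar> \<bar>v $ 2\<bar> \<bar>v $ 3\<bar> \<partial>sphere_area) = 24 * octant_integral k"
    unfolding sphere_area_octant[OF f] gk[symmetric] g_def ..
  ultimately have "(\<integral>\<^sup>+v. f \<bar>v $ 1\<bar> \<bar>v $ 2\<bar> \<bar>v $ 3\<bar> \<partial>sphere_area)
      = 8 * (\<integral>\<^sup>+y\<in>{0<..}. (\<integral>\<^sup>+z\<in>{0<..}.
        ennreal (a / R y z ^ 3) * f (a / R y z) (y / R y z) (z / R y z) \<partial>lborel) \<partial>lborel)"
    by (simp only:)
  thus ?thesis
    unfolding R_def Let_def .
qed

lemma octant_integral_product:
  assumes [measurable]: "u \<in> borel_measurable borel" "v \<in> borel_measurable borel" "w \<in> borel_measurable borel"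
  shows "octant_integral (\<lambda>x y z. u x * v y * w z)
    = (\<integral>\<^sup>+x\<in>{0<..}. u x \<partial>lborel) * (\<integral>\<^sup>+y\<in>{0<..}. v y \<partial>lborel) * (\<integral>\<^sup>+z\<in>{0<..}. w z \<partial>lborel)"
proof -
  let ?I = "indicator {0<..} :: real \<Rightarrow> ennreal"
  define V where "V = (\<integral>\<^sup>+y\<in>{0<..}. v y \<partial>lborel)"
  define W where "W = (\<integral>\<^sup>+z\<in>{0<..}. w z \<partial>lborel)"
  have z: "(\<integral>\<^sup>+z\<in>{0<..}. u x * v y * w z \<partial>lborel) = u x * v y * W" for x y
    by (simp add: W_def mult.assoc nn_integral_cmult)
  have y: "(\<integral>\<^sup>+y\<in>{0<..}. u x * v y * W \<partial>lborel) = u x * (V * W)" for x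
  proof -
    have "(\<integral>\<^sup>+y\<in>{0<..}. u x * v y * W \<partial>lborel) = (\<integral>\<^sup>+y. (u x * W) * (v y * ?I y) \<partial>lborel)"
      by (simp add: mult_ac)
    also have "\<dots> = (u x * W) * V"
      unfolding V_def by (rule nn_integral_cmult) measurable
    finally show ?thesis by (simp add: mult_ac)
  qed
  have "(\<integral>\<^sup>+x\<in>{0<..}. u x * (V * W) \<partial>lborel) = (\<integral>\<^sup>+x. (u x * ?I x) * (V * W) \<partial>lborel)"
    by (simp add: mult_ac)
  also have "\<dots> = (\<integral>\<^sup>+x\<in>{0<..}. u x \<partial>lborel) * (V * W)"
    by (rule nn_integral_multc) measurable
  finally show ?thesis
    unfolding octant_integral_def z y V_def[symmetric] W_def[symmetric] by (simp only: mult.assoc)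
qed

text \<open>
  By polar coordinates the integral of \<open>|x\<^sub>1| exp (- |x|\<^sup>2)\<close> over space is the required integral times
  the integral of \<open>s\<^sup>3 exp (- s\<^sup>2)\<close>; it is also a product of Gaussian integrals.
\<close>

lemma mean_abs_component_sphere: "(\<integral>\<^sup>+v. ennreal \<bar>v $ 1\<bar> \<partial>sphere_area) = ennreal (2 * pi)"
proof -
  \<comment> \<open>The weight \<open>x\<close> gives \<open>|v\<^sub>1|\<close> times a power of the radius; the Gaussian factor makes the right-hand side a product.\<close>
  let ?f = "\<lambda>x y z :: real. ennreal (x * exp (- (x\<^sup>2 + y\<^sup>2 + z\<^sup>2)))"
  have f: "(\<lambda>(x, y, z). ?f x y z) \<in> borel_measurable borel"
    unfolding borel_prod[symmetric] by measurable
  have g0: "(\<integral>\<^sup>+x\<in>{0<..}. ennreal (exp (- x\<^sup>2)) \<partial>lborel) = ennreal (sqrt pi / 2)"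
  proof -
    have "(\<integral>\<^sup>+x\<in>{0<..}. ennreal (exp (- x\<^sup>2)) \<partial>lborel) = (\<integral>\<^sup>+x. ennreal (indicator {0..} x *\<^sub>R exp (- x\<^sup>2)) \<partial>lborel)"
      by (rule nn_integral_cong_AE, rule AE_mp[OF AE_lborel_singleton[of 0]]) (auto simp: indicator_def)
    also have "\<dots> = ennreal (\<integral>x. indicator {0..} x *\<^sub>R exp (- x\<^sup>2) \<partial>lborel)"
      using gaussian_moment_0 by (intro nn_integral_eq_integral AE_I2) (simp_all add: has_bochner_integral_iff indicator_def)
    also have "(\<integral>x. indicator {0..} x *\<^sub>R exp (- x\<^sup>2) \<partial>lborel) = sqrt pi / 2"
      by (rule has_bochner_integral_integral_eq[OF gaussian_moment_0])
    finally show ?thesis .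
  qed
  have g1: "(\<integral>\<^sup>+x\<in>{0<..}. ennreal (x * exp (- x\<^sup>2)) \<partial>lborel) = ennreal (1 / 2)"
  proof -
    have "(\<integral>\<^sup>+x\<in>{0<..}. ennreal (x * exp (- x\<^sup>2)) \<partial>lborel) = (\<integral>\<^sup>+x. ennreal (indicator {0..} x *\<^sub>R (exp (- x\<^sup>2) * x)) \<partial>lborel)"
      by (intro nn_integral_cong) (auto simp: indicator_def mult.commute)
    also have "\<dots> = ennreal (\<integral>x. indicator {0..} x *\<^sub>R (exp (- x\<^sup>2) * x) \<partial>lborel)"
      using gaussian_moment_1 by (intro nn_integral_eq_integral AE_I2) (simp_all add: has_bochner_integral_iff indicator_def)
    also have "(\<integral>x. indicator {0..} x *\<^sub>R (exp (- x\<^sup>2) * x) \<partial>lborel) = (1 / 2 :: real)"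
      by (rule has_bochner_integral_integral_eq[OF gaussian_moment_1])
    finally show ?thesis .
  qed
  have g3: "(\<integral>\<^sup>+s\<in>{0<..}. ennreal (s ^ 3 * exp (- s\<^sup>2)) \<partial>lborel) = ennreal (1 / 2)"
  proof -
    have "(\<integral>\<^sup>+s\<in>{0<..}. ennreal (s ^ 3 * exp (- s\<^sup>2)) \<partial>lborel)
        = (\<integral>\<^sup>+s. ennreal (s ^ 3 * exp (- s\<^sup>2)) * indicator {0..} s \<partial>lborel)"
      by (intro nn_integral_cong) (auto simp: indicator_def)
    also have "\<dots> = ennreal (0 - (- (0\<^sup>2 + 1) / 2 * exp (- 0\<^sup>2)))"
    proof (rule nn_integral_FTC_atLeast[where F = "\<lambda>s. - (s\<^sup>2 + 1) / 2 * exp (- s\<^sup>2)"])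
      show "((\<lambda>s::real. - (s\<^sup>2 + 1) / 2 * exp (- s\<^sup>2)) \<longlongrightarrow> 0) at_top"
        by real_asymp
      show "((\<lambda>s. - (s\<^sup>2 + 1) / 2 * exp (- s\<^sup>2)) has_real_derivative x ^ 3 * exp (- x\<^sup>2)) (at x)" for x :: real
        by (auto intro!: derivative_eq_intros simp: algebra_simps eval_nat_numeral)
    qed auto
    finally show ?thesis by simp
  qed
  have "8 * octant_integral ?f
      = (\<integral>\<^sup>+v. (\<integral>\<^sup>+s\<in>{0<..}. ennreal (s\<^sup>2) * ?f (s * \<bar>v $ 1\<bar>) (s * \<bar>v $ 2\<bar>) (s * \<bar>v $ 3\<bar>) \<partial>lborel) \<partial>sphere_area)"
    by (rule polar_coordinates_octant[OF f, symmetric])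
  also have "\<dots> = (\<integral>\<^sup>+v. ennreal \<bar>v $ 1\<bar> * ennreal (1 / 2) \<partial>sphere_area)"
  proof (rule nn_integral_cong)
    fix v assume "v \<in> space sphere_area"
    hence v: "(v $ 1)\<^sup>2 + (v $ 2)\<^sup>2 + (v $ 3)\<^sup>2 = 1"
      using norm_vec3[of v] by simp
    have "ennreal (s\<^sup>2) * ?f (s * \<bar>v $ 1\<bar>) (s * \<bar>v $ 2\<bar>) (s * \<bar>v $ 3\<bar>) * indicator {0<..} s
        = ennreal \<bar>v $ 1\<bar> * (ennreal (s ^ 3 * exp (- s\<^sup>2)) * indicator {0<..} s)" for s
    proof -
      have "(s * \<bar>v $ 1\<bar>)\<^sup>2 + (s * \<bar>v $ 2\<bar>)\<^sup>2 + (s * \<bar>v $ 3\<bar>)\<^sup>2 = s\<^sup>2"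
        using v by (simp add: power_mult_distrib flip: distrib_left)
      thus ?thesis
        by (auto simp: indicator_def ennreal_mult'[symmetric] eval_nat_numeral mult_ac)
    qed
    thus "(\<integral>\<^sup>+s\<in>{0<..}. ennreal (s\<^sup>2) * ?f (s * \<bar>v $ 1\<bar>) (s * \<bar>v $ 2\<bar>) (s * \<bar>v $ 3\<bar>) \<partial>lborel)
        = ennreal \<bar>v $ 1\<bar> * ennreal (1 / 2)"
      by (simp only: nn_integral_cmult g3[symmetric]) (subst nn_integral_cmult, auto)
  qed
  also have "\<dots> = (\<integral>\<^sup>+v. ennreal \<bar>v $ 1\<bar> \<partial>sphere_area) * ennreal (1 / 2)"
    by (rule nn_integral_multc) (simp add: sphere_area_def measurable_restrict_space1)
  finally have 1: "(\<integral>\<^sup>+v. ennreal \<bar>v $ 1\<bar> \<partial>sphere_area) * ennreal (1 / 2) = 8 * octant_integral ?f" ..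
  have "octant_integral ?f
      = octant_integral (\<lambda>x y z. ennreal (x * exp (- x\<^sup>2)) * ennreal (exp (- y\<^sup>2)) * ennreal (exp (- z\<^sup>2)))"
    by (rule octant_integral_cong) (simp add: ennreal_mult'[symmetric] exp_add exp_diff divide_inverse exp_minus mult_ac)
  also have "\<dots> = ennreal (1 / 2) * ennreal (sqrt pi / 2) * ennreal (sqrt pi / 2)"
    by (subst octant_integral_product) (measurable, simp only: g0 g1)
  also have "\<dots> = ennreal (1 / 2 * (sqrt pi / 2) * (sqrt pi / 2))"
    by (subst ennreal_mult, simp, simp)+ (rule refl)
  also have "1 / 2 * (sqrt pi / 2) * (sqrt pi / 2) = pi / 8"
    by simp
  finally have 2: "8 * octant_integral ?f = ennreal pi"
    by (simp add: ennreal_mult'[symmetric] flip: ennreal_numeral)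
  have half: "ennreal (1 / 2) * ennreal 2 = 1"
    by (subst ennreal_mult[symmetric]) auto
  have "(\<integral>\<^sup>+v. ennreal \<bar>v $ 1\<bar> \<partial>sphere_area)
      = (\<integral>\<^sup>+v. ennreal \<bar>v $ 1\<bar> \<partial>sphere_area) * (ennreal (1 / 2) * ennreal 2)"
    by (simp only: half mult_1_right)
  also have "\<dots> = ennreal pi * ennreal 2"
    by (simp only: mult.assoc[symmetric] 1 2)
  finally show ?thesis
    by (simp add: ennreal_mult'[symmetric] mult.commute del: ennreal_numeral)
qed

section \<open>The distance from the origin as a variable\<close>

text \<open>
  On a line at squared distance \<open>A\<close> from the origin, the coordinate \<open>z\<close> along the line is replaced by the distance
  \<open>s\<close> from the origin, where \<open>s\<^sup>2 = A + z\<^sup>2\<close>.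
\<close>

lemma nn_integral_distance_substitution:
  assumes [measurable]: "k \<in> borel_measurable borel" and A: "0 < A" and c: "0 < c"
  shows "(\<integral>\<^sup>+z\<in>{0<..<c}. k z \<partial>lborel)
    = (\<integral>\<^sup>+s\<in>{sqrt A<..<sqrt (A + c\<^sup>2)}. k (sqrt (s\<^sup>2 - A)) * ennreal (s / sqrt (s\<^sup>2 - A)) \<partial>lborel)"
proof -
  let ?g = "\<lambda>z. sqrt (A + z\<^sup>2)" and ?f = "\<lambda>s. k (sqrt (s\<^sup>2 - A)) * ennreal (s / sqrt (s\<^sup>2 - A))"
  have pos: "0 < A + z\<^sup>2" for z using A by (simp add: add_pos_nonneg)
  have "(\<integral>\<^sup>+s. ?f s * indicator {?g 0..?g c} s \<partial>lborel)
      = (\<integral>\<^sup>+z. ?f (?g z) * ennreal (z / ?g z) * indicator {0..c} z \<partial>lborel)"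
  proof (rule nn_integral_substitution_aux)
    show "(?g has_real_derivative z / ?g z) (at z)" for z
      using pos[of z] by (auto intro!: derivative_eq_intros simp: divide_simps)
    show "continuous_on {0..c} (\<lambda>z. z / ?g z)"
      using pos by (auto intro!: continuous_intros simp: less_imp_neq[symmetric])
  qed (use pos c in \<open>auto simp: less_imp_le\<close>)
  also have "\<dots> = (\<integral>\<^sup>+z\<in>{0<..<c}. k z \<partial>lborel)"
  proof (rule nn_integral_cong_AE, rule AE_mp[OF AE_lborel_singleton[of 0]],
      rule AE_mp[OF AE_lborel_singleton[of c]], rule AE_I2, intro impI)
    fix z :: real assume z: "z \<noteq> c" "z \<noteq> 0"
    have "ennreal (?g z / z) * ennreal (z / ?g z) = 1" if "0 < z"
      using pos[of z] that by (subst ennreal_mult'[symmetric]) auto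
    thus "?f (?g z) * ennreal (z / ?g z) * indicator {0..c} z = k z * indicator {0<..<c} z"
      using z pos[of z] by (auto simp: indicator_def mult.assoc)
  qed
  also have "(\<integral>\<^sup>+s. ?f s * indicator {?g 0..?g c} s \<partial>lborel) = (\<integral>\<^sup>+s\<in>{sqrt A<..<sqrt (A + c\<^sup>2)}. ?f s \<partial>lborel)"
    by (rule nn_integral_cong_AE, rule AE_mp[OF AE_lborel_singleton[of "?g 0"]],
      rule AE_mp[OF AE_lborel_singleton[of "?g c"]]) (auto simp: indicator_def)
  finally show ?thesis ..
qed

text \<open>
  The closed form of the integral of \<open>(a - x) (R - x\<^sup>2)\<^sup>+\<close> over \<open>[0, a]\<close>.
\<close>

definition tent_moment :: "real \<Rightarrow> real \<Rightarrow> real" where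
  "tent_moment a R =
    (if R \<le> 0 then 0 else if R \<le> a\<^sup>2 then 2 / 3 * a * R * sqrt R - R\<^sup>2 / 4 else a\<^sup>2 * R / 2 - a ^ 4 / 12)"

lemma has_integral_tent_moment:
  assumes a: "0 < a"
  shows "((\<lambda>x. (a - x) * max 0 (R - x\<^sup>2)) has_integral tent_moment a R) {0..a}"
proof -
  let ?f = "\<lambda>x. (a - x) * max 0 (R - x\<^sup>2)"
  define P where "P = (\<lambda>x. a * R * x - a * x ^ 3 / 3 - R * x\<^sup>2 / 2 + x ^ 4 / 4)"
  have FTC: "(?f has_integral P h - P 0) {0..h}" if h: "0 \<le> h" "h\<^sup>2 \<le> R" for h
  proof -
    have "((\<lambda>x. (a - x) * (R - x\<^sup>2)) has_integral P h - P 0) {0..h}"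
      unfolding P_def using h(1)
      by (intro fundamental_theorem_of_calculus)
         (auto intro!: derivative_eq_intros simp: has_real_derivative_iff_has_vector_derivative[symmetric] algebra_simps eval_nat_numeral)
    moreover have "(a - x) * (R - x\<^sup>2) = ?f x" if "x \<in> {0..h}" for x
    proof -
      have "x\<^sup>2 \<le> h\<^sup>2" using that by (intro power_mono) auto
      thus ?thesis using h by (simp add: max_def)
    qed
    ultimately show ?thesis
      by (rule has_integral_eq[rotated])
  qed
  have zero: "(?f has_integral 0) {h..a}" if h: "0 \<le> h" "R \<le> h\<^sup>2" for h
  proof (rule has_integral_is_0)
    fix x assume "x \<in> {h..a}"
    hence "h\<^sup>2 \<le> x\<^sup>2" using h by (intro power_mono) auto
    thus "?f x = 0" using h by (simp add: max_def)
  qed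
  consider "R \<le> 0" | "0 < R" "R \<le> a\<^sup>2" | "0 < R" "a\<^sup>2 < R" by linarith
  thus ?thesis
  proof cases
    case 1
    thus ?thesis using zero[of 0] by (simp add: tent_moment_def)
  next
    case 2
    have "sqrt R \<le> a" using 2 a by (simp add: real_le_lsqrt)
    hence "(?f has_integral (P (sqrt R) - P 0) + 0) {0..a}"
      using 2 by (intro has_integral_combine[of 0 "sqrt R"] FTC zero) auto
    moreover have "P (sqrt R) - P 0 = tent_moment a R"
    proof -
      have "sqrt R ^ 3 = R * sqrt R" "sqrt R ^ 4 = R\<^sup>2" "(sqrt R)\<^sup>2 = R"
        using 2 by (simp_all add: eval_nat_numeral)
      thus ?thesis using 2 by (simp add: P_def tent_moment_def power2_eq_square field_simps)
    qed
    ultimately show ?thesis by simp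
  next
    case 3
    have "P a - P 0 = tent_moment a R"
      using 3 by (simp add: P_def tent_moment_def field_simps eval_nat_numeral)
    thus ?thesis using FTC[of a] 3 a by simp
  qed
qed

text \<open>
  The substitution \<open>u = y\<^sup>2\<close> turns the left-hand side into the length of the intersection of \<open>(0, b\<^sup>2)\<close>
  and \<open>(S - c\<^sup>2, S)\<close>.
\<close>

lemma nn_integral_shell_slice:
  assumes b: "0 < b" and c: "0 < c"
  shows "(\<integral>\<^sup>+y\<in>{0<..}. (if y < b \<and> S - c\<^sup>2 < y\<^sup>2 \<and> y\<^sup>2 < S then ennreal (2 * y) else 0) \<partial>lborel)
    = ennreal (max 0 S - max 0 (S - b\<^sup>2) - max 0 (S - c\<^sup>2) + max 0 (S - b\<^sup>2 - c\<^sup>2))"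
proof -
  define lo where "lo = sqrt (max 0 (S - c\<^sup>2))"
  define hi where "hi = min b (sqrt (max 0 S))"
  have lo2: "lo\<^sup>2 = max 0 (S - c\<^sup>2)" and lo0: "0 \<le> lo" by (simp_all add: lo_def)
  have hi2: "hi\<^sup>2 = min (b\<^sup>2) (max 0 S)" and hi0: "0 \<le> hi"
  proof -
    show "0 \<le> hi" using b by (simp add: hi_def)
    have "b \<le> sqrt (max 0 S) \<longleftrightarrow> b\<^sup>2 \<le> max 0 S"
      using b power_mono_iff[of b "sqrt (max 0 S)" 2] by simp
    thus "hi\<^sup>2 = min (b\<^sup>2) (max 0 S)" by (simp add: hi_def min_def)
  qed
  have mem: "(y < b \<and> S - c\<^sup>2 < y\<^sup>2 \<and> y\<^sup>2 < S) \<longleftrightarrow> (lo < y \<and> y < hi)" if y: "0 < y" for y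
  proof -
    have "lo < y \<longleftrightarrow> lo\<^sup>2 < y\<^sup>2" "y < hi \<longleftrightarrow> y\<^sup>2 < hi\<^sup>2" "y < b \<longleftrightarrow> y\<^sup>2 < b\<^sup>2"
      using y lo0 hi0 b power_mono_iff[of y lo 2] power_mono_iff[of hi y 2] power_mono_iff[of b y 2]
      by (simp_all flip: not_le)
    moreover have "Y < B \<and> S - C < Y \<and> Y < S \<longleftrightarrow> max 0 (S - C) < Y \<and> Y < min B (max 0 S)"
      if "0 < Y" for Y B C :: real
      using that by (auto simp: max_def min_def)
    from this[of "y\<^sup>2"] have "y\<^sup>2 < b\<^sup>2 \<and> S - c\<^sup>2 < y\<^sup>2 \<and> y\<^sup>2 < S \<longleftrightarrow> max 0 (S - c\<^sup>2) < y\<^sup>2 \<and> y\<^sup>2 < min (b\<^sup>2) (max 0 S)"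
      using y by simp
    ultimately show ?thesis unfolding lo2 hi2 by (simp only:)
  qed
  have "(\<integral>\<^sup>+y\<in>{0<..}. (if y < b \<and> S - c\<^sup>2 < y\<^sup>2 \<and> y\<^sup>2 < S then ennreal (2 * y) else 0) \<partial>lborel)
      = (\<integral>\<^sup>+y. ennreal (2 * y) * indicator {lo..hi} y \<partial>lborel)"
  proof (rule nn_integral_cong_AE, rule AE_mp[OF AE_lborel_singleton[of lo]],
        rule AE_mp[OF AE_lborel_singleton[of hi]], rule AE_I2, intro impI)
    fix y :: real assume ne: "y \<noteq> hi" "y \<noteq> lo"
    show "(if y < b \<and> S - c\<^sup>2 < y\<^sup>2 \<and> y\<^sup>2 < S then ennreal (2 * y) else 0) * indicator {0<..} y
        = ennreal (2 * y) * indicator {lo..hi} y"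
    proof (cases "0 < y")
      case True
      show ?thesis unfolding mem[OF True] using ne True by (auto simp: indicator_def)
    next
      case False
      hence "\<not> lo \<le> y" using lo0 ne by linarith
      thus ?thesis using False by simp
    qed
  qed
  also have "\<dots> = ennreal (if lo \<le> hi then hi\<^sup>2 - lo\<^sup>2 else 0)"
  proof (cases "lo \<le> hi")
    case True
    have "(\<integral>\<^sup>+y. ennreal (2 * y) * indicator {lo..hi} y \<partial>lborel) = ennreal (hi\<^sup>2 - lo\<^sup>2)"
      by (rule nn_integral_FTC_Icc[OF _ _ _ True]) (use lo0 in \<open>auto intro!: derivative_eq_intros\<close>)
    thus ?thesis using True by simp
  qed simp
  also have "lo \<le> hi \<longleftrightarrow> lo\<^sup>2 \<le> hi\<^sup>2"
    using lo0 hi0 by (simp add: power_mono_iff)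
  also have "(if lo\<^sup>2 \<le> hi\<^sup>2 then hi\<^sup>2 - lo\<^sup>2 else 0)
      = max 0 S - max 0 (S - b\<^sup>2) - max 0 (S - c\<^sup>2) + max 0 (S - b\<^sup>2 - c\<^sup>2)"
  proof -
    have "(if max 0 (S - C) \<le> min B (max 0 S) then min B (max 0 S) - max 0 (S - C) else 0)
        = max 0 S - max 0 (S - B) - max 0 (S - C) + max 0 (S - B - C)" if "0 < B" "0 < C" for B C :: real
      using that by (auto simp: max_def min_def)
    thus ?thesis unfolding lo2 hi2 using b c by simp
  qed
  finally show ?thesis .
qed

text \<open>
  The closed form of the integral in \<open>nn_integral_face_slice\<close>: an antiderivative between the ends of the
  interval of those \<open>y\<close> in \<open>(0, b)\<close> for which \<open>R - y\<^sup>2\<close> lies between \<open>0\<close> and \<open>c\<^sup>2\<close>.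
\<close>

definition face_moment :: "real \<Rightarrow> real \<Rightarrow> real \<Rightarrow> real" where
  "face_moment b c R =
    (if R \<le> 0 \<or> b\<^sup>2 + c\<^sup>2 \<le> R then 0
     else let \<Phi> = (\<lambda>y. b * c * arcsin (y / sqrt R) + c * sqrt (R - y\<^sup>2) - b * y + y\<^sup>2 / 2)
       in \<Phi> (min b (sqrt R)) - \<Phi> (sqrt (max 0 (R - c\<^sup>2))))"

lemma nn_integral_face_slice:
  assumes b: "0 < b" and c: "0 < c"
  shows "(\<integral>\<^sup>+y\<in>{0<..}. (if y < b \<and> R - c\<^sup>2 < y\<^sup>2 \<and> y\<^sup>2 < R
            then ennreal ((b - y) * (c / sqrt (R - y\<^sup>2) - 1)) else 0) \<partial>lborel)
    = ennreal (face_moment b c R)"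
    and "0 \<le> face_moment b c R"
proof -
  let ?f = "\<lambda>y. (b - y) * (c / sqrt (R - y\<^sup>2) - 1)"
  let ?P = "\<lambda>y. y < b \<and> R - c\<^sup>2 < y\<^sup>2 \<and> y\<^sup>2 < R"
  have "(\<integral>\<^sup>+y\<in>{0<..}. (if ?P y then ennreal (?f y) else 0) \<partial>lborel) = ennreal (face_moment b c R)
    \<and> 0 \<le> face_moment b c R"
  proof (cases "R \<le> 0 \<or> b\<^sup>2 + c\<^sup>2 \<le> R")
    case True
    have "\<not> ?P y" if "0 < y" for y
    proof
      assume P: "?P y"
      hence "y\<^sup>2 < b\<^sup>2" using that by (intro power_strict_mono) auto
      moreover have "0 < y\<^sup>2" using that by simp
      ultimately show False using P True by linarith
    qed
    hence "(if ?P y then ennreal (?f y) else 0) * indicator {0<..} y = 0" for y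
      by (auto simp: indicator_def)
    hence "(\<integral>\<^sup>+y\<in>{0<..}. (if ?P y then ennreal (?f y) else 0) \<partial>lborel) = 0"
      by (simp only: nn_integral_const mult_zero_left)
    thus ?thesis using True by (simp add: face_moment_def)
  next
    case False
    hence R: "0 < R" "R < b\<^sup>2 + c\<^sup>2" by auto
    define \<Phi> where "\<Phi> = (\<lambda>y. b * c * arcsin (y / sqrt R) + c * sqrt (R - y\<^sup>2) - b * y + y\<^sup>2 / 2)"
    define lo where "lo = sqrt (max 0 (R - c\<^sup>2))"
    define hi where "hi = min b (sqrt R)"
    have lo2: "lo\<^sup>2 = max 0 (R - c\<^sup>2)" and lo0: "0 \<le> lo" by (simp_all add: lo_def)
    have hi0: "0 < hi" using b R by (simp add: hi_def)
    have hib: "hi \<le> b" "hi \<le> sqrt R" by (simp_all add: hi_def)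
    have hi2: "hi\<^sup>2 = min (b\<^sup>2) R"
    proof -
      have "b \<le> sqrt R \<longleftrightarrow> b\<^sup>2 \<le> R"
        using b R power_mono_iff[of b "sqrt R" 2] by simp
      thus ?thesis using R by (simp add: hi_def min_def)
    qed
    have "lo\<^sup>2 \<le> hi\<^sup>2" unfolding lo2 hi2 using R b c by (auto simp: max_def min_def)
    hence le: "lo \<le> hi" using lo0 hi0 by (simp add: power_mono_iff)
    have inner: "?P y" if y: "lo < y" "y < hi" for y
    proof -
      have "lo\<^sup>2 < y\<^sup>2" "y\<^sup>2 < hi\<^sup>2" using y lo0 by (auto intro!: power_strict_mono)
      thus ?thesis using y hib unfolding lo2 hi2 by auto
    qed
    have outer: "lo < y \<and> y < hi" if y: "0 < y" "?P y" for y
    proof -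
      have "y\<^sup>2 < b\<^sup>2" "0 < y\<^sup>2" using y by (auto intro!: power_strict_mono)
      hence "lo\<^sup>2 < y\<^sup>2" "y\<^sup>2 < hi\<^sup>2" using y unfolding lo2 hi2 by auto
      thus ?thesis using y lo0 hi0 by (auto dest: power2_less_imp_less)
    qed
    have "(?f has_integral (\<Phi> hi - \<Phi> lo)) {lo..hi}"
    proof (rule fundamental_theorem_of_calculus_interior[OF le])
      have ratio: "-1 \<le> y / sqrt R \<and> y / sqrt R \<le> 1" if "y \<in> {lo..hi}" for y
        using that lo0 hib R by (auto simp: divide_simps intro: order_trans[of _ 0] order_trans)
      show "continuous_on {lo..hi} \<Phi>"
        unfolding \<Phi>_def using ratio R by (intro continuous_intros) auto
      fix y assume y: "y \<in> {lo<..<hi}"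
      hence P: "?P y" using inner by auto
      have y0: "0 < y" using y lo0 by auto
      have q: "0 < R - y\<^sup>2" using P by simp
      have lt: "-1 < y / sqrt R" "y / sqrt R < 1"
        using y0 y hib R by (auto simp: divide_simps intro: less_trans[of _ 0])
      have ar: "sqrt (1 - (y / sqrt R)\<^sup>2) = sqrt (R - y\<^sup>2) / sqrt R"
        using R by (simp add: power_divide real_sqrt_divide[symmetric] divide_simps)
      have d1: "((\<lambda>y. arcsin (y / sqrt R)) has_real_derivative inverse (sqrt (1 - (y / sqrt R)\<^sup>2)) * (1 / sqrt R)) (at y)"
        by (rule DERIV_chain2[where g = "\<lambda>y. y / sqrt R", OF DERIV_arcsin[OF lt]])
           (rule DERIV_cdivide[OF DERIV_ident])
      hence d1: "((\<lambda>y. arcsin (y / sqrt R)) has_real_derivative 1 / sqrt (R - y\<^sup>2)) (at y)"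
        using R q unfolding ar by (simp add: field_simps)
      have d2: "((\<lambda>y. sqrt (R - y\<^sup>2)) has_real_derivative - y / sqrt (R - y\<^sup>2)) (at y)"
        using q by (auto intro!: derivative_eq_intros simp: divide_simps)
      have "(\<Phi> has_real_derivative b * c * (1 / sqrt (R - y\<^sup>2)) + c * (- y / sqrt (R - y\<^sup>2)) - b + y) (at y)"
        unfolding \<Phi>_def
        by (rule derivative_eq_intros refl DERIV_cmult[OF d1] DERIV_cmult[OF d2] | simp)+
      moreover have "b * c * (1 / sqrt (R - y\<^sup>2)) + c * (- y / sqrt (R - y\<^sup>2)) - b + y = ?f y"
        using q by (simp add: field_simps)
      ultimately show "(\<Phi> has_vector_derivative ?f y) (at y)"
        by (simp add: has_real_derivative_iff_has_vector_derivative)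
    qed
    \<comment> \<open>If \<open>hi = sqrt R\<close>, division by zero may make the integrand negative at \<open>hi\<close>.\<close>
    hence I: "(?f has_integral (\<Phi> hi - \<Phi> lo)) {lo<..<hi}"
      by (simp add: has_integral_Icc_iff_Ioo)
    have f0: "0 \<le> ?f y" if y: "y \<in> {lo<..<hi}" for y
    proof -
      have P: "?P y" using y inner by auto
      have "sqrt (R - y\<^sup>2) \<le> c" using P c by (intro real_le_lsqrt) auto
      hence "1 \<le> c / sqrt (R - y\<^sup>2)" using P by (simp add: divide_simps)
      thus ?thesis using P by simp
    qed
    have eq: "face_moment b c R = \<Phi> hi - \<Phi> lo"
      using False by (simp add: face_moment_def \<Phi>_def lo_def hi_def Let_def)
    have "(\<integral>\<^sup>+y\<in>{0<..}. (if ?P y then ennreal (?f y) else 0) \<partial>lborel)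
        = (\<integral>\<^sup>+y. ennreal (?f y) * indicator {lo<..<hi} y \<partial>lborel)"
    proof (rule nn_integral_cong)
      fix y :: real
      have "0 < y \<and> ?P y \<longleftrightarrow> y \<in> {lo<..<hi}"
        using inner[of y] outer[of y] lo0 by auto
      thus "(if ?P y then ennreal (?f y) else 0) * indicator {0<..} y = ennreal (?f y) * indicator {lo<..<hi} y"
        by (auto simp: indicator_def)
    qed
    also have "\<dots> = ennreal (\<Phi> hi - \<Phi> lo)"
      by (rule nn_integral_has_integral_lebesgue'[OF f0 I])
    finally show ?thesis
      using has_integral_nonneg[OF I f0] by (simp add: eq)
  qed
  thus "(\<integral>\<^sup>+y\<in>{0<..}. (if ?P y then ennreal (?f y) else 0) \<partial>lborel) = ennreal (face_moment b c R)"
    "0 \<le> face_moment b c R" by auto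
qed

text \<open>
  Integrating \<open>nn_integral_shell_slice\<close> at \<open>S = R - x\<^sup>2\<close> against \<open>a - x\<close> gives four tent moments.
\<close>

definition box_moment :: "real \<Rightarrow> real \<Rightarrow> real \<Rightarrow> real \<Rightarrow> real" where
  "box_moment a b c R = tent_moment a R - tent_moment a (R - b\<^sup>2) - tent_moment a (R - c\<^sup>2)
     + tent_moment a (R - b\<^sup>2 - c\<^sup>2)"

lemma
  assumes a: "0 < a" and b: "0 < b" and c: "0 < c"
  shows nn_integral_box_moment: "(\<integral>\<^sup>+x\<in>{0..a}. ennreal ((a - x) * (max 0 (R - x\<^sup>2) - max 0 (R - x\<^sup>2 - b\<^sup>2)
      - max 0 (R - x\<^sup>2 - c\<^sup>2) + max 0 (R - x\<^sup>2 - b\<^sup>2 - c\<^sup>2))) \<partial>lborel) = ennreal (box_moment a b c R)"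
    and box_moment_nonneg: "0 \<le> box_moment a b c R"
proof -
  let ?f = "\<lambda>x. (a - x) * (max 0 (R - x\<^sup>2) - max 0 (R - x\<^sup>2 - b\<^sup>2)
      - max 0 (R - x\<^sup>2 - c\<^sup>2) + max 0 (R - x\<^sup>2 - b\<^sup>2 - c\<^sup>2))"
  have "((\<lambda>x. (a - x) * max 0 (R - x\<^sup>2) - (a - x) * max 0 ((R - b\<^sup>2) - x\<^sup>2)
      - (a - x) * max 0 ((R - c\<^sup>2) - x\<^sup>2) + (a - x) * max 0 ((R - b\<^sup>2 - c\<^sup>2) - x\<^sup>2))
      has_integral box_moment a b c R) {0..a}"
    unfolding box_moment_def
    by (intro has_integral_add has_integral_diff has_integral_tent_moment a)
  hence I: "(?f has_integral box_moment a b c R) {0..a}"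
    by (rule has_integral_eq[rotated]) (simp add: algebra_simps)
  have f0: "0 \<le> ?f x" if "x \<in> {0..a}" for x
  proof -
    have "0 \<le> max 0 S - max 0 (S - B) - max 0 (S - C) + max 0 (S - B - C)" if "0 \<le> B" "0 \<le> C" for S B C :: real
      using that by (auto simp: max_def)
    thus ?thesis using that by simp
  qed
  show "(\<integral>\<^sup>+x\<in>{0..a}. ennreal (?f x) \<partial>lborel) = ennreal (box_moment a b c R)"
    by (rule nn_integral_has_integral_lebesgue'[OF f0 I])
  show "0 \<le> box_moment a b c R"
    by (rule has_integral_nonneg[OF I f0])
qed

lemma borel_measurable_tent_moment [measurable]: "tent_moment a \<in> borel_measurable borel"
  unfolding tent_moment_def by measurable

lemma borel_measurable_box_moment [measurable]: "box_moment a b c \<in> borel_measurable borel"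
  unfolding box_moment_def by measurable

text \<open>
  The integral that \<open>face_moment\<close> evaluates is measurable in its parameter.
\<close>

lemma borel_measurable_face_moment:
  assumes "0 < b" "0 < c"
  shows "face_moment b c \<in> borel_measurable borel"
proof -
  let ?g = "\<lambda>R y. (if y < b \<and> R - c\<^sup>2 < y\<^sup>2 \<and> y\<^sup>2 < R
            then ennreal ((b - y) * (c / sqrt (R - y\<^sup>2) - 1)) else 0) * indicator {0<..} y"
  have "face_moment b c R = enn2real (\<integral>\<^sup>+y. ?g R y \<partial>lborel)" for R
    using nn_integral_face_slice[OF assms, of R] by simp
  hence "face_moment b c = (\<lambda>R. enn2real (\<integral>\<^sup>+y. ?g R y \<partial>lborel))"
    by (rule ext)
  also have "\<dots> \<in> borel_measurable borel"
    by measurable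
  finally show ?thesis .
qed

text \<open>
  Replacing \<open>z\<close> by the distance \<open>s\<close> cancels the factor \<open>z\<close>. The integrals over \<open>y\<close> and then \<open>x\<close>, for fixed
  \<open>s\<close>, are those of \<open>nn_integral_shell_slice\<close> and \<open>nn_integral_box_moment\<close>.
\<close>

lemma volume_part_by_distance:
  assumes a: "0 < a" and b: "0 < b" and c: "0 < c" and t: "0 \<le> t"
  shows "octant_integral (\<lambda>x y z. if x < a \<and> y < b \<and> z < c \<and> t < sqrt (x\<^sup>2 + y\<^sup>2 + z\<^sup>2)
            then ennreal (2 * y * z * (a - x) / (x\<^sup>2 + y\<^sup>2 + z\<^sup>2)\<^sup>2) else 0)
    = (\<integral>\<^sup>+s\<in>{t<..}. ennreal (box_moment a b c (s\<^sup>2) / s ^ 3) \<partial>lborel)"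
proof -
  define k where "k = (\<lambda>x y s. if x < a \<and> y < b \<and> sqrt (x\<^sup>2 + y\<^sup>2) < s \<and> s < sqrt (x\<^sup>2 + y\<^sup>2 + c\<^sup>2)
      then ennreal (2 * y * (a - x) / s ^ 3) else 0)"
  have k: "(\<lambda>(x, y, s). k x y s) \<in> borel_measurable borel"
    unfolding k_def borel_prod[symmetric] by measurable
  note [measurable (raw)] = borel_measurable_curried3[OF k]
  have subst: "(\<integral>\<^sup>+z\<in>{0<..}. (if x < a \<and> y < b \<and> z < c \<and> t < sqrt (x\<^sup>2 + y\<^sup>2 + z\<^sup>2)
            then ennreal (2 * y * z * (a - x) / (x\<^sup>2 + y\<^sup>2 + z\<^sup>2)\<^sup>2) else 0) \<partial>lborel)
      = (\<integral>\<^sup>+s\<in>{t<..}. k x y s \<partial>lborel)" if x: "0 < x" and y: "0 < y" for x y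
  proof -
    define A where "A = x\<^sup>2 + y\<^sup>2"
    have A: "0 < A" using x by (simp add: A_def add_pos_nonneg)
    define \<kappa> where "\<kappa> = (\<lambda>z. if x < a \<and> y < b \<and> t < sqrt (A + z\<^sup>2)
            then ennreal (2 * y * z * (a - x) / (A + z\<^sup>2)\<^sup>2) else 0)"
    have \<kappa>: "\<kappa> \<in> borel_measurable borel" unfolding \<kappa>_def by measurable
    have "(\<integral>\<^sup>+z\<in>{0<..}. (if x < a \<and> y < b \<and> z < c \<and> t < sqrt (x\<^sup>2 + y\<^sup>2 + z\<^sup>2)
            then ennreal (2 * y * z * (a - x) / (x\<^sup>2 + y\<^sup>2 + z\<^sup>2)\<^sup>2) else 0) \<partial>lborel)
        = (\<integral>\<^sup>+z\<in>{0<..<c}. \<kappa> z \<partial>lborel)"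
      by (rule nn_integral_cong) (auto simp: \<kappa>_def A_def indicator_def)
    also have "\<dots> = (\<integral>\<^sup>+s\<in>{sqrt A<..<sqrt (A + c\<^sup>2)}. \<kappa> (sqrt (s\<^sup>2 - A)) * ennreal (s / sqrt (s\<^sup>2 - A)) \<partial>lborel)"
      by (rule nn_integral_distance_substitution[OF \<kappa> A c])
    also have "\<dots> = (\<integral>\<^sup>+s\<in>{t<..}. k x y s \<partial>lborel)"
    proof (rule nn_integral_cong)
      fix s :: real
      show "\<kappa> (sqrt (s\<^sup>2 - A)) * ennreal (s / sqrt (s\<^sup>2 - A)) * indicator {sqrt A<..<sqrt (A + c\<^sup>2)} s
          = k x y s * indicator {t<..} s"
      proof (cases "sqrt A < s")
        case True
        hence s: "0 < s" using A real_sqrt_gt_zero[OF A] by linarith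
        have "A < s\<^sup>2" using True s real_sqrt_less_iff[of A "s\<^sup>2"] by simp
        define \<zeta> where "\<zeta> = sqrt (s\<^sup>2 - A)"
        have \<zeta>: "0 < \<zeta>" "\<zeta>\<^sup>2 = s\<^sup>2 - A" using \<open>A < s\<^sup>2\<close> by (simp_all add: \<zeta>_def)
        have "ennreal (2 * y * \<zeta> * (a - x) / (s\<^sup>2)\<^sup>2) * ennreal (s / \<zeta>) = ennreal (2 * y * (a - x) / s ^ 3)" if "x < a"
        proof -
          have "2 * y * \<zeta> * (a - x) / (s\<^sup>2)\<^sup>2 * (s / \<zeta>) = 2 * y * (a - x) / s ^ 3"
            using s \<zeta> by (simp add: field_simps eval_nat_numeral)
          thus ?thesis using that s \<zeta> y by (subst ennreal_mult[symmetric]) auto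
        qed
        thus ?thesis
          using True s \<zeta> unfolding \<zeta>_def[symmetric] \<kappa>_def k_def A_def[symmetric]
          by (auto simp: indicator_def)
      next
        case False
        thus ?thesis by (auto simp: k_def A_def)
      qed
    qed
    finally show ?thesis .
  qed
  have slice: "(\<integral>\<^sup>+x\<in>{0<..}. (\<integral>\<^sup>+y\<in>{0<..}. k x y s \<partial>lborel) \<partial>lborel) = ennreal (box_moment a b c (s\<^sup>2) / s ^ 3)"
    if s: "0 < s" for s
  proof -
    let ?W = "\<lambda>x. max 0 (s\<^sup>2 - x\<^sup>2) - max 0 (s\<^sup>2 - x\<^sup>2 - b\<^sup>2) - max 0 (s\<^sup>2 - x\<^sup>2 - c\<^sup>2) + max 0 (s\<^sup>2 - x\<^sup>2 - b\<^sup>2 - c\<^sup>2)"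
    have inner: "(\<integral>\<^sup>+y\<in>{0<..}. k x y s \<partial>lborel) = ennreal ((a - x) / s ^ 3) * ennreal (?W x)" if x: "0 < x" "x < a" for x
    proof -
      let ?g = "\<lambda>y. if y < b \<and> (s\<^sup>2 - x\<^sup>2) - c\<^sup>2 < y\<^sup>2 \<and> y\<^sup>2 < s\<^sup>2 - x\<^sup>2 then ennreal (2 * y) else 0"
      have "k x y s * indicator {0<..} y = ennreal ((a - x) / s ^ 3) * (?g y * indicator {0<..} y)" for y
      proof (cases "0 < y")
        case True
        have "sqrt (x\<^sup>2 + y\<^sup>2) < s \<longleftrightarrow> y\<^sup>2 < s\<^sup>2 - x\<^sup>2"
          using s real_sqrt_less_iff[of "x\<^sup>2 + y\<^sup>2" "s\<^sup>2"] by auto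
        moreover have "s < sqrt (x\<^sup>2 + y\<^sup>2 + c\<^sup>2) \<longleftrightarrow> (s\<^sup>2 - x\<^sup>2) - c\<^sup>2 < y\<^sup>2"
          using s real_sqrt_less_iff[of "s\<^sup>2" "x\<^sup>2 + y\<^sup>2 + c\<^sup>2"] by auto
        moreover have "ennreal (2 * y * (a - x) / s ^ 3) = ennreal ((a - x) / s ^ 3) * ennreal (2 * y)"
          using x s True by (subst ennreal_mult[symmetric]) (auto simp: mult_ac)
        ultimately show ?thesis using x True by (auto simp: k_def)
      qed simp
      hence "(\<integral>\<^sup>+y\<in>{0<..}. k x y s \<partial>lborel) = (\<integral>\<^sup>+y. ennreal ((a - x) / s ^ 3) * (?g y * indicator {0<..} y) \<partial>lborel)"
        by simp
      also have "\<dots> = ennreal ((a - x) / s ^ 3) * (\<integral>\<^sup>+y\<in>{0<..}. ?g y \<partial>lborel)"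
        by (rule nn_integral_cmult) measurable
      finally show ?thesis
        by (simp only: nn_integral_shell_slice[OF b c])
    qed
    have "(\<integral>\<^sup>+x\<in>{0<..}. (\<integral>\<^sup>+y\<in>{0<..}. k x y s \<partial>lborel) \<partial>lborel)
        = (\<integral>\<^sup>+x. ennreal (1 / s ^ 3) * (ennreal ((a - x) * ?W x) * indicator {0..a} x) \<partial>lborel)"
    proof (rule nn_integral_cong_AE, rule AE_mp[OF AE_lborel_singleton[of 0]],
        rule AE_mp[OF AE_lborel_singleton[of a]], rule AE_I2, intro impI)
      fix x assume ne: "x \<noteq> a" "x \<noteq> 0"
      consider "x < 0" | "0 < x" "x < a" | "a < x" using ne by linarith
      thus "(\<integral>\<^sup>+y\<in>{0<..}. k x y s \<partial>lborel) * indicator {0<..} x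
          = ennreal (1 / s ^ 3) * (ennreal ((a - x) * ?W x) * indicator {0..a} x)"
      proof cases
        case 2
        have "ennreal ((a - x) / s ^ 3) * ennreal (?W x) = ennreal ((a - x) / s ^ 3 * ?W x)"
          using 2 s by (subst ennreal_mult') auto
        also have "(a - x) / s ^ 3 * ?W x = 1 / s ^ 3 * ((a - x) * ?W x)"
          by simp
        also have "ennreal \<dots> = ennreal (1 / s ^ 3) * ennreal ((a - x) * ?W x)"
          using s by (intro ennreal_mult') auto
        finally show ?thesis using 2 inner[OF 2] by simp
      next
        case 3
        hence "k x y s = 0" for y by (simp add: k_def)
        thus ?thesis using 3 by simp
      qed simp
    qed
    also have "\<dots> = ennreal (1 / s ^ 3) * ennreal (box_moment a b c (s\<^sup>2))"
      unfolding nn_integral_box_moment[OF a b c, symmetric] by (rule nn_integral_cmult) measurable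
    also have "\<dots> = ennreal (box_moment a b c (s\<^sup>2) / s ^ 3)"
      using s by (subst ennreal_mult'[symmetric]) auto
    finally show ?thesis .
  qed
  let ?h = "\<lambda>x y z. if x < a \<and> y < b \<and> z < c \<and> t < sqrt (x\<^sup>2 + y\<^sup>2 + z\<^sup>2)
            then ennreal (2 * y * z * (a - x) / (x\<^sup>2 + y\<^sup>2 + z\<^sup>2)\<^sup>2) else 0"
  have "octant_integral ?h = (\<integral>\<^sup>+x\<in>{0<..}. (\<integral>\<^sup>+y\<in>{0<..}. (\<integral>\<^sup>+s\<in>{t<..}. k x y s \<partial>lborel) \<partial>lborel) \<partial>lborel)"
    unfolding octant_integral_def
    by (intro set_nn_integral_cong refl subst) auto
  also have "\<dots> = (\<integral>\<^sup>+x\<in>{0<..}. (\<integral>\<^sup>+s\<in>{t<..}. (\<integral>\<^sup>+y\<in>{0<..}. k x y s \<partial>lborel) \<partial>lborel) \<partial>lborel)"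
    by (intro nn_integral_cong arg_cong2[where f = "(*)"] refl nn_integral_swap_set) measurable
  also have "\<dots> = (\<integral>\<^sup>+s\<in>{t<..}. (\<integral>\<^sup>+x\<in>{0<..}. (\<integral>\<^sup>+y\<in>{0<..}. k x y s \<partial>lborel) \<partial>lborel) \<partial>lborel)"
    by (rule nn_integral_swap_set) measurable
  also have "\<dots> = (\<integral>\<^sup>+s\<in>{t<..}. ennreal (box_moment a b c (s\<^sup>2) / s ^ 3) \<partial>lborel)"
    using t by (intro set_nn_integral_cong refl slice) auto
  finally show ?thesis .
qed

text \<open>
  The same change of variables on the face at distance \<open>a\<close> from the origin. No factor \<open>z\<close> is present now, and dividing by \<open>z\<close>
  produces the integrand of \<open>nn_integral_face_slice\<close>.
\<close>

lemma face_part_by_distance: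
  assumes a: "0 < a" and b: "0 < b" and c: "0 < c" and t: "0 \<le> t"
  shows "(\<integral>\<^sup>+y\<in>{0<..}. (\<integral>\<^sup>+z\<in>{0<..}. (if y < b \<and> z < c \<and> t < sqrt (a\<^sup>2 + y\<^sup>2 + z\<^sup>2)
            then ennreal (a\<^sup>2 * (b - y) * (c - z) / (a\<^sup>2 + y\<^sup>2 + z\<^sup>2)\<^sup>2) else 0) \<partial>lborel) \<partial>lborel)
    = (\<integral>\<^sup>+s\<in>{t<..}. ennreal (a\<^sup>2 * face_moment b c (s\<^sup>2 - a\<^sup>2) / s ^ 3) \<partial>lborel)"
proof -
  define k where "k = (\<lambda>y s. if y < b \<and> sqrt (a\<^sup>2 + y\<^sup>2) < s \<and> s < sqrt (a\<^sup>2 + y\<^sup>2 + c\<^sup>2)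
      then ennreal (a\<^sup>2 / s ^ 3 * ((b - y) * (c / sqrt (s\<^sup>2 - a\<^sup>2 - y\<^sup>2) - 1))) else 0)"
  have k: "(\<lambda>(y, s). k y s) \<in> borel_measurable (borel \<Otimes>\<^sub>M borel)"
    unfolding k_def by measurable
  have subst: "(\<integral>\<^sup>+z\<in>{0<..}. (if y < b \<and> z < c \<and> t < sqrt (a\<^sup>2 + y\<^sup>2 + z\<^sup>2)
            then ennreal (a\<^sup>2 * (b - y) * (c - z) / (a\<^sup>2 + y\<^sup>2 + z\<^sup>2)\<^sup>2) else 0) \<partial>lborel)
      = (\<integral>\<^sup>+s\<in>{t<..}. k y s \<partial>lborel)" for y
  proof -
    define A where "A = a\<^sup>2 + y\<^sup>2"
    have A: "0 < A" using a by (simp add: A_def add_pos_nonneg)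
    define \<kappa> where "\<kappa> = (\<lambda>z. if y < b \<and> t < sqrt (A + z\<^sup>2)
            then ennreal (a\<^sup>2 * (b - y) * (c - z) / (A + z\<^sup>2)\<^sup>2) else 0)"
    have \<kappa>: "\<kappa> \<in> borel_measurable borel" unfolding \<kappa>_def by measurable
    have "(\<integral>\<^sup>+z\<in>{0<..}. (if y < b \<and> z < c \<and> t < sqrt (a\<^sup>2 + y\<^sup>2 + z\<^sup>2)
            then ennreal (a\<^sup>2 * (b - y) * (c - z) / (a\<^sup>2 + y\<^sup>2 + z\<^sup>2)\<^sup>2) else 0) \<partial>lborel)
        = (\<integral>\<^sup>+z\<in>{0<..<c}. \<kappa> z \<partial>lborel)"
      by (rule nn_integral_cong) (auto simp: \<kappa>_def A_def indicator_def)
    also have "\<dots> = (\<integral>\<^sup>+s\<in>{sqrt A<..<sqrt (A + c\<^sup>2)}. \<kappa> (sqrt (s\<^sup>2 - A)) * ennreal (s / sqrt (s\<^sup>2 - A)) \<partial>lborel)"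
      by (rule nn_integral_distance_substitution[OF \<kappa> A c])
    also have "\<dots> = (\<integral>\<^sup>+s\<in>{t<..}. k y s \<partial>lborel)"
    proof (rule nn_integral_cong)
      fix s :: real
      show "\<kappa> (sqrt (s\<^sup>2 - A)) * ennreal (s / sqrt (s\<^sup>2 - A)) * indicator {sqrt A<..<sqrt (A + c\<^sup>2)} s
          = k y s * indicator {t<..} s"
      proof (cases "sqrt A < s \<and> s < sqrt (A + c\<^sup>2)")
        case True
        hence s: "0 < s" using A real_sqrt_gt_zero[OF A] by linarith
        have "A < s\<^sup>2" "s\<^sup>2 < A + c\<^sup>2"
          using True s real_sqrt_less_iff[of A "s\<^sup>2"] real_sqrt_less_iff[of "s\<^sup>2" "A + c\<^sup>2"] by auto
        define \<zeta> where "\<zeta> = sqrt (s\<^sup>2 - A)"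
        have \<zeta>: "0 < \<zeta>" "\<zeta>\<^sup>2 = s\<^sup>2 - A" using \<open>A < s\<^sup>2\<close> by (simp_all add: \<zeta>_def)
        have \<zeta>c: "\<zeta> < c"
          unfolding \<zeta>_def using \<open>s\<^sup>2 < A + c\<^sup>2\<close> c by (intro real_less_lsqrt) auto
        have "ennreal (a\<^sup>2 * (b - y) * (c - \<zeta>) / (s\<^sup>2)\<^sup>2) * ennreal (s / \<zeta>)
            = ennreal (a\<^sup>2 / s ^ 3 * ((b - y) * (c / \<zeta> - 1)))" if "y < b"
        proof -
          have "a\<^sup>2 * (b - y) * (c - \<zeta>) / (s\<^sup>2)\<^sup>2 * (s / \<zeta>) = a\<^sup>2 / s ^ 3 * ((b - y) * (c / \<zeta> - 1))"
            using s \<zeta> by (simp add: field_simps eval_nat_numeral)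
          thus ?thesis using that s \<zeta> \<zeta>c by (subst ennreal_mult[symmetric]) auto
        qed
        moreover have "k y s = (if y < b then ennreal (a\<^sup>2 / s ^ 3 * ((b - y) * (c / \<zeta> - 1))) else 0)"
          using True by (simp add: k_def A_def \<zeta>_def diff_diff_eq)
        ultimately show ?thesis
          using True s \<zeta> unfolding \<zeta>_def[symmetric] \<kappa>_def
          by (auto simp: indicator_def)
      next
        case False
        thus ?thesis by (auto simp: k_def A_def)
      qed
    qed
    finally show ?thesis .
  qed
  have slice: "(\<integral>\<^sup>+y\<in>{0<..}. k y s \<partial>lborel) = ennreal (a\<^sup>2 * face_moment b c (s\<^sup>2 - a\<^sup>2) / s ^ 3)"
    if s: "0 < s" for s
  proof -
    let ?R = "s\<^sup>2 - a\<^sup>2"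
    let ?g = "\<lambda>y. if y < b \<and> ?R - c\<^sup>2 < y\<^sup>2 \<and> y\<^sup>2 < ?R then ennreal ((b - y) * (c / sqrt (?R - y\<^sup>2) - 1)) else 0"
    have "k y s * indicator {0<..} y = ennreal (a\<^sup>2 / s ^ 3) * (?g y * indicator {0<..} y)" for y
    proof -
      have "sqrt (a\<^sup>2 + y\<^sup>2) < s \<longleftrightarrow> y\<^sup>2 < ?R"
        using s real_sqrt_less_iff[of "a\<^sup>2 + y\<^sup>2" "s\<^sup>2"] by auto
      moreover have "s < sqrt (a\<^sup>2 + y\<^sup>2 + c\<^sup>2) \<longleftrightarrow> ?R - c\<^sup>2 < y\<^sup>2"
        using s real_sqrt_less_iff[of "s\<^sup>2" "a\<^sup>2 + y\<^sup>2 + c\<^sup>2"] by auto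
      moreover have "ennreal (a\<^sup>2 / s ^ 3 * r) = ennreal (a\<^sup>2 / s ^ 3) * ennreal r" for r
        using s by (intro ennreal_mult') auto
      ultimately show ?thesis by (auto simp: k_def indicator_def)
    qed
    hence "(\<integral>\<^sup>+y\<in>{0<..}. k y s \<partial>lborel) = (\<integral>\<^sup>+y. ennreal (a\<^sup>2 / s ^ 3) * (?g y * indicator {0<..} y) \<partial>lborel)"
      by simp
    also have "\<dots> = ennreal (a\<^sup>2 / s ^ 3) * (\<integral>\<^sup>+y\<in>{0<..}. ?g y \<partial>lborel)"
      by (rule nn_integral_cmult) measurable
    also have "\<dots> = ennreal (a\<^sup>2 / s ^ 3) * ennreal (face_moment b c ?R)"
      by (simp only: nn_integral_face_slice[OF b c])
    also have "\<dots> = ennreal (a\<^sup>2 * face_moment b c ?R / s ^ 3)"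
      using s by (subst ennreal_mult'[symmetric]) auto
    finally show ?thesis .
  qed
  have "(\<integral>\<^sup>+y\<in>{0<..}. (\<integral>\<^sup>+z\<in>{0<..}. (if y < b \<and> z < c \<and> t < sqrt (a\<^sup>2 + y\<^sup>2 + z\<^sup>2)
            then ennreal (a\<^sup>2 * (b - y) * (c - z) / (a\<^sup>2 + y\<^sup>2 + z\<^sup>2)\<^sup>2) else 0) \<partial>lborel) \<partial>lborel)
      = (\<integral>\<^sup>+y\<in>{0<..}. (\<integral>\<^sup>+s\<in>{t<..}. k y s \<partial>lborel) \<partial>lborel)"
    by (simp only: subst)
  also have "\<dots> = (\<integral>\<^sup>+s\<in>{t<..}. (\<integral>\<^sup>+y\<in>{0<..}. k y s \<partial>lborel) \<partial>lborel)"
    by (rule nn_integral_swap_set[OF k]) auto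
  also have "\<dots> = (\<integral>\<^sup>+s\<in>{t<..}. ennreal (a\<^sup>2 * face_moment b c (s\<^sup>2 - a\<^sup>2) / s ^ 3) \<partial>lborel)"
    using t by (intro set_nn_integral_cong refl slice) auto
  finally show ?thesis .
qed

section \<open>The tail integrated over all directions\<close>

text \<open>
  One of the three summands of the smooth part of the tail. The point \<open>s v\<close>, with \<open>x, y, z\<close> the absolute components of
  \<open>v\<close>, is the displacement of a chord of length \<open>s\<close>, and it must stay inside the box.
\<close>

definition interior_part :: "real \<Rightarrow> real \<Rightarrow> real \<Rightarrow> real \<Rightarrow> real \<Rightarrow> real \<Rightarrow> real \<Rightarrow> ennreal" where
  "interior_part a b c t x y z =
    (\<integral>\<^sup>+s\<in>{t<..}. (if s * x < a \<and> s * y < b \<and> s * z < c then ennreal (2 * y * z * (a - s * x)) else 0) \<partial>lborel)"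

text \<open>
  The jump of the tail at \<open>t = a / x\<close>, where the displacement reaches the face at distance \<open>a\<close>. It is the area of the
  lines in this direction that join the two faces of the box at distance \<open>a\<close>, counted if \<open>a / x\<close> exceeds \<open>t\<close>.
\<close>

definition opposite_part :: "real \<Rightarrow> real \<Rightarrow> real \<Rightarrow> real \<Rightarrow> real \<Rightarrow> real \<Rightarrow> real \<Rightarrow> ennreal" where
  "opposite_part a b c t x y z =
    (if t * x < a \<and> a * y < b * x \<and> a * z < c * x then ennreal (x * (b - a * y / x) * (c - a * z / x)) else 0)"

definition tail_poly :: "real \<Rightarrow> real \<Rightarrow> real \<Rightarrow> real \<Rightarrow> real \<Rightarrow> real \<Rightarrow> real \<Rightarrow> real" where
  "tail_poly a b c s x y z =
     x * (b - s * y) * (c - s * z) + y * (c - s * z) * (a - s * x) + z * (a - s * x) * (b - s * y)"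

lemma tail_poly_cyclic: "tail_poly b c a s y z x = tail_poly a b c s x y z"
  by (simp add: tail_poly_def algebra_simps)

text \<open>
  If the ray in direction \<open>(x, y, z)\<close> leaves the box through the face at distance \<open>a\<close>, only the first
  summand can be nonzero. On the boundary of that face the polynomial vanishes, so ties do no
  harm.
\<close>

lemma sum_opposite_parts:
  assumes pos: "0 < x" "0 < y" "0 < z" and \<tau>: "t * x < a" "a * y \<le> b * x" "a * z \<le> c * x"
  shows "opposite_part a b c t x y z + opposite_part b c a t y z x + opposite_part c a b t z x y
    = ennreal (tail_poly a b c (a / x) x y z)"
proof -
  have "opposite_part b c a t y z x = 0" "opposite_part c a b t z x y = 0"
    using \<tau> by (auto simp: opposite_part_def mult.commute)
  moreover have "opposite_part a b c t x y z = ennreal (tail_poly a b c (a / x) x y z)"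
  proof (cases "a * y < b * x \<and> a * z < c * x")
    case True
    thus ?thesis using \<tau> pos by (simp add: opposite_part_def tail_poly_def)
  next
    case False
    hence "b - a / x * y = 0 \<or> c - a / x * z = 0"
      using \<tau> pos by (auto simp: field_simps)
    hence "tail_poly a b c (a / x) x y z = 0"
      using pos by (auto simp: tail_poly_def)
    thus ?thesis using False by (auto simp: opposite_part_def)
  qed
  ultimately show ?thesis by simp
qed

text \<open>
  As a function of \<open>t\<close>, the tail equals \<open>tail_poly\<close> up to the length \<open>\<tau>\<close> at which the displacement leaves the box, and
  zero from there on. Minus the derivative of \<open>tail_poly\<close> is the sum of the integrands of the
  three interior parts, and its value at \<open>\<tau>\<close> is the sum of the three jumps.
\<close>

lemma tail_area_decomposition:
  assumes abc: "0 < a" "0 < b" "0 < c" and pos: "0 < x" "0 < y" "0 < z"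
  shows "ennreal (tail_area a b c t x y z)
    = interior_part a b c t x y z + interior_part b c a t y z x + interior_part c a b t z x y
    + (opposite_part a b c t x y z + opposite_part b c a t y z x + opposite_part c a b t z x y)"
proof (cases "t * x < a \<and> t * y < b \<and> t * z < c")
  case False
  have "\<not> (s * x < a \<and> s * y < b \<and> s * z < c)" if "t < s" for s
  proof -
    have "t * x < s * x" "t * y < s * y" "t * z < s * z"
      using that pos by auto
    thus ?thesis using False by linarith
  qed
  hence "interior_part a b c t x y z = 0" "interior_part b c a t y z x = 0" "interior_part c a b t z x y = 0"
    unfolding interior_part_def by (auto intro!: nn_integral_zero' AE_I2 simp: indicator_def)
  moreover have opp: "opposite_part a b c t x y z = 0"
    if n: "\<not> (t * x < a \<and> t * y < b \<and> t * z < c)" and p: "0 < x" "0 < y" "0 < z" for a b c x y z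
  proof -
    have "t * y < b \<and> t * z < c" if h: "t * x < a" "a * y < b * x" "a * z < c * x"
    proof -
      have "(t * y) * x < b * x" "(t * z) * x < c * x"
        using h mult_strict_right_mono[OF h(1) p(2)] mult_strict_right_mono[OF h(1) p(3)]
        unfolding mult.assoc mult.commute[of x] by linarith+
      thus ?thesis using p by simp
    qed
    thus ?thesis using n by (auto simp: opposite_part_def)
  qed
  have "opposite_part a b c t x y z = 0" "opposite_part b c a t y z x = 0" "opposite_part c a b t z x y = 0"
    using False pos by (auto intro!: opp)
  ultimately show ?thesis using False by (auto simp: tail_area_def)
next
  case True
  \<comment> \<open>the length at which the ray in direction \<open>(x, y, z)\<close> leaves the box\<close>
  define \<tau> where "\<tau> = min (a / x) (min (b / y) (c / z))"
  have lt: "s < \<tau> \<longleftrightarrow> s * x < a \<and> s * y < b \<and> s * z < c" for s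
    using pos by (simp add: \<tau>_def pos_less_divide_eq)
  have t\<tau>: "t < \<tau>" using True lt by simp
  have le: "s * x \<le> a \<and> s * y \<le> b \<and> s * z \<le> c" if "s \<le> \<tau>" for s
    using that pos by (simp add: \<tau>_def pos_le_divide_eq)
  define P where "P = (\<lambda>s. 2 * y * z * (a - s * x) + 2 * z * x * (b - s * y) + 2 * x * y * (c - s * z))"
  have "interior_part a b c t x y z + interior_part b c a t y z x + interior_part c a b t z x y
      = (\<integral>\<^sup>+s. (if s * x < a \<and> s * y < b \<and> s * z < c then ennreal (2 * y * z * (a - s * x)) else 0) * indicator {t<..} s
          + (if s * y < b \<and> s * z < c \<and> s * x < a then ennreal (2 * z * x * (b - s * y)) else 0) * indicator {t<..} s
          + (if s * z < c \<and> s * x < a \<and> s * y < b then ennreal (2 * x * y * (c - s * z)) else 0) * indicator {t<..} s \<partial>lborel)"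
    unfolding interior_part_def by (simp add: nn_integral_add)
  also have "\<dots> = (\<integral>\<^sup>+s. ennreal (P s) * indicator {t..\<tau>} s \<partial>lborel)"
  proof (rule nn_integral_cong_AE, rule AE_mp[OF AE_lborel_singleton[of t]],
      rule AE_mp[OF AE_lborel_singleton[of \<tau>]], rule AE_I2, intro impI)
    fix s assume ne: "s \<noteq> \<tau>" "s \<noteq> t"
    show "(if s * x < a \<and> s * y < b \<and> s * z < c then ennreal (2 * y * z * (a - s * x)) else 0) * indicator {t<..} s
          + (if s * y < b \<and> s * z < c \<and> s * x < a then ennreal (2 * z * x * (b - s * y)) else 0) * indicator {t<..} s
          + (if s * z < c \<and> s * x < a \<and> s * y < b then ennreal (2 * x * y * (c - s * z)) else 0) * indicator {t<..} s
        = ennreal (P s) * indicator {t..\<tau>} s"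
    proof (cases "t < s \<and> s < \<tau>")
      case True
      hence *: "s * x < a" "s * y < b" "s * z < c" using lt by auto
      thus ?thesis using True pos by (simp add: P_def)
    next
      case False
      thus ?thesis using ne lt[of s] by (auto simp: indicator_def)
    qed
  qed
  also have "\<dots> = ennreal (- tail_poly a b c \<tau> x y z - - tail_poly a b c t x y z)"
  proof (rule nn_integral_FTC_Icc)
    show "((\<lambda>s. - tail_poly a b c s x y z) has_real_derivative P s) (at s)" for s
      unfolding tail_poly_def P_def by (auto intro!: derivative_eq_intros simp: algebra_simps)
    show "0 \<le> P s" if "s \<in> {t..\<tau>}" for s
      using le[of s] that pos by (simp add: P_def)
    show "P \<in> borel_measurable borel" unfolding P_def by measurable
  qed (use t\<tau> in auto)
  finally have interior: "interior_part a b c t x y z + interior_part b c a t y z x + interior_part c a b t z x y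
      = ennreal (tail_poly a b c t x y z - tail_poly a b c \<tau> x y z)"
    by simp
  have opp: "opposite_part a b c t x y z + opposite_part b c a t y z x + opposite_part c a b t z x y
      = ennreal (tail_poly a b c \<tau> x y z)"
  proof -
    have "\<tau> = a / x \<or> \<tau> = b / y \<or> \<tau> = c / z"
      by (simp add: \<tau>_def min_def)
    then consider "\<tau> = a / x" | "\<tau> = b / y" | "\<tau> = c / z"
      by blast
    thus ?thesis
    proof cases
      case 1
      have "a * y \<le> b * x" "a * z \<le> c * x"
        using le[of "a / x"] 1 pos by (auto simp: field_simps)
      from sum_opposite_parts[OF pos _ this] show ?thesis using True 1 by simp
    next
      case 2
      have "b * z \<le> c * y" "b * x \<le> a * y"
        using le[of "b / y"] 2 pos by (auto simp: field_simps)
      from sum_opposite_parts[OF pos(2,3,1) _ this] show ?thesis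
        using True 2 by (simp add: tail_poly_cyclic add_ac)
    next
      case 3
      have "c * x \<le> a * z" "c * y \<le> b * z"
        using le[of "c / z"] 3 pos by (auto simp: field_simps)
      from sum_opposite_parts[OF pos(3,1,2) _ this] show ?thesis
        using True 3 tail_poly_cyclic[of c a b "c / z" z x y] tail_poly_cyclic[of b c a "c / z" y z x]
        by (simp add: add_ac)
    qed
  qed
  have \<tau>0: "0 \<le> tail_poly a b c \<tau> x y z"
    using le[of \<tau>] pos by (simp add: tail_poly_def)
  have "tail_poly a b c \<tau> x y z \<le> tail_poly a b c t x y z"
  proof (rule DERIV_nonpos_imp_nonincreasing[OF less_imp_le[OF t\<tau>]])
    fix s assume "t \<le> s" "s \<le> \<tau>"
    hence "0 \<le> P s" using le[of s] pos by (simp add: P_def)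
    hence "- P s \<le> 0" by simp
    moreover have "((\<lambda>s. tail_poly a b c s x y z) has_real_derivative - P s) (at s)"
      unfolding tail_poly_def P_def by (auto intro!: derivative_eq_intros simp: algebra_simps)
    ultimately show "\<exists>y'. ((\<lambda>s. tail_poly a b c s x y z) has_real_derivative y') (at s) \<and> y' \<le> 0"
      by blast
  qed
  hence "ennreal (tail_poly a b c t x y z)
      = ennreal (tail_poly a b c t x y z - tail_poly a b c \<tau> x y z) + ennreal (tail_poly a b c \<tau> x y z)"
    using \<tau>0 by (subst ennreal_plus[symmetric]) auto
  moreover have "tail_area a b c t x y z = tail_poly a b c t x y z"
    using True by (simp add: tail_area_def tail_poly_def)
  ultimately show ?thesis
    unfolding interior opp by simp
qed

lemma borel_measurable_interior_part:
  "(\<lambda>(x, y, z). interior_part a b c t x y z) \<in> borel_measurable borel"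
  unfolding interior_part_def borel_prod[symmetric] by measurable

lemma borel_measurable_opposite_part:
  "(\<lambda>(x, y, z). opposite_part a b c t x y z) \<in> borel_measurable borel"
  unfolding opposite_part_def borel_prod[symmetric] by measurable

text \<open>
  The double integral over directions and lengths is an integral over displacement vectors. Passing to
  volume divides by \<open>s\<^sup>2\<close>, and writing the two direction cosines as \<open>y / s\<close> and \<open>z / s\<close> divides by \<open>s\<^sup>2\<close> again.
\<close>

lemma sphere_integral_interior_part:
  assumes abc: "0 < a" "0 < b" "0 < c" and t: "0 \<le> t"
  shows "(\<integral>\<^sup>+v. interior_part a b c t \<bar>v $ 1\<bar> \<bar>v $ 2\<bar> \<bar>v $ 3\<bar> \<partial>sphere_area)
    = 8 * (\<integral>\<^sup>+s\<in>{t<..}. ennreal (box_moment a b c (s\<^sup>2) / s ^ 3) \<partial>lborel)"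
proof -
  let ?h = "\<lambda>x y z. if x < a \<and> y < b \<and> z < c \<and> t < sqrt (x\<^sup>2 + y\<^sup>2 + z\<^sup>2)
            then ennreal (2 * y * z * (a - x) / (x\<^sup>2 + y\<^sup>2 + z\<^sup>2)\<^sup>2) else 0"
  have h: "(\<lambda>(x, y, z). ?h x y z) \<in> borel_measurable borel"
    unfolding borel_prod[symmetric] by measurable
  have "(\<integral>\<^sup>+v. interior_part a b c t \<bar>v $ 1\<bar> \<bar>v $ 2\<bar> \<bar>v $ 3\<bar> \<partial>sphere_area)
      = (\<integral>\<^sup>+v. (\<integral>\<^sup>+s\<in>{0<..}. ennreal (s\<^sup>2) * ?h (s * \<bar>v $ 1\<bar>) (s * \<bar>v $ 2\<bar>) (s * \<bar>v $ 3\<bar>) \<partial>lborel) \<partial>sphere_area)"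
    unfolding interior_part_def
  proof (rule nn_integral_cong, rule nn_integral_cong)
    fix v :: "real^3" and s :: real
    assume "v \<in> space sphere_area"
    hence v: "(v $ 1)\<^sup>2 + (v $ 2)\<^sup>2 + (v $ 3)\<^sup>2 = 1"
      using norm_vec3[of v] by simp
    have r: "(s * \<bar>v $ 1\<bar>)\<^sup>2 + (s * \<bar>v $ 2\<bar>)\<^sup>2 + (s * \<bar>v $ 3\<bar>)\<^sup>2 = s\<^sup>2"
      using v by (simp add: power_mult_distrib flip: distrib_left)
    show "(if s * \<bar>v $ 1\<bar> < a \<and> s * \<bar>v $ 2\<bar> < b \<and> s * \<bar>v $ 3\<bar> < c
           then ennreal (2 * \<bar>v $ 2\<bar> * \<bar>v $ 3\<bar> * (a - s * \<bar>v $ 1\<bar>)) else 0) * indicator {t<..} s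
        = ennreal (s\<^sup>2) * ?h (s * \<bar>v $ 1\<bar>) (s * \<bar>v $ 2\<bar>) (s * \<bar>v $ 3\<bar>) * indicator {0<..} s"
    proof (cases "0 < s")
      case True
      have "ennreal (s\<^sup>2) * ennreal (2 * (s * \<bar>v $ 2\<bar>) * (s * \<bar>v $ 3\<bar>) * (a - s * \<bar>v $ 1\<bar>) / (s\<^sup>2)\<^sup>2)
          = ennreal (2 * \<bar>v $ 2\<bar> * \<bar>v $ 3\<bar> * (a - s * \<bar>v $ 1\<bar>))"
      proof -
        have "s\<^sup>2 * (2 * (s * \<bar>v $ 2\<bar>) * (s * \<bar>v $ 3\<bar>) * (a - s * \<bar>v $ 1\<bar>) / (s\<^sup>2)\<^sup>2)
            = 2 * \<bar>v $ 2\<bar> * \<bar>v $ 3\<bar> * (a - s * \<bar>v $ 1\<bar>)"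
          using True by (simp add: field_simps eval_nat_numeral)
        thus ?thesis by (subst ennreal_mult'[symmetric]) simp_all
      qed
      thus ?thesis unfolding r using True by (auto simp: indicator_def)
    next
      case False
      thus ?thesis using t by simp
    qed
  qed
  also have "\<dots> = 8 * octant_integral ?h"
    by (rule polar_coordinates_octant[OF h])
  finally show ?thesis
    by (simp only: volume_part_by_distance[OF abc t])
qed

lemma sphere_integral_opposite_part:
  assumes abc: "0 < a" "0 < b" "0 < c" and t: "0 \<le> t"
  shows "(\<integral>\<^sup>+v. opposite_part a b c t \<bar>v $ 1\<bar> \<bar>v $ 2\<bar> \<bar>v $ 3\<bar> \<partial>sphere_area)
    = 8 * (\<integral>\<^sup>+s\<in>{t<..}. ennreal (a\<^sup>2 * face_moment b c (s\<^sup>2 - a\<^sup>2) / s ^ 3) \<partial>lborel)"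
proof -
  have pt: "(let r = sqrt (a\<^sup>2 + y\<^sup>2 + z\<^sup>2) in ennreal (a / r ^ 3) * opposite_part a b c t (a / r) (y / r) (z / r))
      = (if y < b \<and> z < c \<and> t < sqrt (a\<^sup>2 + y\<^sup>2 + z\<^sup>2)
            then ennreal (a\<^sup>2 * (b - y) * (c - z) / (a\<^sup>2 + y\<^sup>2 + z\<^sup>2)\<^sup>2) else 0)" for y z
  proof -
    define r where "r = sqrt (a\<^sup>2 + y\<^sup>2 + z\<^sup>2)"
    have r: "0 < r" using abc by (simp add: r_def add_pos_nonneg)
    have r2: "a\<^sup>2 + y\<^sup>2 + z\<^sup>2 = r\<^sup>2" by (simp add: r_def)
    have conds: "t * (a / r) < a \<longleftrightarrow> t < r" "a * (y / r) < b * (a / r) \<longleftrightarrow> y < b" "a * (z / r) < c * (a / r) \<longleftrightarrow> z < c"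
      using abc r by (simp_all add: field_simps)
    have "a * (y / r) / (a / r) = y" "a * (z / r) / (a / r) = z"
      using abc r by simp_all
    moreover have "ennreal (a / r ^ 3) * ennreal (a / r * (b - y) * (c - z)) = ennreal (a\<^sup>2 * (b - y) * (c - z) / (r\<^sup>2)\<^sup>2)"
    proof -
      have "a / r ^ 3 * (a / r * (b - y) * (c - z)) = a\<^sup>2 * (b - y) * (c - z) / (r\<^sup>2)\<^sup>2"
        by (simp add: field_simps eval_nat_numeral)
      thus ?thesis using abc r by (subst ennreal_mult'[symmetric]) auto
    qed
    moreover have "k * (if A \<and> B \<and> C then u else 0) = (if B \<and> C \<and> A then k * u else 0)" for A B C and k u :: ennreal
      by auto
    ultimately show ?thesis
      unfolding opposite_part_def Let_def r_def[symmetric] conds unfolding r2 by (simp only:)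
  qed
  show ?thesis
    by (subst sphere_area_central_projection[OF borel_measurable_opposite_part abc(1)])
       (simp only: pt face_part_by_distance[OF abc t])
qed

text \<open>
  One of three cyclically permuted contributions to the unnormalised density. The factor \<open>8\<close> counts the octants.
\<close>

definition chord_density :: "real \<Rightarrow> real \<Rightarrow> real \<Rightarrow> real \<Rightarrow> real" where
  "chord_density a b c s = 8 * (box_moment a b c (s\<^sup>2) + a\<^sup>2 * face_moment b c (s\<^sup>2 - a\<^sup>2)) / s ^ 3"

lemma chord_density_nonneg:
  assumes "0 < a" "0 < b" "0 < c" "0 \<le> s"
  shows "0 \<le> chord_density a b c s"
  using assms box_moment_nonneg[of a b c "s\<^sup>2"] nn_integral_face_slice(2)[of b c "s\<^sup>2 - a\<^sup>2"]
  by (simp add: chord_density_def)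

lemma borel_measurable_chord_density:
  assumes "0 < b" "0 < c"
  shows "chord_density a b c \<in> borel_measurable borel"
proof -
  note [measurable] = borel_measurable_face_moment[OF assms]
  show ?thesis unfolding chord_density_def by measurable
qed

lemma sphere_integral_parts:
  assumes abc: "0 < a" "0 < b" "0 < c" and t: "0 \<le> t"
  shows "(\<integral>\<^sup>+v. interior_part a b c t \<bar>v $ 1\<bar> \<bar>v $ 2\<bar> \<bar>v $ 3\<bar> + opposite_part a b c t \<bar>v $ 1\<bar> \<bar>v $ 2\<bar> \<bar>v $ 3\<bar> \<partial>sphere_area)
    = (\<integral>\<^sup>+s\<in>{t<..}. ennreal (chord_density a b c s) \<partial>lborel)"
proof -
  note [measurable (raw)] = borel_measurable_curried3[OF borel_measurable_interior_part]
    borel_measurable_curried3[OF borel_measurable_opposite_part]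
  have m: "(\<lambda>v. interior_part a b c t \<bar>v $ 1\<bar> \<bar>v $ 2\<bar> \<bar>v $ 3\<bar>) \<in> borel_measurable sphere_area"
    "(\<lambda>v. opposite_part a b c t \<bar>v $ 1\<bar> \<bar>v $ 2\<bar> \<bar>v $ 3\<bar>) \<in> borel_measurable sphere_area"
    by (auto simp: sphere_area_def intro!: measurable_restrict_space1)
  note [measurable] = borel_measurable_face_moment[OF abc(2,3)]
  have "(\<integral>\<^sup>+v. interior_part a b c t \<bar>v $ 1\<bar> \<bar>v $ 2\<bar> \<bar>v $ 3\<bar> + opposite_part a b c t \<bar>v $ 1\<bar> \<bar>v $ 2\<bar> \<bar>v $ 3\<bar> \<partial>sphere_area)
     = 8 * ((\<integral>\<^sup>+s\<in>{t<..}. ennreal (box_moment a b c (s\<^sup>2) / s ^ 3) \<partial>lborel)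
          + (\<integral>\<^sup>+s\<in>{t<..}. ennreal (a\<^sup>2 * face_moment b c (s\<^sup>2 - a\<^sup>2) / s ^ 3) \<partial>lborel))"
    by (simp add: nn_integral_add[OF m] sphere_integral_interior_part[OF abc t] sphere_integral_opposite_part[OF abc t] distrib_left)
  also have "\<dots> = 8 * (\<integral>\<^sup>+s. ennreal (box_moment a b c (s\<^sup>2) / s ^ 3) * indicator {t<..} s
      + ennreal (a\<^sup>2 * face_moment b c (s\<^sup>2 - a\<^sup>2) / s ^ 3) * indicator {t<..} s \<partial>lborel)"
    by (subst nn_integral_add) auto
  also have "\<dots> = (\<integral>\<^sup>+s. 8 * (ennreal (box_moment a b c (s\<^sup>2) / s ^ 3) * indicator {t<..} s
      + ennreal (a\<^sup>2 * face_moment b c (s\<^sup>2 - a\<^sup>2) / s ^ 3) * indicator {t<..} s) \<partial>lborel)"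
    by (rule nn_integral_cmult[symmetric]) measurable
  also have "\<dots> = (\<integral>\<^sup>+s\<in>{t<..}. ennreal (chord_density a b c s) \<partial>lborel)"
  proof (rule nn_integral_cong)
    fix s :: real
    show "8 * (ennreal (box_moment a b c (s\<^sup>2) / s ^ 3) * indicator {t<..} s
      + ennreal (a\<^sup>2 * face_moment b c (s\<^sup>2 - a\<^sup>2) / s ^ 3) * indicator {t<..} s)
      = ennreal (chord_density a b c s) * indicator {t<..} s"
    proof (cases "t < s")
      case True
      hence s: "0 < s" using t by linarith
      have nn: "0 \<le> box_moment a b c (s\<^sup>2) / s ^ 3" "0 \<le> a\<^sup>2 * face_moment b c (s\<^sup>2 - a\<^sup>2) / s ^ 3"
        using s box_moment_nonneg[OF abc] nn_integral_face_slice(2)[OF abc(2,3)] by auto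
      have "8 * (ennreal p + ennreal q) = ennreal (8 * (p + q))" if "0 \<le> p" "0 \<le> q" for p q
        using that by (simp add: ennreal_mult')
      from this[OF nn] have "8 * (ennreal (box_moment a b c (s\<^sup>2) / s ^ 3) + ennreal (a\<^sup>2 * face_moment b c (s\<^sup>2 - a\<^sup>2) / s ^ 3))
          = ennreal (chord_density a b c s)"
        by (simp only: chord_density_def add_divide_distrib[symmetric] times_divide_eq_right)
      thus ?thesis using True by simp
    qed simp
  qed
  finally show ?thesis .
qed

lemma sphere_integral_tail_area:
  assumes abc: "0 < a" "0 < b" "0 < c" and t: "0 \<le> t"
  shows "(\<integral>\<^sup>+v. ennreal (tail_area a b c t \<bar>v $ 1\<bar> \<bar>v $ 2\<bar> \<bar>v $ 3\<bar>) \<partial>sphere_area)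
    = (\<integral>\<^sup>+s\<in>{t<..}. ennreal (chord_density a b c s + chord_density b c a s + chord_density c a b s) \<partial>lborel)"
proof -
  note [measurable (raw)] = borel_measurable_curried3[OF borel_measurable_interior_part]
    borel_measurable_curried3[OF borel_measurable_opposite_part]
  define \<Psi> where "\<Psi> = (\<lambda>a b c x y z. interior_part a b c t x y z + opposite_part a b c t x y z)"
  have \<Psi>: "(\<lambda>(x, y, z). \<Psi> a b c x y z) \<in> borel_measurable borel"
    "(\<lambda>(x, y, z). \<Psi> a b c y z x) \<in> borel_measurable borel" for a b c
    unfolding \<Psi>_def borel_prod[symmetric] by measurable
  note [measurable (raw)] = borel_measurable_curried3[OF \<Psi>(1)]
  have m: "(\<lambda>v. \<Psi> a b c \<bar>v $ i\<bar> \<bar>v $ j\<bar> \<bar>v $ k\<bar>) \<in> borel_measurable sphere_area" for a b c i j k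
    by (auto simp: sphere_area_def intro!: measurable_restrict_space1)
  have "(\<integral>\<^sup>+v. ennreal (tail_area a b c t \<bar>v $ 1\<bar> \<bar>v $ 2\<bar> \<bar>v $ 3\<bar>) \<partial>sphere_area)
      = (\<integral>\<^sup>+v. \<Psi> a b c \<bar>v $ 1\<bar> \<bar>v $ 2\<bar> \<bar>v $ 3\<bar> + \<Psi> b c a \<bar>v $ 2\<bar> \<bar>v $ 3\<bar> \<bar>v $ 1\<bar>
            + \<Psi> c a b \<bar>v $ 3\<bar> \<bar>v $ 1\<bar> \<bar>v $ 2\<bar> \<partial>sphere_area)"
  proof (rule nn_integral_cong_AE, rule AE_mp[OF AE_sphere_area_nonzero[of 1]],
      rule AE_mp[OF AE_sphere_area_nonzero[of 2]], rule AE_mp[OF AE_sphere_area_nonzero[of 3]], rule AE_I2, intro impI)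
    fix v :: "real^3" assume "v $ 3 \<noteq> 0" "v $ 2 \<noteq> 0" "v $ 1 \<noteq> 0"
    thus "ennreal (tail_area a b c t \<bar>v $ 1\<bar> \<bar>v $ 2\<bar> \<bar>v $ 3\<bar>)
        = \<Psi> a b c \<bar>v $ 1\<bar> \<bar>v $ 2\<bar> \<bar>v $ 3\<bar> + \<Psi> b c a \<bar>v $ 2\<bar> \<bar>v $ 3\<bar> \<bar>v $ 1\<bar> + \<Psi> c a b \<bar>v $ 3\<bar> \<bar>v $ 1\<bar> \<bar>v $ 2\<bar>"
      using abc by (subst tail_area_decomposition) (auto simp: \<Psi>_def add_ac)
  qed
  also have "\<dots> = (\<integral>\<^sup>+v. \<Psi> a b c \<bar>v $ 1\<bar> \<bar>v $ 2\<bar> \<bar>v $ 3\<bar> \<partial>sphere_area)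
      + (\<integral>\<^sup>+v. \<Psi> b c a \<bar>v $ 2\<bar> \<bar>v $ 3\<bar> \<bar>v $ 1\<bar> \<partial>sphere_area)
      + (\<integral>\<^sup>+v. \<Psi> c a b \<bar>v $ 3\<bar> \<bar>v $ 1\<bar> \<bar>v $ 2\<bar> \<partial>sphere_area)"
    using m by (simp add: nn_integral_add)
  also have "(\<integral>\<^sup>+v. \<Psi> b c a \<bar>v $ 2\<bar> \<bar>v $ 3\<bar> \<bar>v $ 1\<bar> \<partial>sphere_area) = (\<integral>\<^sup>+v. \<Psi> b c a \<bar>v $ 1\<bar> \<bar>v $ 2\<bar> \<bar>v $ 3\<bar> \<partial>sphere_area)"
    by (rule sphere_area_cyclic[OF \<Psi>(1)])
  also have "(\<integral>\<^sup>+v. \<Psi> c a b \<bar>v $ 3\<bar> \<bar>v $ 1\<bar> \<bar>v $ 2\<bar> \<partial>sphere_area) = (\<integral>\<^sup>+v. \<Psi> c a b \<bar>v $ 2\<bar> \<bar>v $ 3\<bar> \<bar>v $ 1\<bar> \<partial>sphere_area)"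
    by (rule sphere_area_cyclic[OF \<Psi>(2)])
  also have "(\<integral>\<^sup>+v. \<Psi> c a b \<bar>v $ 2\<bar> \<bar>v $ 3\<bar> \<bar>v $ 1\<bar> \<partial>sphere_area) = (\<integral>\<^sup>+v. \<Psi> c a b \<bar>v $ 1\<bar> \<bar>v $ 2\<bar> \<bar>v $ 3\<bar> \<partial>sphere_area)"
    by (rule sphere_area_cyclic[OF \<Psi>(1)])
  finally have "(\<integral>\<^sup>+v. ennreal (tail_area a b c t \<bar>v $ 1\<bar> \<bar>v $ 2\<bar> \<bar>v $ 3\<bar>) \<partial>sphere_area)
      = (\<integral>\<^sup>+s\<in>{t<..}. ennreal (chord_density a b c s) \<partial>lborel)
      + (\<integral>\<^sup>+s\<in>{t<..}. ennreal (chord_density b c a s) \<partial>lborel)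
      + (\<integral>\<^sup>+s\<in>{t<..}. ennreal (chord_density c a b s) \<partial>lborel)"
    using abc t by (simp add: \<Psi>_def sphere_integral_parts)
  also have "\<dots> = (\<integral>\<^sup>+s. ennreal (chord_density a b c s) * indicator {t<..} s
      + ennreal (chord_density b c a s) * indicator {t<..} s + ennreal (chord_density c a b s) * indicator {t<..} s \<partial>lborel)"
  proof -
    have [measurable]: "chord_density a b c \<in> borel_measurable borel" "chord_density b c a \<in> borel_measurable borel"
        "chord_density c a b \<in> borel_measurable borel"
      using abc by (simp_all add: borel_measurable_chord_density)
    show ?thesis by (simp add: nn_integral_add)
  qed
  also have "\<dots> = (\<integral>\<^sup>+s\<in>{t<..}. ennreal (chord_density a b c s + chord_density b c a s + chord_density c a b s) \<partial>lborel)"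
    using abc t by (intro nn_integral_cong) (auto simp: indicator_def chord_density_nonneg)
  finally show ?thesis .
qed

section \<open>Comparison with the function F\<close>

lemma arcsin_div_hypotenuse:
  assumes "0 \<le> p" "0 < q"
  shows "arcsin (p / sqrt (p\<^sup>2 + q\<^sup>2)) = arctan (p / q)"
proof -
  define h where "h = sqrt (p\<^sup>2 + q\<^sup>2)"
  have h: "0 < h" "h\<^sup>2 = p\<^sup>2 + q\<^sup>2" using assms by (simp_all add: h_def add_nonneg_pos)
  have "p < h" unfolding h_def using assms by (intro real_less_rsqrt) auto
  hence "-1 < p / h" "p / h < 1" using assms h by (auto simp: divide_simps)
  hence "arcsin (p / h) = arctan (p / h / sqrt (1 - (p / h)\<^sup>2))"
    by (rule arcsin_arctan)
  also have "1 - (p / h)\<^sup>2 = (q / h)\<^sup>2"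
  proof -
    have "(p / h)\<^sup>2 + (q / h)\<^sup>2 = (p\<^sup>2 + q\<^sup>2) / h\<^sup>2"
      by (simp add: power_divide add_divide_distrib)
    also have "\<dots> = 1" using h by (simp flip: h(2))
    finally show ?thesis by simp
  qed
  also have "p / h / sqrt ((q / h)\<^sup>2) = p / q"
    using h assms by simp
  finally show ?thesis by (simp add: h_def)
qed

text \<open>
  Closed forms are written from here on as an initial expression plus corrections that switch on once the argument
  passes a threshold. In this form sums of them with different thresholds can be
  compared term by term.
\<close>

definition tent_base :: "real \<Rightarrow> real \<Rightarrow> real" where
  "tent_base a R = 2 / 3 * a * R * sqrt R - R\<^sup>2 / 4"

definition tent_step :: "real \<Rightarrow> real \<Rightarrow> real" where
  "tent_step a R = a\<^sup>2 * R / 2 - a ^ 4 / 12 - 2 / 3 * a * R * sqrt R + R\<^sup>2 / 4"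

lemma tent_moment_steps:
  "tent_moment a R = of_bool (0 < R) * tent_base a R + of_bool (a\<^sup>2 < R) * tent_step a R"
proof -
  have "a\<^sup>2 < R \<Longrightarrow> 0 < R" by (rule le_less_trans[OF zero_le_power2])
  thus ?thesis by (auto simp: tent_moment_def tent_base_def tent_step_def)
qed

definition face_base :: "real \<Rightarrow> real \<Rightarrow> real \<Rightarrow> real" where
  "face_base b c R = b * c * pi / 2 - (b + c) * sqrt R + R / 2"

definition face_step :: "real \<Rightarrow> real \<Rightarrow> real \<Rightarrow> real" where
  "face_step b c R = - b * c * arctan (sqrt (R - b\<^sup>2) / b) + c * sqrt (R - b\<^sup>2) - b\<^sup>2 / 2 + b * sqrt R - R / 2"

lemma face_moment_steps:
  assumes b: "0 < b" and c: "0 < c" and R: "R < b\<^sup>2 + c\<^sup>2"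
  shows "face_moment b c R = of_bool (0 < R) * face_base b c R
     + of_bool (b\<^sup>2 < R) * face_step b c R + of_bool (c\<^sup>2 < R) * face_step c b R"
proof (cases "0 < R")
  case False
  hence "\<not> b\<^sup>2 < R" "\<not> c\<^sup>2 < R"
    using le_less_trans[OF zero_le_power2] by blast+
  thus ?thesis using False by (auto simp: face_moment_def)
next
  case True
  define \<Phi> where "\<Phi> = (\<lambda>y. b * c * arcsin (y / sqrt R) + c * sqrt (R - y\<^sup>2) - b * y + y\<^sup>2 / 2)"
  have hi: "\<Phi> (min b (sqrt R)) = b * c * pi / 2 - b * sqrt R + R / 2 + of_bool (b\<^sup>2 < R) * face_step b c R"
  proof (cases "b\<^sup>2 < R")
    case False
    hence "sqrt R \<le> b" using b by (intro real_le_lsqrt) auto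
    thus ?thesis using False True by (simp add: \<Phi>_def min_def)
  next
    case lt: True
    hence "b < sqrt R" using b by (intro real_less_rsqrt) auto
    hence m: "min b (sqrt R) = b" by simp
    have "arcsin (b / sqrt R) = arctan (b / sqrt (R - b\<^sup>2))"
      using arcsin_div_hypotenuse[of b "sqrt (R - b\<^sup>2)"] b lt by simp
    also have "\<dots> = pi / 2 - arctan (sqrt (R - b\<^sup>2) / b)"
      using arctan_inverse[of "sqrt (R - b\<^sup>2) / b"] b lt by simp
    finally have asin: "arcsin (b / sqrt R) = pi / 2 - arctan (sqrt (R - b\<^sup>2) / b)" .
    show ?thesis
      unfolding m \<Phi>_def asin face_step_def using lt by (simp add: algebra_simps power2_eq_square)
  qed
  have lo: "\<Phi> (sqrt (max 0 (R - c\<^sup>2))) = c * sqrt R - of_bool (c\<^sup>2 < R) * face_step c b R"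
  proof (cases "c\<^sup>2 < R")
    case False
    thus ?thesis by (simp add: \<Phi>_def)
  next
    case lt: True
    have "arcsin (sqrt (R - c\<^sup>2) / sqrt R) = arctan (sqrt (R - c\<^sup>2) / c)"
      using arcsin_div_hypotenuse[of "sqrt (R - c\<^sup>2)" c] c lt by simp
    thus ?thesis
      using lt c by (simp add: \<Phi>_def face_step_def algebra_simps power2_eq_square diff_divide_distrib)
  qed
  have "face_moment b c R = \<Phi> (min b (sqrt R)) - \<Phi> (sqrt (max 0 (R - c\<^sup>2)))"
    using True R by (simp add: face_moment_def \<Phi>_def Let_def)
  thus ?thesis
    unfolding hi lo using True by (simp add: face_base_def algebra_simps)
qed

text \<open>
  The three formulas in the definition of \<open>F\<close>, each without its range.
\<close>

definition F_piece1 :: "real \<Rightarrow> real \<Rightarrow> real" where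
  "F_piece1 a t = t^3 * (8 * a - 3 * t)"

definition F_piece2 :: "real \<Rightarrow> real \<Rightarrow> real \<Rightarrow> real \<Rightarrow> real" where
  "F_piece2 a b c t = (6 * t^4 - a^4 + 6 * pi * a^2 * b * c) - 4 * (b + c) * sqrt \<bar>t^2 - a^2\<bar> * (a^2 + 2 * t^2)"

definition F_piece3 :: "real \<Rightarrow> real \<Rightarrow> real \<Rightarrow> real \<Rightarrow> real" where
  "F_piece3 a b c t = 6 * pi * a^2 * b * c + b^4 - 3 * t^4 - 6 * a^2 * b^2
         + 4 * c * sqrt \<bar>t^2 - a^2 - b^2\<bar> * (a^2 + b^2 + 2 * t^2)
         + 4 * a * sqrt \<bar>t^2 - b^2\<bar> * (b^2 + 2 * t^2)
         - 12 * a^2 * b * c * arctan (sqrt \<bar>t^2 - a^2 - b^2\<bar> / b)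
         - 4 * c * sqrt \<bar>t^2 - a^2\<bar> * (a^2 + 2 * t^2)
         - 12 * a * b^2 * c * arctan (sqrt \<bar>t^2 - a^2 - b^2\<bar> / a)"

lemma F_steps:
  assumes "0 < a" "0 < b" "0 < c" "0 < t" "t < sqrt (a^2 + b^2 + c^2)" "t \<noteq> a" "t \<noteq> sqrt (a^2 + b^2)"
  shows "F a b c t = F_piece1 a t + of_bool (a\<^sup>2 < t\<^sup>2) * (F_piece2 a b c t - F_piece1 a t)
    + of_bool (a\<^sup>2 + b\<^sup>2 < t\<^sup>2) * (F_piece3 a b c t - F_piece2 a b c t)"
proof -
  have 1: "a\<^sup>2 < t\<^sup>2 \<longleftrightarrow> a < t"
    using assms power_mono_iff[of t a 2] by (simp flip: not_le)
  have 2: "a\<^sup>2 + b\<^sup>2 < t\<^sup>2 \<longleftrightarrow> sqrt (a\<^sup>2 + b\<^sup>2) < t"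
    using assms real_sqrt_less_iff[of "a\<^sup>2 + b\<^sup>2" "t\<^sup>2"] by simp
  have 3: "a < sqrt (a\<^sup>2 + b\<^sup>2)"
    using assms by (intro real_less_rsqrt) auto
  consider "t < a" | "a < t" "t < sqrt (a\<^sup>2 + b\<^sup>2)" | "sqrt (a\<^sup>2 + b\<^sup>2) < t"
    using assms by linarith
  thus ?thesis
    using assms(4,5) 3 unfolding 1 2
    by cases (simp_all add: F_def F_piece1_def F_piece2_def F_piece3_def)
qed

lemma F_piece1_eq:
  assumes "0 < t"
  shows "F_piece1 a t = 12 * tent_base a (t\<^sup>2)"
  using assms by (simp add: F_piece1_def tent_base_def field_simps eval_nat_numeral)

text \<open>
  All contributions that switch on at \<open>t = a\<close>: the correction of the tent moment of side \<open>a\<close> itself, the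
  tent moments of the other two sides shifted by \<open>a\<^sup>2\<close>, and the integral over the face at distance \<open>a\<close>.
\<close>

lemma F_step1_eq:
  assumes "0 < t" "a\<^sup>2 < t\<^sup>2"
  shows "F_piece2 a b c t - F_piece1 a t
    = 12 * (tent_step a (t\<^sup>2) - tent_base b (t\<^sup>2 - a\<^sup>2) - tent_base c (t\<^sup>2 - a\<^sup>2) + a\<^sup>2 * face_base b c (t\<^sup>2 - a\<^sup>2))"
proof -
  define p where "p = sqrt (t\<^sup>2 - a\<^sup>2)"
  have abs: "\<bar>t\<^sup>2 - a\<^sup>2\<bar> = t\<^sup>2 - a\<^sup>2" using assms by simp
  show ?thesis
    unfolding F_piece2_def F_piece1_def tent_step_def tent_base_def face_base_def abs p_def[symmetric]
    using assms(1) by (simp add: field_simps eval_nat_numeral)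
qed

text \<open>
  All contributions that switch on at \<open>t\<^sup>2 = a\<^sup>2 + b\<^sup>2\<close>, when the sphere of radius \<open>t\<close> passes an edge of the
  box.
\<close>

lemma F_step2_eq:
  assumes "0 < a" "0 < b" "a\<^sup>2 + b\<^sup>2 < t\<^sup>2"
  shows "F_piece3 a b c t - F_piece2 a b c t
    = 12 * (- tent_step b (t\<^sup>2 - a\<^sup>2) - tent_step a (t\<^sup>2 - b\<^sup>2) + tent_base c (t\<^sup>2 - a\<^sup>2 - b\<^sup>2)
        + a\<^sup>2 * face_step b c (t\<^sup>2 - a\<^sup>2) + b\<^sup>2 * face_step a c (t\<^sup>2 - b\<^sup>2))"
proof -
  define p where "p = sqrt (t\<^sup>2 - a\<^sup>2)"
  define q where "q = sqrt (t\<^sup>2 - b\<^sup>2)"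
  define K where "K = sqrt (t\<^sup>2 - a\<^sup>2 - b\<^sup>2)"
  have abs: "\<bar>t\<^sup>2 - a\<^sup>2 - b\<^sup>2\<bar> = t\<^sup>2 - a\<^sup>2 - b\<^sup>2" "\<bar>t\<^sup>2 - a\<^sup>2\<bar> = t\<^sup>2 - a\<^sup>2" "\<bar>t\<^sup>2 - b\<^sup>2\<bar> = t\<^sup>2 - b\<^sup>2"
    using zero_le_power2[of a] zero_le_power2[of b] assms(3) by linarith+
  have K': "sqrt (t\<^sup>2 - b\<^sup>2 - a\<^sup>2) = K" by (simp add: K_def algebra_simps)
  show ?thesis
    unfolding F_piece3_def F_piece2_def tent_step_def tent_base_def face_step_def abs K' p_def[symmetric] q_def[symmetric] K_def[symmetric]
    by (simp add: field_simps eval_nat_numeral)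
qed

text \<open>
  Both sides are combinations of the indicators of the six thresholds \<open>a\<^sup>2\<close>, \<open>b\<^sup>2\<close>, \<open>c\<^sup>2\<close>, \<open>a\<^sup>2 + b\<^sup>2\<close>,
  \<open>b\<^sup>2 + c\<^sup>2\<close>, \<open>c\<^sup>2 + a\<^sup>2\<close>, with equal coefficients by \<open>F_piece1_eq\<close>, \<open>F_step1_eq\<close> and
  \<open>F_step2_eq\<close>. The break points have to be excluded because \<open>F\<close> takes a dummy value there.
\<close>

lemma chord_density_eq_F:
  assumes abc: "0 < a" "0 < b" "0 < c" and t: "0 < t" "t < sqrt (a\<^sup>2 + b\<^sup>2 + c\<^sup>2)"
    and ne: "t \<noteq> a" "t \<noteq> b" "t \<noteq> c" "t \<noteq> sqrt (a\<^sup>2 + b\<^sup>2)" "t \<noteq> sqrt (b\<^sup>2 + c\<^sup>2)" "t \<noteq> sqrt (c\<^sup>2 + a\<^sup>2)"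
  shows "chord_density a b c t + chord_density b c a t + chord_density c a b t
    = 2 * (F a b c t + F b c a t + F c a b t) / (3 * t ^ 3)"
proof -
  define T where "T = t\<^sup>2"
  have T: "T < a\<^sup>2 + b\<^sup>2 + c\<^sup>2"
    unfolding T_def using t real_sqrt_less_iff[of "t\<^sup>2" "a\<^sup>2 + b\<^sup>2 + c\<^sup>2"] by simp
  define A B C AB BC CA :: real where
    "A = of_bool (a\<^sup>2 < T)" and "B = of_bool (b\<^sup>2 < T)" and "C = of_bool (c\<^sup>2 < T)" and
    "AB = of_bool (a\<^sup>2 + b\<^sup>2 < T)" and "BC = of_bool (b\<^sup>2 + c\<^sup>2 < T)" and "CA = of_bool (c\<^sup>2 + a\<^sup>2 < T)"
  note steps = A_def B_def C_def AB_def BC_def CA_def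
  have tent: "tent_moment x (T - y\<^sup>2) = of_bool (y\<^sup>2 < T) * tent_base x (T - y\<^sup>2) + of_bool (x\<^sup>2 + y\<^sup>2 < T) * tent_step x (T - y\<^sup>2)"
    "tent_moment x (T - y\<^sup>2) = of_bool (y\<^sup>2 < T) * tent_base x (T - y\<^sup>2) + of_bool (y\<^sup>2 + x\<^sup>2 < T) * tent_step x (T - y\<^sup>2)" for x y
    unfolding tent_moment_steps by (simp_all add: less_diff_eq add.commute)
  have tent0: "tent_moment x T = tent_base x T + of_bool (x\<^sup>2 < T) * tent_step x T" for x
    unfolding tent_moment_steps using t by (simp add: T_def)
  have tent2: "tent_moment x (T - y\<^sup>2 - z\<^sup>2) = of_bool (y\<^sup>2 + z\<^sup>2 < T) * tent_base x (T - y\<^sup>2 - z\<^sup>2)"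
    if "T < x\<^sup>2 + y\<^sup>2 + z\<^sup>2" for x y z
    unfolding tent_moment_steps using that by (simp add: less_diff_eq algebra_simps)
  have boxes: "box_moment a b c T = tent_base a T + A * tent_step a T - (B * tent_base a (T - b\<^sup>2) + AB * tent_step a (T - b\<^sup>2))
       - (C * tent_base a (T - c\<^sup>2) + CA * tent_step a (T - c\<^sup>2)) + BC * tent_base a (T - b\<^sup>2 - c\<^sup>2)"
    "box_moment b c a T = tent_base b T + B * tent_step b T - (C * tent_base b (T - c\<^sup>2) + BC * tent_step b (T - c\<^sup>2))
       - (A * tent_base b (T - a\<^sup>2) + AB * tent_step b (T - a\<^sup>2)) + CA * tent_base b (T - c\<^sup>2 - a\<^sup>2)"
    "box_moment c a b T = tent_base c T + C * tent_step c T - (A * tent_base c (T - a\<^sup>2) + CA * tent_step c (T - a\<^sup>2))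
       - (B * tent_base c (T - b\<^sup>2) + BC * tent_step c (T - b\<^sup>2)) + AB * tent_base c (T - a\<^sup>2 - b\<^sup>2)"
    using T unfolding box_moment_def steps
    by (simp_all add: tent0 tent2 tent(1)[of a b] tent(2)[of a c] tent(1)[of b c] tent(2)[of b a]
        tent(1)[of c a] tent(2)[of c b])
  have faces: "face_moment b c (T - a\<^sup>2) = A * face_base b c (T - a\<^sup>2) + AB * face_step b c (T - a\<^sup>2) + CA * face_step c b (T - a\<^sup>2)"
    "face_moment c a (T - b\<^sup>2) = B * face_base c a (T - b\<^sup>2) + BC * face_step c a (T - b\<^sup>2) + AB * face_step a c (T - b\<^sup>2)"
    "face_moment a b (T - c\<^sup>2) = C * face_base a b (T - c\<^sup>2) + CA * face_step a b (T - c\<^sup>2) + BC * face_step b a (T - c\<^sup>2)"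
    using T abc unfolding steps by (subst face_moment_steps; simp add: less_diff_eq add.commute)+
  have step1: "of_bool (x\<^sup>2 < T) * (F_piece2 x y z t - F_piece1 x t) = of_bool (x\<^sup>2 < T) *
      (12 * (tent_step x T - tent_base y (T - x\<^sup>2) - tent_base z (T - x\<^sup>2) + x\<^sup>2 * face_base y z (T - x\<^sup>2)))" for x y z
    using F_step1_eq[OF t(1), of x y z] by (auto simp: T_def)
  have step2: "of_bool (x\<^sup>2 + y\<^sup>2 < T) * (F_piece3 x y z t - F_piece2 x y z t) = of_bool (x\<^sup>2 + y\<^sup>2 < T) *
      (12 * (- tent_step y (T - x\<^sup>2) - tent_step x (T - y\<^sup>2) + tent_base z (T - x\<^sup>2 - y\<^sup>2)
        + x\<^sup>2 * face_step y z (T - x\<^sup>2) + y\<^sup>2 * face_step x z (T - y\<^sup>2)))" if "0 < x" "0 < y" for x y z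
    using F_step2_eq[OF that, of t z] by (auto simp: T_def)
  have Fs: "F x y z t = 12 * tent_base x T + of_bool (x\<^sup>2 < T) *
      (12 * (tent_step x T - tent_base y (T - x\<^sup>2) - tent_base z (T - x\<^sup>2) + x\<^sup>2 * face_base y z (T - x\<^sup>2)))
      + of_bool (x\<^sup>2 + y\<^sup>2 < T) * (12 * (- tent_step y (T - x\<^sup>2) - tent_step x (T - y\<^sup>2) + tent_base z (T - x\<^sup>2 - y\<^sup>2)
        + x\<^sup>2 * face_step y z (T - x\<^sup>2) + y\<^sup>2 * face_step x z (T - y\<^sup>2)))"
    if "0 < x" "0 < y" "0 < z" "t < sqrt (x\<^sup>2 + y\<^sup>2 + z\<^sup>2)" "t \<noteq> x" "t \<noteq> sqrt (x\<^sup>2 + y\<^sup>2)" for x y z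
    using F_steps[OF that(1-3) t(1) that(4-6)] step1[of x y z] step2[OF that(1,2), of z] F_piece1_eq[OF t(1), of x]
    by (simp only: T_def)
  have "t < sqrt (b\<^sup>2 + c\<^sup>2 + a\<^sup>2)" "t < sqrt (c\<^sup>2 + a\<^sup>2 + b\<^sup>2)"
    using t by (simp_all add: add_ac)
  note F_abc = Fs[OF abc t(2) ne(1,4), folded steps]
    and F_bca = Fs[OF abc(2,3,1) this(1) ne(2,5), folded steps]
    and F_cab = Fs[OF abc(3,1,2) this(2) ne(3,6), folded steps]
  define S where "S = (box_moment a b c T + a\<^sup>2 * face_moment b c (T - a\<^sup>2))
      + (box_moment b c a T + b\<^sup>2 * face_moment c a (T - b\<^sup>2)) + (box_moment c a b T + c\<^sup>2 * face_moment a b (T - c\<^sup>2))"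
  have "F a b c t + F b c a t + F c a b t = 12 * S"
    unfolding S_def boxes faces F_abc F_bca F_cab by (simp add: algebra_simps)
  moreover have "chord_density a b c t + chord_density b c a t + chord_density c a b t = 8 * S / t ^ 3"
    unfolding chord_density_def T_def[symmetric] S_def by (simp only: distrib_left add_divide_distrib)
  ultimately show ?thesis
    by simp
qed

lemma chord_density_beyond_diameter:
  assumes abc: "0 < a" "0 < b" "0 < c" and t: "sqrt (a\<^sup>2 + b\<^sup>2 + c\<^sup>2) < t"
  shows "chord_density a b c t = 0"
proof -
  have "0 \<le> sqrt (a\<^sup>2 + b\<^sup>2 + c\<^sup>2)" by simp
  hence "0 < t" using t by linarith
  hence T: "a\<^sup>2 + b\<^sup>2 + c\<^sup>2 < t\<^sup>2"
    using t real_sqrt_less_iff[of "a\<^sup>2 + b\<^sup>2 + c\<^sup>2" "t\<^sup>2"] by simp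
  have big: "tent_moment a R = a\<^sup>2 * R / 2 - a ^ 4 / 12" if "a\<^sup>2 < R" for R
  proof -
    have "0 < R" using that by (rule le_less_trans[OF zero_le_power2])
    thus ?thesis using that by (simp add: tent_moment_def)
  qed
  have "0 < a\<^sup>2" "0 < b\<^sup>2" "0 < c\<^sup>2" using abc by auto
  hence "a\<^sup>2 < t\<^sup>2" "a\<^sup>2 < t\<^sup>2 - b\<^sup>2" "a\<^sup>2 < t\<^sup>2 - c\<^sup>2" "a\<^sup>2 < t\<^sup>2 - b\<^sup>2 - c\<^sup>2"
    using T by linarith+
  hence "box_moment a b c (t\<^sup>2) = 0"
    by (simp add: box_moment_def big field_simps)
  moreover have "face_moment b c (t\<^sup>2 - a\<^sup>2) = 0"
    using T by (simp add: face_moment_def)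
  ultimately show ?thesis by (simp add: chord_density_def)
qed

section \<open>The law of the chord length\<close>

lemma sets_chord_tail: 
  assumes "K \<in> sets borel"
  shows "{l \<in> directed_lines. t < chord_length K l} \<in> sets line_measure"
proof -
  note [measurable] = borel_measurable_chord_length[OF assms]
  have "{l. t < chord_length K l} \<in> sets borel"
    by measurable
  thus ?thesis
    by (auto simp: sets_restrict_space_iff Int_def[symmetric] Collect_conj_eq)
qed

lemma sets_hitting_lines:
  assumes "compact K"
  shows "hitting_lines K \<in> sets line_measure"
  using compact_hitting_lines[OF assms]
  by (auto simp: sets_restrict_space_iff compact_imp_closed hitting_lines_def)

lemma emeasure_chord_tail:
  assumes abc: "0 < a" "0 < b" "0 < c" and t: "0 \<le> t"
  shows "emeasure line_measure {l \<in> directed_lines. t < chord_length (box3 a b c) l}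
    = (\<integral>\<^sup>+s\<in>{t<..}. ennreal (chord_density a b c s + chord_density b c a s + chord_density c a b s) \<partial>lborel)"
proof -
  have "emeasure line_measure {l \<in> directed_lines. t < chord_length (box3 a b c) l}
      = (\<integral>\<^sup>+v. emeasure (plane_area v) {q. (v, q) \<in> {l \<in> directed_lines. t < chord_length (box3 a b c) l}} \<partial>sphere_area)"
    by (rule emeasure_line_measure[OF sets_chord_tail]) (simp add: box3_eq_cbox)
  also have "\<dots> = (\<integral>\<^sup>+v. ennreal (tail_area a b c t \<bar>v $ 1\<bar> \<bar>v $ 2\<bar> \<bar>v $ 3\<bar>) \<partial>sphere_area)"
  proof (rule nn_integral_cong)
    fix v assume "v \<in> space sphere_area"
    hence v: "norm v = 1" by simp
    hence "{q. (v, q) \<in> {l \<in> directed_lines. t < chord_length (box3 a b c) l}}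
        = {q \<in> perp v. t < chord_length (box3 a b c) (v, q)}"
      by (auto simp: directed_lines_def)
    thus "emeasure (plane_area v) {q. (v, q) \<in> {l \<in> directed_lines. t < chord_length (box3 a b c) l}}
        = ennreal (tail_area a b c t \<bar>v $ 1\<bar> \<bar>v $ 2\<bar> \<bar>v $ 3\<bar>)"
      using emeasure_chord_tail_direction[OF v t, of 0 "vector [a, b, c]"] by (simp add: box3_eq_cbox)
  qed
  also have "\<dots> = (\<integral>\<^sup>+s\<in>{t<..}. ennreal (chord_density a b c s + chord_density b c a s + chord_density c a b s) \<partial>lborel)"
    by (rule sphere_integral_tail_area[OF abc t])
  finally show ?thesis .
qed

lemma emeasure_hitting_lines_eq:
  assumes abc: "0 < a" "0 < b" "0 < c"
  shows "emeasure line_measure (hitting_lines (box3 a b c))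
    = (\<integral>\<^sup>+v. ennreal (tail_area a b c 0 \<bar>v $ 1\<bar> \<bar>v $ 2\<bar> \<bar>v $ 3\<bar>) \<partial>sphere_area)"
proof -
  have "emeasure line_measure (hitting_lines (box3 a b c))
      = (\<integral>\<^sup>+v. emeasure (plane_area v) {q. (v, q) \<in> hitting_lines (box3 a b c)} \<partial>sphere_area)"
    by (rule emeasure_line_measure[OF sets_hitting_lines]) (simp add: box3_eq_cbox)
  also have "\<dots> = (\<integral>\<^sup>+v. ennreal (tail_area a b c 0 \<bar>v $ 1\<bar> \<bar>v $ 2\<bar> \<bar>v $ 3\<bar>) \<partial>sphere_area)"
    by (intro nn_integral_cong emeasure_shadow_direction abc) simp
  finally show ?thesis .
qed

text \<open>
  For a box of surface area \<open>S\<close> this is Cauchy's formula, which gives the value \<open>\<pi> S\<close>.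
\<close>

lemma emeasure_hitting_lines_box:
  assumes abc: "0 < a" "0 < b" "0 < c"
  shows "emeasure line_measure (hitting_lines (box3 a b c)) = ennreal (2 * pi * (a * b + a * c + b * c))"
proof -
  have f: "(\<lambda>(x, y, z). ennreal x) \<in> borel_measurable (borel :: (real \<times> real \<times> real) measure)"
    "(\<lambda>(x, y, z). ennreal y) \<in> borel_measurable (borel :: (real \<times> real \<times> real) measure)"
    unfolding borel_prod[symmetric] by measurable
  have mean: "(\<integral>\<^sup>+v. ennreal \<bar>v $ 1\<bar> \<partial>sphere_area) = ennreal (2 * pi)"
    "(\<integral>\<^sup>+v. ennreal \<bar>v $ 2\<bar> \<partial>sphere_area) = ennreal (2 * pi)"
    "(\<integral>\<^sup>+v. ennreal \<bar>v $ 3\<bar> \<partial>sphere_area) = ennreal (2 * pi)"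
    using sphere_area_cyclic[OF f(1)] sphere_area_cyclic[OF f(2)] mean_abs_component_sphere by simp_all
  have m [measurable]: "(\<lambda>v. ennreal \<bar>v $ i\<bar>) \<in> borel_measurable sphere_area" for i
    by (simp add: sphere_area_def measurable_restrict_space1)
  have "(\<integral>\<^sup>+v. ennreal (tail_area a b c 0 \<bar>v $ 1\<bar> \<bar>v $ 2\<bar> \<bar>v $ 3\<bar>) \<partial>sphere_area)
      = (\<integral>\<^sup>+v. ennreal (b * c) * ennreal \<bar>v $ 1\<bar> + ennreal (c * a) * ennreal \<bar>v $ 2\<bar> + ennreal (a * b) * ennreal \<bar>v $ 3\<bar> \<partial>sphere_area)"
    using abc by (intro nn_integral_cong) (simp add: tail_area_def ennreal_mult'[symmetric] mult_ac)
  also have "\<dots> = ennreal (b * c) * ennreal (2 * pi) + ennreal (c * a) * ennreal (2 * pi) + ennreal (a * b) * ennreal (2 * pi)"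
    by (simp add: nn_integral_add nn_integral_cmult[OF m] mean)
  also have "\<dots> = ennreal (2 * pi * (a * b + a * c + b * c))"
    using abc by (simp add: ennreal_mult'[symmetric] ennreal_plus[symmetric] algebra_simps del: ennreal_plus)
  finally show ?thesis by (simp add: emeasure_hitting_lines_eq[OF abc])
qed

lemma borel_measurable_F [measurable]: "F a b c \<in> borel_measurable borel"
proof -
  have [measurable]: "arctan \<in> borel_measurable borel"
    by (intro borel_measurable_continuous_onI continuous_intros)
  show ?thesis unfolding F_def[abs_def] by measurable
qed

theorem theorem5:
  fixes a b c :: real
  assumes "a > 0" and "b > 0" and "c > 0"
  shows "is_pdf (random_line (box3 a b c)) (chord_length (box3 a b c))
    (\<lambda>t. if 0 < t \<and> t < sqrt (a^2 + b^2 + c^2)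
         then (F a b c t + F b c a t + F c a b t) / (3 * pi * t^3 * (a * b + a * c + b * c))
         else 0)"
proof -
  note abc = assms
  let ?K = "box3 a b c"
  define f where "f = (\<lambda>t. if 0 < t \<and> t < sqrt (a^2 + b^2 + c^2)
         then (F a b c t + F b c a t + F c a b t) / (3 * pi * t^3 * (a * b + a * c + b * c))
         else 0)"
  define D where "D = (\<lambda>s. chord_density a b c s + chord_density b c a s + chord_density c a b s)"
  define N where "N = 2 * pi * (a * b + a * c + b * c)"
  define H where "H = hitting_lines ?K"
  have N: "0 < N" using abc by (simp add: N_def add_pos_pos)
  have fm [measurable]: "f \<in> borel_measurable borel"
    unfolding f_def by measurable
  have [measurable]: "chord_density a b c \<in> borel_measurable borel" "chord_density b c a \<in> borel_measurable borel"
      "chord_density c a b \<in> borel_measurable borel"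
    using abc by (simp_all add: borel_measurable_chord_density)
  have Dm [measurable]: "D \<in> borel_measurable borel"
    unfolding D_def by measurable
  have D0: "0 \<le> D s" if "0 < s" for s
    using that abc by (simp add: D_def chord_density_nonneg)
  have fD: "AE t in lborel. f t = indicator {0<..} t * (D t / N)"
  proof -
    let ?E = "{0, a, b, c, sqrt (a\<^sup>2 + b\<^sup>2), sqrt (b\<^sup>2 + c\<^sup>2), sqrt (c\<^sup>2 + a\<^sup>2), sqrt (a\<^sup>2 + b\<^sup>2 + c\<^sup>2)}"
    have "AE t in lborel. t \<notin> ?E"
      by (intro AE_not_in finite_imp_null_set_lborel) simp
    thus ?thesis
    proof (rule AE_mp, intro AE_I2 impI)
      fix t assume t: "t \<notin> ?E"
      consider "t < 0" | "0 < t" "t < sqrt (a\<^sup>2 + b\<^sup>2 + c\<^sup>2)" | "sqrt (a\<^sup>2 + b\<^sup>2 + c\<^sup>2) < t"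
        using t by fastforce
      thus "f t = indicator {0<..} t * (D t / N)"
      proof cases
        case 1
        thus ?thesis by (simp add: f_def)
      next
        case 2
        have "D t = 2 * (F a b c t + F b c a t + F c a b t) / (3 * t ^ 3)"
          unfolding D_def using t 2 by (intro chord_density_eq_F abc) auto
        moreover have "2 * X / (3 * k) / (2 * pi * S) = X / (3 * pi * k * S)" for X k S :: real
          by (simp add: divide_simps)
        ultimately show ?thesis using 2 by (simp only: f_def N_def) simp
      next
        case 3
        hence "D t = 0"
          unfolding D_def using abc
          by (simp add: chord_density_beyond_diameter add_ac)
        thus ?thesis using 3 by (simp add: f_def)
      qed
    qed
  qed
  have tail: "emeasure line_measure (H \<inter> {l \<in> directed_lines. x < chord_length ?K l})
      = (\<integral>\<^sup>+s\<in>{max 0 x<..}. ennreal (D s) \<partial>lborel)" for x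
  proof (cases "0 \<le> x")
    case True
    have "{l \<in> directed_lines. x < chord_length ?K l} \<subseteq> H"
      unfolding H_def using True by (auto intro: positive_chord_hits)
    hence "H \<inter> {l \<in> directed_lines. x < chord_length ?K l} = {l \<in> directed_lines. x < chord_length ?K l}"
      by blast
    thus ?thesis
      using True emeasure_chord_tail[OF abc True] by (simp add: D_def max_def)
  next
    case False
    have "0 \<le> chord_length ?K l" for l
      by (cases l) (simp add: chord_length_def)
    hence "x < chord_length ?K l" for l
      using False by (meson less_le_trans not_le)
    hence "H \<inter> {l \<in> directed_lines. x < chord_length ?K l} = H"
      by (auto simp: H_def hitting_lines_def)
    thus ?thesis
      using False sphere_integral_tail_area[OF abc order_refl]
      by (simp add: H_def emeasure_hitting_lines_eq[OF abc] D_def max_def)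
  qed
  have HN: "emeasure line_measure H = ennreal N"
    unfolding H_def N_def by (rule emeasure_hitting_lines_box[OF abc])
  have M: "random_line ?K = uniform_measure line_measure H"
    by (simp add: random_line_def H_def hitting_lines_def)
  have Hs: "H \<in> sets line_measure"
    unfolding H_def by (rule sets_hitting_lines) (simp add: box3_eq_cbox)
  have Ks: "?K \<in> sets borel"
    by (simp add: box3_eq_cbox)
  have X: "chord_length ?K \<in> borel_measurable (random_line ?K)"
  proof -
    have "chord_length ?K \<in> borel_measurable borel"
      by (rule borel_measurable_chord_length[OF Ks])
    hence "chord_length ?K \<in> borel_measurable (restrict_space borel directed_lines)"
      by (rule measurable_restrict_space1)
    thus ?thesis
      unfolding M by (simp cong: measurable_cong_sets)
  qed
  have prob: "emeasure (random_line ?K) {l \<in> directed_lines. x < chord_length ?K l}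
      = (\<integral>\<^sup>+s\<in>{max 0 x<..}. ennreal (D s) \<partial>lborel) / ennreal N" for x
    unfolding M emeasure_uniform_measure[OF Hs sets_chord_tail[OF Ks]] tail HN ..
  \<comment> \<open>Below \<open>0\<close> both tails are constant, hence the maximum.\<close>
  have dens: "emeasure (density lborel (\<lambda>t. ennreal (f t))) {x<..}
      = (\<integral>\<^sup>+s\<in>{max 0 x<..}. ennreal (D s) \<partial>lborel) / ennreal N" for x
  proof -
    have "emeasure (density lborel (\<lambda>t. ennreal (f t))) {x<..} = (\<integral>\<^sup>+t. ennreal (f t) * indicator {x<..} t \<partial>lborel)"
      by (rule emeasure_density) auto
    also have "\<dots> = (\<integral>\<^sup>+t. ennreal (D t) * indicator {max 0 x<..} t / ennreal N \<partial>lborel)"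
    proof (rule nn_integral_cong_AE, rule AE_mp[OF fD], rule AE_I2, rule impI)
      fix t assume "f t = indicator {0<..} t * (D t / N)"
      thus "ennreal (f t) * indicator {x<..} t = ennreal (D t) * indicator {max 0 x<..} t / ennreal N"
        using D0[of t] N by (auto simp: indicator_def divide_ennreal)
    qed
    also have "\<dots> = (\<integral>\<^sup>+s\<in>{max 0 x<..}. ennreal (D s) \<partial>lborel) / ennreal N"
      by (rule nn_integral_divide) measurable
    finally show ?thesis .
  qed
  have law: "distr (random_line ?K) lborel (chord_length ?K) = density lborel (\<lambda>t. ennreal (f t))"
  proof (rule measure_eqI_lessThan)
    show "sets (distr (random_line ?K) lborel (chord_length ?K)) = sets borel"
      "sets (density lborel (\<lambda>t. ennreal (f t))) = sets borel" by simp_all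
    fix x :: real
    have sp: "space (random_line ?K) = directed_lines" by (simp add: M)
    have "emeasure (distr (random_line ?K) lborel (chord_length ?K)) {x<..}
        = emeasure (random_line ?K) {l \<in> directed_lines. x < chord_length ?K l}"
      using X by (subst emeasure_distr) (auto simp: sp vimage_def intro!: arg_cong2[where f = emeasure])
    thus eq: "emeasure (distr (random_line ?K) lborel (chord_length ?K)) {x<..}
        = emeasure (density lborel (\<lambda>t. ennreal (f t))) {x<..}"
      by (simp only: prob dens)
    have "emeasure (density lborel (\<lambda>t. ennreal (f t))) {x<..} \<le> ennreal N / ennreal N"
    proof -
      have "(\<integral>\<^sup>+s\<in>{max 0 x<..}. ennreal (D s) \<partial>lborel) \<le> ennreal N"
        unfolding tail[symmetric] HN[symmetric] by (rule emeasure_mono[OF _ Hs]) simp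
      thus ?thesis unfolding dens by (intro divide_right_mono_ennreal)
    qed
    also have "\<dots> < \<infinity>" using N by (simp add: divide_ennreal)
    finally show "emeasure (distr (random_line ?K) lborel (chord_length ?K)) {x<..} < \<infinity>"
      unfolding eq .
  qed
  have "AE t in lborel. 0 \<le> f t"
  proof (rule AE_mp[OF fD], intro AE_I2 impI)
    fix t assume "f t = indicator {0<..} t * (D t / N)"
    thus "0 \<le> f t" using D0[of t] N by (simp add: indicator_def)
  qed
  moreover have "distributed (random_line ?K) lborel (chord_length ?K) (\<lambda>t. ennreal (f t))"
    unfolding distributed_def using X law by simp
  ultimately show ?thesis
    unfolding is_pdf_def f_def by blast
qed

end
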